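(* Let $\mathfrak g$ be a finite dimensional simple complex Lie algebra, let $V_1,\dots,V_N$ be finite dimensional irreducible representations of $\mathfrak g$, $V=V_1\otimes\cdots\otimes V_N$, and let $z_1,\dots,z_N\in\mathbb C$ be fixed parameters, pairwise distinct modulo $\mathbb Z+\mathbb Z\tau$. Let $\hat\tau(u)$ be the differential operator acting on $V^*(0)$-valued functions on $S$ defined by $$\hat\tau(u)=\frac12\sum_{r=1}^l\nabla_{\xi_r,u}^2+\frac12\sum_{i,j=1}^N\sum_{\alpha\in\Delta}w_{\alpha(H)}(z_i-u)\,w_{-\alpha(H)}(z_j-u)\,\rho_j^*(e_{-\alpha})\rho_i^*(e_\alpha),$$ $$\nabla_{\xi_r,u}=\frac{\partial}{\partial\xi_r}-\sum_{i=1}^N\zeta_{11}(z_i-u)\,\rho_i^*(h_r).$$ Then for all spectral parameters $u,u'\in\mathbb C$ (not congruent to any $z_i$ modulo $\mathbb Z+\mathbb Z\tau$), $$[\hat\tau(u),\hat\tau(u')]=0.$$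
   Context: Fix $\tau\in\mathbb C$ with $\operatorname{Im}\tau>0$. Let $\mathfrak h\subset\mathfrak g$ be a Cartan subalgebra, $l=\dim\mathfrak h$, $\Delta$ the set of roots, $\mathfrak g=\mathfrak h\oplus\bigoplus_{\alpha\in\Delta}\mathfrak g_\alpha$. The inner product is $(A\mid B)=\frac1{2h^\vee}\operatorname{Tr}_{\mathfrak g}(\operatorname{ad}A\,\operatorname{ad}B)$, where $h^\vee$ is the dual Coxeter number. Choose $e_\alpha\in\mathfrak g_\alpha$ with $(e_\alpha\mid e_{-\alpha'})=\delta_{\alpha,\alpha'}$, an orthonormal basis $h_1,\dots,h_l$ of $\mathfrak h$, and the associated coordinates $H=\sum_r\xi_rh_r$ on $\mathfrak h$. $S=\{H\in\mathfrak h\mid\alpha(H)\notin\mathbb Z+\mathbb Z\tau\text{ for all }\alpha\in\Delta\}$. $\rho_i$ denotes the action of $\mathfrak g$ on the $i$-th tensor factor of $V$. For $\Phi\in V^*=\operatorname{Hom}_{\mathbb C}(V,\mathbb C)$ put $(\rho_i^*(A)\Phi)(v)=\Phi(\rho_i(A)v)$ (a right action). $V^*(0)$ is the $0$-weight space of $V^*$ with respect to $\mathfrak h$, identified with the dual of the $0$-weight space $V(0)$ of $V$. Theta function: $\theta_{11}(z)=\theta_{11}(z,\tau)=\sum_{n\in\mathbb Z}\exp\left(\pi i\tau(n+\tfrac12)^2+2\pi i(z+\tfrac12)(n+\tfrac12)\right)$. Further, $$w_c(z)=\frac{\theta_{11}'(0)\,\theta_{11}(z-c)}{\theta_{11}(z)\,\theta_{11}(-c)},\qquad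 \zeta_{11}(z)=\frac{d}{dz}\log\theta_{11}(z).$$ *)

theory Defs
  imports "HOL-Analysis.Analysis"
begin

section \<open>Theta functions\<close>

definition period_lattice :: "complex \<Rightarrow> complex set" where
  "period_lattice \<tau> = {of_int m + of_int n * \<tau> | m n. True}"

definition theta11 :: "complex \<Rightarrow> complex \<Rightarrow> complex" where
  "theta11 \<tau> z = (\<Sum>\<^sub>\<infinity>n::int.
     exp (of_real pi * \<i> * \<tau> * (of_int n + 1/2)^2
          + 2 * of_real pi * \<i> * (z + 1/2) * (of_int n + 1/2)))"

definition w_fun :: "complex \<Rightarrow> complex \<Rightarrow> complex \<Rightarrow> complex" where
  "w_fun \<tau> c z =
     deriv (theta11 \<tau>) 0 * theta11 \<tau> (z - c) / (theta11 \<tau> z * theta11 \<tau> (- c))"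

text \<open>The derivative of the multivalued function \<open>log \<theta>\<^sub>1\<^sub>1\<close> is written as the logarithmic
  derivative, so that no branch cut of the principal logarithm interferes.\<close>

definition zeta11 :: "complex \<Rightarrow> complex \<Rightarrow> complex" where
  "zeta11 \<tau> z = deriv (theta11 \<tau>) z / theta11 \<tau> z"


section \<open>Linear algebra\<close>

text \<open>Several spaces below are subspaces \<open>V\<close> of an ambient type; only the behaviour of a map on
  \<open>V\<close> is relevant, which \<^const>\<open>Vector_Spaces.linear\<close> (linearity on a whole type) does not
  express.\<close>

definition linear_on_subspace ::
  "(complex \<Rightarrow> 'a::ab_group_add \<Rightarrow> 'a) \<Rightarrow> (complex \<Rightarrow> 'b::ab_group_add \<Rightarrow> 'b)
    \<Rightarrow> 'a set \<Rightarrow> ('a \<Rightarrow> 'b) \<Rightarrow> bool" where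
  "linear_on_subspace s1 s2 V f \<longleftrightarrow>
     (\<forall>x\<in>V. \<forall>y\<in>V. f (x + y) = f x + f y) \<and> (\<forall>c. \<forall>x\<in>V. f (s1 c x) = s2 c (f x))"

text \<open>Trace of an endomorphism of a finite-dimensional space; the value does not depend on the
  chosen basis.\<close>

definition (in vector_space) endo_trace :: "('b \<Rightarrow> 'b) \<Rightarrow> 'a" where
  "endo_trace f =
     (let B = (SOME B. independent B \<and> span B = UNIV) in \<Sum>b\<in>B. representation B (f b) b)"

definition multilinear_on ::
  "(complex \<Rightarrow> 'v::ab_group_add \<Rightarrow> 'v) \<Rightarrow> (complex \<Rightarrow> 'w::ab_group_add \<Rightarrow> 'w)
    \<Rightarrow> 'i set \<Rightarrow> ('i \<Rightarrow> 'v set) \<Rightarrow> (('i \<Rightarrow> 'v) \<Rightarrow> 'w) \<Rightarrow> bool" where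
  "multilinear_on sv sw I V t \<longleftrightarrow>
     (\<forall>v \<in> (\<Pi>\<^sub>E i\<in>I. V i). \<forall>i\<in>I. linear_on_subspace sv sw (V i) (\<lambda>x. t (v(i := x))))"

text \<open>The vector space \<open>'w\<close> (with scalar multiplication \<open>sw\<close>) together with
  \<open>t (v\<^sub>1, \<dots>, v\<^sub>N) = v\<^sub>1 \<otimes> \<dots> \<otimes> v\<^sub>N\<close> is a tensor product of the spaces \<open>V i\<close>. The universal
  property is stated for multilinear forms; over a field this implies it for multilinear
  maps into every vector space: uniqueness of the factorisation means that the elementary
  tensors span \<open>'w\<close>, existence means that they satisfy no relations besides the multilinear
  ones.\<close>

definition is_tensor_product ::
  "(complex \<Rightarrow> 'v::ab_group_add \<Rightarrow> 'v) \<Rightarrow> (complex \<Rightarrow> 'w::ab_group_add \<Rightarrow> 'w)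
    \<Rightarrow> 'i set \<Rightarrow> ('i \<Rightarrow> 'v set) \<Rightarrow> (('i \<Rightarrow> 'v) \<Rightarrow> 'w) \<Rightarrow> bool" where
  "is_tensor_product sv sw I V t \<longleftrightarrow>
     vector_space sw \<and> multilinear_on sv sw I V t \<and>
     (\<forall>\<phi> :: ('i \<Rightarrow> 'v) \<Rightarrow> complex. multilinear_on sv (*) I V \<phi> \<longrightarrow>
        (\<exists>!f. Vector_Spaces.linear sw (*) f \<and> (\<forall>v \<in> (\<Pi>\<^sub>E i\<in>I. V i). f (t v) = \<phi> v)))"

text \<open>Holomorphy in several variables: real Frechet differentiability with complex linear
  derivative.\<close>

definition holomorphic_several :: "(complex^'n \<Rightarrow> complex) \<Rightarrow> (complex^'n) set \<Rightarrow> bool" where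
  "holomorphic_several f D \<longleftrightarrow>
     (\<forall>\<xi>\<in>D. \<exists>L. (f has_derivative L) (at \<xi>) \<and> (\<forall>c x. L (c *s x) = c * L x))"


section \<open>Complex Lie algebras and root decomposition\<close>

locale lie_algebra = vector_space scale
  for scale :: "complex \<Rightarrow> 'g::ab_group_add \<Rightarrow> 'g" +
  fixes bracket :: "'g \<Rightarrow> 'g \<Rightarrow> 'g"
  assumes bracket_linear_left: "Vector_Spaces.linear scale scale (\<lambda>x. bracket x y)"
    and bracket_linear_right: "Vector_Spaces.linear scale scale (bracket x)"
    and bracket_self: "bracket x x = 0"
    and jacobi: "bracket x (bracket y z) + bracket y (bracket z x) + bracket z (bracket x y) = 0"
begin

definition finite_dim :: bool where
  "finite_dim \<longleftrightarrow> (\<exists>B. finite B \<and> span B = UNIV)"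

definition lie_ideal :: "'g set \<Rightarrow> bool" where
  "lie_ideal J \<longleftrightarrow> subspace J \<and> (\<forall>x. \<forall>y\<in>J. bracket x y \<in> J)"

definition simple_lie :: bool where
  "simple_lie \<longleftrightarrow> (\<exists>x y. bracket x y \<noteq> 0) \<and> (\<forall>J. lie_ideal J \<longrightarrow> J = {0} \<or> J = UNIV)"

definition abelian_subalgebra :: "'g set \<Rightarrow> bool" where
  "abelian_subalgebra k \<longleftrightarrow> subspace k \<and> (\<forall>x\<in>k. \<forall>y\<in>k. bracket x y = 0)"

text \<open>Cartan subalgebra of a complex semisimple Lie algebra: a maximal abelian subalgebra all of
  whose elements are ad-semisimple (that is, ad-diagonalisable, as the field is \<open>\<complex>\<close>).\<close>

definition cartan_subalgebra :: "'g set \<Rightarrow> bool" where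
  "cartan_subalgebra h \<longleftrightarrow>
     abelian_subalgebra h \<and>
     (\<forall>k. abelian_subalgebra k \<and> h \<subseteq> k \<longrightarrow> k = h) \<and>
     (\<forall>H\<in>h. span {x. \<exists>c. bracket H x = scale c x} = UNIV)"

definition root_space :: "'g set \<Rightarrow> ('g \<Rightarrow> complex) \<Rightarrow> 'g set" where
  "root_space h \<alpha> = {x. \<forall>H\<in>h. bracket H x = scale (\<alpha> H) x}"

text \<open>Elements of the dual of \<open>h\<close> are represented by functions on all of \<open>'g\<close> that vanish outside
  the set \<open>h\<close> (and are linear on \<open>h\<close>). This makes the representing function unique, and
  pointwise negation \<open>- \<alpha>\<close> represents the negative functional.\<close>

definition roots :: "'g set \<Rightarrow> ('g \<Rightarrow> complex) set" where
  "roots h = {\<alpha>. linear_on_subspace scale (*) h \<alpha> \<and> (\<forall>x. x \<notin> h \<longrightarrow> \<alpha> x = 0) \<and>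
                 (\<exists>H\<in>h. \<alpha> H \<noteq> 0) \<and> root_space h \<alpha> \<noteq> {0}}"

definition simple_roots :: "'g set \<Rightarrow> ('g \<Rightarrow> complex) set \<Rightarrow> bool" where
  "simple_roots h P \<longleftrightarrow>
     finite P \<and> P \<subseteq> roots h \<and>
     (\<forall>c :: ('g \<Rightarrow> complex) \<Rightarrow> complex.
        (\<forall>H\<in>h. (\<Sum>\<alpha>\<in>P. c \<alpha> * \<alpha> H) = 0) \<longrightarrow> (\<forall>\<alpha>\<in>P. c \<alpha> = 0)) \<and>
     (\<forall>\<beta>\<in>roots h. \<exists>n :: ('g \<Rightarrow> complex) \<Rightarrow> nat.
        (\<forall>H\<in>h. \<beta> H = (\<Sum>\<alpha>\<in>P. of_nat (n \<alpha>) * \<alpha> H)) \<or>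
        (\<forall>H\<in>h. \<beta> H = - (\<Sum>\<alpha>\<in>P. of_nat (n \<alpha>) * \<alpha> H)))"

definition highest_root :: "'g set \<Rightarrow> ('g \<Rightarrow> complex) set \<Rightarrow> ('g \<Rightarrow> complex) \<Rightarrow> bool" where
  "highest_root h P \<theta> \<longleftrightarrow>
     \<theta> \<in> roots h \<and>
     (\<forall>\<beta>\<in>roots h. \<exists>n :: ('g \<Rightarrow> complex) \<Rightarrow> nat.
        \<forall>H\<in>h. \<theta> H - \<beta> H = (\<Sum>\<alpha>\<in>P. of_nat (n \<alpha>) * \<alpha> H))"

definition coroot :: "'g set \<Rightarrow> ('g \<Rightarrow> complex) \<Rightarrow> 'g" where
  "coroot h \<alpha> =
     (THE T. T \<in> span {bracket x y | x y. x \<in> root_space h \<alpha> \<and> y \<in> root_space h (- \<alpha>)} \<and>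
             \<alpha> T = 2)"

text \<open>\<open>h\<^sup>\<or> = 1 + \<Sum> a\<^sub>i\<^sup>\<or>\<close>, where the \<open>a\<^sub>i\<^sup>\<or>\<close> are the coefficients of the coroot of the highest root
  in terms of the simple coroots. The value does not depend on the choice of simple roots
  (nor on \<open>h\<close>).\<close>

definition dual_coxeter_number :: "'g set \<Rightarrow> complex" where
  "dual_coxeter_number h =
     (THE k. \<exists>P \<theta> a. simple_roots h P \<and> highest_root h P \<theta> \<and>
               coroot h \<theta> = (\<Sum>\<alpha>\<in>P. scale (a \<alpha>) (coroot h \<alpha>)) \<and>
               k = 1 + (\<Sum>\<alpha>\<in>P. a \<alpha>))"

definition inner_form :: "'g set \<Rightarrow> 'g \<Rightarrow> 'g \<Rightarrow> complex" where
  "inner_form h A B =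
     1 / (2 * dual_coxeter_number h) * endo_trace (\<lambda>x. bracket A (bracket B x))"

definition regular_set :: "complex \<Rightarrow> 'g set \<Rightarrow> 'g set" where
  "regular_set \<tau> h = {H \<in> h. \<forall>\<alpha>\<in>roots h. \<alpha> H \<notin> period_lattice \<tau>}"


subsection \<open>Representations\<close>

text \<open>\<open>r\<close> is an action of the Lie algebra on the subspace \<open>V\<close> of \<open>'v\<close>; working with
  subspaces of one type allows families of representations of different dimensions.\<close>

definition lie_representation ::
  "(complex \<Rightarrow> 'v::ab_group_add \<Rightarrow> 'v) \<Rightarrow> 'v set \<Rightarrow> ('g \<Rightarrow> 'v \<Rightarrow> 'v) \<Rightarrow> bool" where
  "lie_representation sv V r \<longleftrightarrow>
     module.subspace sv V \<and>
     (\<forall>A. \<forall>v\<in>V. r A v \<in> V) \<and>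
     (\<forall>A. linear_on_subspace sv sv V (r A)) \<and>
     (\<forall>v\<in>V. Vector_Spaces.linear scale sv (\<lambda>A. r A v)) \<and>
     (\<forall>A B. \<forall>v\<in>V. r (bracket A B) v = r A (r B v) - r B (r A v))"

definition finite_dim_irreducible_rep ::
  "(complex \<Rightarrow> 'v::ab_group_add \<Rightarrow> 'v) \<Rightarrow> 'v set \<Rightarrow> ('g \<Rightarrow> 'v \<Rightarrow> 'v) \<Rightarrow> bool" where
  "finite_dim_irreducible_rep sv V r \<longleftrightarrow>
     lie_representation sv V r \<and>
     (\<exists>B. finite B \<and> module.span sv B = V) \<and>
     V \<noteq> {0} \<and>
     (\<forall>U. module.subspace sv U \<and> U \<subseteq> V \<and> (\<forall>A. \<forall>v\<in>U. r A v \<in> U) \<longrightarrow> U = {0} \<or> U = V)"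

end

text \<open>\<open>\<rho> i A\<close> is the action of \<open>A\<close> on the \<open>i\<close>-th tensor factor. The condition determines
  \<open>\<rho> i A\<close> uniquely for \<open>i \<in> I\<close>, since elementary tensors span the tensor product.\<close>

definition factor_action ::
  "(complex \<Rightarrow> 'w::ab_group_add \<Rightarrow> 'w) \<Rightarrow> 'i set \<Rightarrow> ('i \<Rightarrow> 'v set) \<Rightarrow> ('i \<Rightarrow> 'g \<Rightarrow> 'v \<Rightarrow> 'v)
    \<Rightarrow> (('i \<Rightarrow> 'v) \<Rightarrow> 'w) \<Rightarrow> ('i \<Rightarrow> 'g \<Rightarrow> 'w \<Rightarrow> 'w) \<Rightarrow> bool" where
  "factor_action sw I V r t \<rho> \<longleftrightarrow>
     (\<forall>i\<in>I. \<forall>A. Vector_Spaces.linear sw sw (\<rho> i A) \<and>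
        (\<forall>v \<in> (\<Pi>\<^sub>E i\<in>I. V i). \<rho> i A (t v) = t (v(i := r i A (v i)))))"

definition rho_star ::
  "('i \<Rightarrow> 'g \<Rightarrow> 'w \<Rightarrow> 'w) \<Rightarrow> 'i \<Rightarrow> 'g \<Rightarrow> ('w \<Rightarrow> complex) \<Rightarrow> ('w \<Rightarrow> complex)" where
  "rho_star \<rho> i A \<Phi> = (\<lambda>v. \<Phi> (\<rho> i A v))"

definition zero_weight_dual ::
  "(complex \<Rightarrow> 'w::ab_group_add \<Rightarrow> 'w) \<Rightarrow> 'i set \<Rightarrow> 'g set \<Rightarrow> ('i \<Rightarrow> 'g \<Rightarrow> 'w \<Rightarrow> 'w)
    \<Rightarrow> ('w \<Rightarrow> complex) set" where
  "zero_weight_dual sw I h \<rho> =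
     {\<Phi>. Vector_Spaces.linear sw (*) \<Phi> \<and> (\<forall>H\<in>h. \<forall>v. (\<Sum>i\<in>I. rho_star \<rho> i H \<Phi> v) = 0)}"


section \<open>The differential operators\<close>

context lie_algebra
begin

text \<open>Holomorphic \<open>V\<^sup>*(0)\<close>-valued functions on \<open>S\<close>, where \<open>h\<close> has the coordinates
  \<open>H = \<Sum>\<^sub>r \<xi>\<^sub>r hb\<^sub>r\<close>. Values of \<open>F\<close> outside \<open>S\<close> are irrelevant.\<close>

definition holomorphic_sections ::
  "complex \<Rightarrow> 'g set \<Rightarrow> ('l::finite \<Rightarrow> 'g) \<Rightarrow> (complex \<Rightarrow> 'w::ab_group_add \<Rightarrow> 'w) \<Rightarrow> 'i set
    \<Rightarrow> ('i \<Rightarrow> 'g \<Rightarrow> 'w \<Rightarrow> 'w) \<Rightarrow> ('g \<Rightarrow> 'w \<Rightarrow> complex) set" where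
  "holomorphic_sections \<tau> h hb sw I \<rho> =
     {F. (\<forall>H\<in>regular_set \<tau> h. F H \<in> zero_weight_dual sw I h \<rho>) \<and>
         (\<forall>v. holomorphic_several (\<lambda>\<xi>. F (\<Sum>r\<in>UNIV. scale (\<xi> $ r) (hb r)) v)
                {\<xi>. (\<Sum>r\<in>UNIV. scale (\<xi> $ r) (hb r)) \<in> regular_set \<tau> h})}"

definition partial_xi ::
  "('l \<Rightarrow> 'g) \<Rightarrow> 'l \<Rightarrow> ('g \<Rightarrow> 'w \<Rightarrow> complex) \<Rightarrow> ('g \<Rightarrow> 'w \<Rightarrow> complex)" where
  "partial_xi hb r F = (\<lambda>H v. deriv (\<lambda>s. F (H + scale s (hb r)) v) 0)"

definition nabla ::
  "complex \<Rightarrow> ('l \<Rightarrow> 'g) \<Rightarrow> 'i set \<Rightarrow> ('i \<Rightarrow> 'g \<Rightarrow> 'w \<Rightarrow> 'w) \<Rightarrow> ('i \<Rightarrow> complex) \<Rightarrow> complex \<Rightarrow> 'l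
    \<Rightarrow> ('g \<Rightarrow> 'w \<Rightarrow> complex) \<Rightarrow> ('g \<Rightarrow> 'w \<Rightarrow> complex)" where
  "nabla \<tau> hb I \<rho> z u r F = (\<lambda>H v.
     partial_xi hb r F H v - (\<Sum>i\<in>I. zeta11 \<tau> (z i - u) * rho_star \<rho> i (hb r) (F H) v))"

definition tau_hat ::
  "complex \<Rightarrow> 'g set \<Rightarrow> ('l::finite \<Rightarrow> 'g) \<Rightarrow> (('g \<Rightarrow> complex) \<Rightarrow> 'g) \<Rightarrow> 'i set
    \<Rightarrow> ('i \<Rightarrow> 'g \<Rightarrow> 'w \<Rightarrow> 'w) \<Rightarrow> ('i \<Rightarrow> complex) \<Rightarrow> complex
    \<Rightarrow> ('g \<Rightarrow> 'w \<Rightarrow> complex) \<Rightarrow> ('g \<Rightarrow> 'w \<Rightarrow> complex)" where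
  "tau_hat \<tau> h hb e I \<rho> z u F = (\<lambda>H v.
     1/2 * (\<Sum>r\<in>UNIV. nabla \<tau> hb I \<rho> z u r (nabla \<tau> hb I \<rho> z u r F) H v)
     + 1/2 * (\<Sum>i\<in>I. \<Sum>j\<in>I. \<Sum>\<alpha>\<in>roots h.
         w_fun \<tau> (\<alpha> H) (z i - u) * w_fun \<tau> (- \<alpha> H) (z j - u) *
         rho_star \<rho> j (e (- \<alpha>)) (rho_star \<rho> i (e \<alpha>) (F H)) v))"

end

end

theory Submission
  imports Defs "HOL-Complex_Analysis.Complex_Analysis" "HOL-Library.Function_Algebras"
begin

text \<open>With \<open>L\<^sub>\<alpha>(u) = \<Sum>\<^sub>i w\<^sub>\<alpha>\<^sub>(\<^sub>H\<^sub>)(z\<^sub>i - u) \<rho>\<^sub>i(e\<^sub>\<alpha>)\<close>, the potential part of the operator is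
  \<open>Q(u) = \<Sum>\<^sub>\<alpha> L\<^sub>-\<^sub>\<alpha>(u) L\<^sub>\<alpha>(u)\<close>. By Fay's identity \<open>[L\<^sub>\<alpha>(u), L\<^sub>\<beta>(u')]\<close> is a combination of
  \<open>L\<^sub>\<alpha>\<^sub>+\<^sub>\<beta>(u)\<close> and \<open>L\<^sub>\<alpha>\<^sub>+\<^sub>\<beta>(u')\<close> whose coefficients depend on \<open>u' - u\<close> only, and a Cartan term if
  \<open>\<alpha> + \<beta> = 0\<close>. Inserting this into \<open>[Q(u), Q(u')]\<close>, the cubic terms collapse by the antisymmetry of
  the structure constants over triples of roots with sum \<open>0\<close>; what remains cancels against the
  commutators of the covariant Laplacians with \<open>Q(u)\<close> and \<open>Q(u')\<close>, up to multiples of the total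
  weight, which vanish on the zero weight space. Fay's identity follows from the Weierstrass
  three-term relation, i.e. from the splitting of \<open>\<theta>(x + y) \<theta>(x - y)\<close> into products of functions of
  \<open>x\<close> and of \<open>y\<close>. If \<open>u' - u\<close> is a period, both operators coincide.\<close>

section \<open>The commutator of the quadratic parts\<close>

text \<open>The commutator of two second order operators could leave derivatives of the section.
  They drop out because two mixed covariant derivatives agree: that of \<open>Q u'\<close> along the
  connection with parameter u and that of \<open>Q u\<close> along the connection with parameter u'
  are both the sum over the roots a of a(h_r) w_a(u' - u) (L_{-a}(u) L_a(u') + L_a(u') L_{-a}(u)).
  Here the derivative of w with respect to a(H) is absorbed by the degenerate case of Fay's
  identity, the one with opposite indices. What survives is the difference of the two connections,
  an operator of order zero with coefficients zeta(z_i - u) - zeta(z_i - u'). Hence at each point H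
  only an identity between endomorphisms is left, and it is proved in an abstract ring for an
  abstract root set. Since forms are acted on from the right, products of ring elements act in
  reading order, total weights must be moved to the left to vanish, and operator commutators come
  out with the opposite sign.\<close>

definition commutator :: "'r::ring \<Rightarrow> 'r \<Rightarrow> 'r" where
  "commutator x y = x * y - y * x"

lemma commutator_sum_left: "commutator (sum f A) y = (\<Sum>i\<in>A. commutator (f i) y)"
  by (simp add: commutator_def sum_distrib_left sum_distrib_right sum_subtractf)

lemma commutator_sum_right: "commutator y (sum f A) = (\<Sum>i\<in>A. commutator y (f i))"
  by (simp add: commutator_def sum_distrib_left sum_distrib_right sum_subtractf)

lemma commutator_sum_sum:
  "commutator (sum f A) (sum g B) = (\<Sum>i\<in>A. \<Sum>j\<in>B. commutator (f i) (g j))"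
  by (simp only: commutator_sum_left) (simp only: commutator_sum_right)

lemma commutator_mult_mult:
  "commutator (x * y) (z * w) =
     x * commutator y z * w + x * z * commutator y w + commutator x z * w * y + z * commutator x w * y"
  by (simp add: commutator_def algebra_simps)

text \<open>The ring carries no scalar multiplication; later it consists of all additive maps of a
  space. Complex numbers therefore enter as ring elements \<open>s k\<close>, linearity of an
  operator becomes commuting with every \<open>s k\<close>, and \<open>s_one\<close> makes it
  possible to divide by 2, 3 and 4.\<close>

locale scalars =
  fixes s :: "complex \<Rightarrow> 'r::ring"
  assumes s_add: "s (k + m) = s k + s m"
    and s_mult: "s (k * m) = s k * s m"
    and s_one: "s 1 * x = x"
begin

lemma s_zero [simp]: "s 0 = 0"
  using s_add[of 0 0] by simp

lemma s_uminus: "s (- k) = - s k"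
  using s_add[of k "- k"] by (simp add: eq_neg_iff_add_eq_0 add.commute)

lemma s_diff: "s (k - m) = s k - s m"
  using s_add[of k "- m"] by (simp add: s_uminus)

lemma s_mult_assoc: "s k * (s m * x) = s (k * m) * x"
  by (simp add: s_mult mult.assoc)

lemma s_uminus_diff_mult: "s (- k - m * n) * x = - (s k * x) - s m * (s n * x)"
  by (simp add: s_diff s_uminus s_mult left_diff_distrib mult.assoc)

lemma eq_zero_of_add_self: "x + x = 0 \<Longrightarrow> x = (0::'r)"
proof -
  assume x: "x + x = 0"
  have "x = s (1/2 + 1/2) * x"
    by (simp add: s_one)
  also have "\<dots> = s (1/2) * (x + x)"
    by (simp only: s_add distrib_left distrib_right)
  finally show "x = 0"
    using x by simp
qed

lemma eq_zero_of_add_self3: "x + x + x = 0 \<Longrightarrow> x = (0::'r)"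
proof -
  assume x: "x + x + x = 0"
  have "x = s (1/3 + 1/3 + 1/3) * x"
    by (simp add: s_one)
  also have "\<dots> = s (1/3) * (x + x + x)"
    by (simp only: s_add distrib_left distrib_right)
  finally show "x = 0"
    using x by simp
qed

lemma commutator_scaled:
  assumes "\<And>k. y * s k = s k * y" "\<And>k. x * s k = s k * x"
  shows "commutator (s k * x) (s m * y) = s (k * m) * commutator x y"
proof -
  have "s k * x * (s m * y) = s k * (x * s m) * y" by (simp add: mult.assoc)
  also have "\<dots> = s (k * m) * (x * y)" by (simp add: assms s_mult mult.assoc)
  finally have 1: "s k * x * (s m * y) = s (k * m) * (x * y)" .
  have "s m * y * (s k * x) = s m * (y * s k) * x" by (simp add: mult.assoc)
  also have "\<dots> = s (k * m) * (y * x)" by (simp add: assms s_mult[symmetric] mult.assoc[symmetric] mult.commute[of k])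
  finally show ?thesis
    using 1 by (simp add: commutator_def right_diff_distrib)
qed

text \<open>Operators on different tensor factors commute, so the double sum of commutators shrinks
  to its diagonal.\<close>

lemma commutator_local_sums:
  assumes "finite I"
    and "\<And>i k. i \<in> I \<Longrightarrow> x i * s k = s k * x i" "\<And>i k. i \<in> I \<Longrightarrow> y i * s k = s k * y i"
    and "\<And>i j. i \<in> I \<Longrightarrow> j \<in> I \<Longrightarrow> i \<noteq> j \<Longrightarrow> x i * y j = y j * x i"
  shows "commutator (\<Sum>i\<in>I. s (f i) * x i) (\<Sum>i\<in>I. s (g i) * y i) =
    (\<Sum>i\<in>I. s (f i * g i) * commutator (x i) (y i))"
proof -
  have "commutator (\<Sum>i\<in>I. s (f i) * x i) (\<Sum>i\<in>I. s (g i) * y i) =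
    (\<Sum>j\<in>I. \<Sum>i\<in>I. s (f i * g j) * commutator (x i) (y j))"
    unfolding commutator_sum_left commutator_sum_right
    by (intro sum.cong refl commutator_scaled) (use assms in auto)
  also have "\<dots> = (\<Sum>j\<in>I. \<Sum>i\<in>I. if i = j then s (f i * g j) * commutator (x i) (y j) else 0)"
    by (intro sum.cong refl) (use assms(4) in \<open>auto simp: commutator_def\<close>)
  also have "\<dots> = (\<Sum>i\<in>I. s (f i * g i) * commutator (x i) (y i))"
    by (intro sum.cong refl) (simp add: assms(1))
  finally show ?thesis .
qed

end

text \<open>\<open>X i a\<close> stands for the root vector of weight \<open>a\<close> acting on the \<open>i\<close>-th tensor factor and \<open>T i a\<close>
  for the bracket of the root vectors of weights \<open>a\<close> and \<open>-a\<close>. The functions \<open>A\<close>, \<open>A'\<close>, \<open>p\<close>, \<open>q\<close>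
  are \<open>w\<^sub>a(z\<^sub>i - u)\<close>, \<open>w\<^sub>a(z\<^sub>i - u')\<close>, \<open>\<zeta>(z\<^sub>i - u)\<close>, \<open>\<zeta>(z\<^sub>i - u')\<close>, while \<open>c a\<close> and \<open>d a\<close> are \<open>w\<^sub>a(u' - u)\<close>
  and its derivative with respect to \<open>a\<close>.\<close>

locale dynamical_fibre = scalars s for s :: "complex \<Rightarrow> 'r::ring" +
  fixes I :: "'i set" and R :: "'a::ab_group_add set"
    and X T :: "'i \<Rightarrow> 'a \<Rightarrow> 'r"
    and ip :: "'a \<Rightarrow> 'a \<Rightarrow> complex" and G :: "'a \<Rightarrow> 'a \<Rightarrow> 'a \<Rightarrow> complex"
    and A A' :: "'a \<Rightarrow> 'i \<Rightarrow> complex" and c d :: "'a \<Rightarrow> complex" and p q :: "'i \<Rightarrow> complex"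
  assumes fin_I: "finite I" and fin_R: "finite R"
    and R_uminus: "a \<in> R \<Longrightarrow> - a \<in> R"
    and R_nonzero: "a \<in> R \<Longrightarrow> a \<noteq> 0"
    and X_s: "i \<in> I \<Longrightarrow> a \<in> R \<Longrightarrow> X i a * s k = s k * X i a"
    and T_s: "i \<in> I \<Longrightarrow> a \<in> R \<Longrightarrow> T i a * s k = s k * T i a"
    and XX_add: "i \<in> I \<Longrightarrow> a \<in> R \<Longrightarrow> b \<in> R \<Longrightarrow> a + b \<in> R \<Longrightarrow>
      commutator (X i a) (X i b) = s (G a b (- (a + b))) * X i (a + b)"
    and XX_uminus: "i \<in> I \<Longrightarrow> a \<in> R \<Longrightarrow> commutator (X i a) (X i (- a)) = T i a"
    and XX_zero: "i \<in> I \<Longrightarrow> a \<in> R \<Longrightarrow> b \<in> R \<Longrightarrow> a + b \<noteq> 0 \<Longrightarrow> a + b \<notin> R \<Longrightarrow>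
      commutator (X i a) (X i b) = 0"
    and XX_diff: "i \<in> I \<Longrightarrow> j \<in> I \<Longrightarrow> i \<noteq> j \<Longrightarrow> a \<in> R \<Longrightarrow> b \<in> R \<Longrightarrow> X i a * X j b = X j b * X i a"
    and TX_same: "i \<in> I \<Longrightarrow> a \<in> R \<Longrightarrow> b \<in> R \<Longrightarrow> commutator (T i a) (X i b) = s (ip a b) * X i b"
    and TX_diff: "i \<in> I \<Longrightarrow> j \<in> I \<Longrightarrow> i \<noteq> j \<Longrightarrow> a \<in> R \<Longrightarrow> b \<in> R \<Longrightarrow> T i a * X j b = X j b * T i a"
    and T_uminus: "i \<in> I \<Longrightarrow> a \<in> R \<Longrightarrow> T i (- a) = - T i a"
    and T_add: "i \<in> I \<Longrightarrow> a \<in> R \<Longrightarrow> b \<in> R \<Longrightarrow> a + b \<in> R \<Longrightarrow> T i (a + b) = T i a + T i b"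
    and G_swap12: "a \<in> R \<Longrightarrow> b \<in> R \<Longrightarrow> e \<in> R \<Longrightarrow> G b a e = - G a b e"
    and G_swap23: "a \<in> R \<Longrightarrow> b \<in> R \<Longrightarrow> e \<in> R \<Longrightarrow> G a e b = - G a b e"
    and ip_uminus: "a \<in> R \<Longrightarrow> ip a (- a) = - ip a a" "a \<in> R \<Longrightarrow> ip (- a) (- a) = ip a a"
    and fay_opposite: "i \<in> I \<Longrightarrow> a \<in> R \<Longrightarrow> A a i * A' (- a) i = c a * (q i - p i) - d a"
    and fay: "i \<in> I \<Longrightarrow> a \<in> R \<Longrightarrow> b \<in> R \<Longrightarrow> a + b \<in> R \<Longrightarrow>
      A a i * A' b i = - c (- b) * A (a + b) i + c a * A' (a + b) i"
begin

definition L :: "'a \<Rightarrow> 'r" where "L a = (\<Sum>i\<in>I. s (A a i) * X i a)"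
definition L' :: "'a \<Rightarrow> 'r" where "L' a = (\<Sum>i\<in>I. s (A' a i) * X i a)"
text \<open>With p and q the zeta values at u and u', \<open>E a\<close> is the difference of the
  two connections in the direction dual to a, and \<open>W a\<close> is the total action of that
  Cartan element, which vanishes on zero weight.\<close>

definition E :: "'a \<Rightarrow> 'r" where "E a = (\<Sum>i\<in>I. s (p i - q i) * T i a)"
definition W :: "'a \<Rightarrow> 'r" where "W a = (\<Sum>i\<in>I. T i a)"

definition TR :: "('a \<times> 'a \<times> 'a) set" where
  "TR = {(a, b, e). a \<in> R \<and> b \<in> R \<and> e \<in> R \<and> a + b + e = 0}"

lemma s_central_sum:
  assumes "\<And>i k. i \<in> I \<Longrightarrow> x i * s k = s k * x i"
  shows "(\<Sum>i\<in>I. s (f i) * x i) * s k = s k * (\<Sum>i\<in>I. s (f i) * x i)"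
proof -
  have "s (f i) * x i * s k = s k * (s (f i) * x i)" if "i \<in> I" for i
  proof -
    have "s (f i) * x i * s k = s (f i) * s k * x i"
      using assms[OF that] by (simp add: mult.assoc)
    also have "\<dots> = s k * (s (f i) * x i)"
      by (simp add: s_mult[symmetric] mult.assoc[symmetric] mult.commute)
    finally show ?thesis .
  qed
  then show ?thesis
    by (simp add: sum_distrib_left sum_distrib_right)
qed

lemma L_s: "a \<in> R \<Longrightarrow> L a * s k = s k * L a"
  and L'_s: "a \<in> R \<Longrightarrow> L' a * s k = s k * L' a"
  unfolding L_def L'_def by (rule s_central_sum; simp add: X_s T_s)+

lemma W_eq: "W a = (\<Sum>i\<in>I. s 1 * T i a)"
  by (simp add: W_def s_one)

lemma W_s: "a \<in> R \<Longrightarrow> W a * s k = s k * W a"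
  unfolding W_eq by (rule s_central_sum; simp add: T_s)+

lemma E_uminus: "a \<in> R \<Longrightarrow> E (- a) = - E a"
  and W_uminus: "a \<in> R \<Longrightarrow> W (- a) = - W a"
  by (simp_all add: E_def W_def T_uminus sum_negf)

section \<open>Commutation relations between the two spectral parameters\<close>

lemma commutator_L_L'_uminus:
  assumes "a \<in> R"
  shows "commutator (L a) (L' (- a)) = - s (c a) * E a - s (d a) * W a"
proof -
  have "commutator (L a) (L' (- a)) = (\<Sum>i\<in>I. s (A a i * A' (- a) i) * T i a)"
    unfolding L_def L'_def
    by (subst commutator_local_sums) (use assms in \<open>auto simp: fin_I X_s XX_diff R_uminus XX_uminus\<close>)
  also have "\<dots> = (\<Sum>i\<in>I. - s (c a) * (s (p i - q i) * T i a) - s (d a) * T i a)"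
  proof (intro sum.cong refl)
    fix i assume i: "i \<in> I"
    have "s (A a i * A' (- a) i) = s (- (c a * (p i - q i)) - d a)"
      unfolding fay_opposite[OF i assms] by (simp add: algebra_simps)
    also have "\<dots> = - s (c a) * s (p i - q i) - s (d a)"
      by (simp add: s_diff s_uminus s_mult)
    finally show "s (A a i * A' (- a) i) * T i a = - s (c a) * (s (p i - q i) * T i a) - s (d a) * T i a"
      by (simp add: left_diff_distrib mult.assoc)
  qed
  also have "\<dots> = - s (c a) * E a - s (d a) * W a"
    by (simp add: E_def W_def sum_subtractf sum_distrib_left sum_negf)
  finally show ?thesis .
qed

lemma commutator_L_L'_add:
  assumes "a \<in> R" "b \<in> R" "a + b \<in> R"
  shows "commutator (L a) (L' b) =
    s (G a b (- (a + b))) * (- s (c (- b)) * L (a + b) + s (c a) * L' (a + b))"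
proof -
  have "commutator (L a) (L' b) =
      (\<Sum>i\<in>I. s (A a i * A' b i) * (s (G a b (- (a + b))) * X i (a + b)))"
    unfolding L_def L'_def
    by (subst commutator_local_sums) (use assms in \<open>auto simp: fin_I X_s XX_diff XX_add\<close>)
  also have "\<dots> = (\<Sum>i\<in>I. s (G a b (- (a + b))) * (- s (c (- b)) * (s (A (a + b) i) * X i (a + b))
      + s (c a) * (s (A' (a + b) i) * X i (a + b))))"
  proof (intro sum.cong refl)
    fix i assume i: "i \<in> I"
    have "s (A a i * A' b i) = - s (c (- b)) * s (A (a + b) i) + s (c a) * s (A' (a + b) i)"
      unfolding fay[OF i assms] by (simp add: s_diff s_mult)
    moreover have "s (A a i * A' b i) * (s (G a b (- (a + b))) * X i (a + b)) =
        s (G a b (- (a + b))) * (s (A a i * A' b i) * X i (a + b))"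
      by (simp only: s_mult_assoc mult.commute)
    ultimately show "s (A a i * A' b i) * (s (G a b (- (a + b))) * X i (a + b)) =
        s (G a b (- (a + b))) * (- s (c (- b)) * (s (A (a + b) i) * X i (a + b))
      + s (c a) * (s (A' (a + b) i) * X i (a + b)))"
      by (simp add: left_diff_distrib distrib_right mult.assoc)
  qed
  also have "\<dots> = s (G a b (- (a + b))) * (- s (c (- b)) * L (a + b) + s (c a) * L' (a + b))"
    by (simp add: L_def L'_def sum_distrib_left sum.distrib sum_negf distrib_left right_diff_distrib sum_subtractf)
  finally show ?thesis .
qed

lemma commutator_L_L'_zero:
  assumes "a \<in> R" "b \<in> R" "a + b \<noteq> 0" "a + b \<notin> R"
  shows "commutator (L a) (L' b) = 0"
  unfolding L_def L'_def
  by (subst commutator_local_sums) (use assms in \<open>auto simp: fin_I X_s XX_diff XX_zero\<close>)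

text \<open>The Leibniz rule for the commutator of \<open>L (- a) * L a\<close> with
  \<open>L' (- b) * L' b\<close> has four terms. After sign changes of a and b each contains the
  same inner commutator m of \<open>L (- a)\<close> and \<open>L' (- b)\<close>;
  \<open>B a b m\<close> collects the four positions of m.\<close>

definition B :: "'a \<Rightarrow> 'a \<Rightarrow> 'r \<Rightarrow> 'r" where
  "B a b m = L a * m * L' b + L a * L' b * m + m * L' b * L a + L' b * m * L a"

lemma B_add: "B a b (m + n) = B a b m + B a b n"
  and B_uminus: "B a b (- m) = - B a b m"
  and B_diff: "B a b (m - n) = B a b m - B a b n"
  and B_zero: "B a b 0 = 0"
  by (simp_all add: B_def algebra_simps)

lemma B_s:
  assumes "a \<in> R" "b \<in> R"
  shows "B a b (s k * m) = s k * B a b m"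
proof -
  have 1: "L a * (s k * x) = s k * (L a * x)" for x
    using L_s[OF assms(1)] by (metis mult.assoc)
  have 2: "L' b * (s k * x) = s k * (L' b * x)" for x
    using L'_s[OF assms(2)] by (metis mult.assoc)
  show ?thesis
    by (simp add: B_def mult.assoc 1 2 distrib_left)
qed

lemma sum_R_uminus: "(\<Sum>a\<in>R. f (- a)) = (\<Sum>a\<in>R. f a)"
  by (rule sum.reindex_bij_witness[where i = uminus and j = uminus]) (use R_uminus in auto)

lemma commutator_Q:
  "commutator (\<Sum>a\<in>R. L (- a) * L a) (\<Sum>a\<in>R. L' (- a) * L' a) =
     (\<Sum>a\<in>R. \<Sum>b\<in>R. B a b (commutator (L (- a)) (L' (- b))))"
proof -
  let ?C = "\<lambda>a b. commutator (L a) (L' b)"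
  have "commutator (\<Sum>a\<in>R. L (- a) * L a) (\<Sum>a\<in>R. L' (- a) * L' a) =
     (\<Sum>a\<in>R. \<Sum>b\<in>R. L (- a) * ?C a (- b) * L' b) + (\<Sum>a\<in>R. \<Sum>b\<in>R. L (- a) * L' (- b) * ?C a b)
     + (\<Sum>a\<in>R. \<Sum>b\<in>R. ?C (- a) (- b) * L' b * L a) + (\<Sum>a\<in>R. \<Sum>b\<in>R. L' (- b) * ?C (- a) b * L a)"
    by (simp only: commutator_sum_sum commutator_mult_mult sum.distrib)
  also have "(\<Sum>a\<in>R. \<Sum>b\<in>R. L (- a) * ?C a (- b) * L' b) = (\<Sum>a\<in>R. \<Sum>b\<in>R. L a * ?C (- a) (- b) * L' b)"
    using sum_R_uminus[of "\<lambda>a. \<Sum>b\<in>R. L a * ?C (- a) (- b) * L' b"] by simp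
  also have "(\<Sum>a\<in>R. \<Sum>b\<in>R. L (- a) * L' (- b) * ?C a b) = (\<Sum>a\<in>R. \<Sum>b\<in>R. L a * L' (- b) * ?C (- a) b)"
    using sum_R_uminus[of "\<lambda>a. \<Sum>b\<in>R. L a * L' (- b) * ?C (- a) b"] by simp
  also have "\<dots> = (\<Sum>a\<in>R. \<Sum>b\<in>R. L a * L' b * ?C (- a) (- b))"
    using sum_R_uminus[of "\<lambda>b. L a * L' b * ?C (- a) (- b)" for a] by simp
  also have "(\<Sum>a\<in>R. \<Sum>b\<in>R. L' (- b) * ?C (- a) b * L a) = (\<Sum>a\<in>R. \<Sum>b\<in>R. L' b * ?C (- a) (- b) * L a)"
    using sum_R_uminus[of "\<lambda>b. L' b * ?C (- a) (- b) * L a" for a] by simp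
  finally show ?thesis
    by (simp add: B_def sum.distrib)
qed

section \<open>Sums over triples of roots with sum zero\<close>

lemma TR_iff: "(a, b, e) \<in> TR \<longleftrightarrow> a \<in> R \<and> b \<in> R \<and> - (a + b) \<in> R \<and> e = - (a + b)"
  using eq_neg_iff_add_eq_0[of e "a + b"] by (auto simp: TR_def add.commute)

lemma sum_TR:
  "(\<Sum>(a, b, e)\<in>TR. f a b e) = (\<Sum>a\<in>R. \<Sum>b\<in>R. if - (a + b) \<in> R then f a b (- (a + b)) else 0)"
proof -
  have "(\<Sum>(a, b, e)\<in>TR. f a b e) = (\<Sum>(a, b)\<in>{(a, b). a \<in> R \<and> b \<in> R \<and> - (a + b) \<in> R}. f a b (- (a + b)))"
    by (rule sum.reindex_bij_witness[where i = "\<lambda>(a, b). (a, b, - (a + b))" and j = "\<lambda>(a, b, e). (a, b)"])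
      (auto simp: TR_iff simp del: minus_add_distrib)
  also have "\<dots> = (\<Sum>(a, b)\<in>R \<times> R. if - (a + b) \<in> R then f a b (- (a + b)) else 0)"
    by (rule sum.mono_neutral_cong_left) (auto simp: fin_R simp del: minus_add_distrib split: if_splits)
  finally show ?thesis
    by (simp add: sum.cartesian_product)
qed

lemma sum_TR_swap13: "(\<Sum>(a, b, e)\<in>TR. f a b e) = (\<Sum>(a, b, e)\<in>TR. f e b a)"
  by (rule sum.reindex_bij_witness[where i = "\<lambda>(a, b, e). (e, b, a)" and j = "\<lambda>(a, b, e). (e, b, a)"])
    (auto simp: TR_def add_ac)

lemma sum_TR_swap23: "(\<Sum>(a, b, e)\<in>TR. f a b e) = (\<Sum>(a, b, e)\<in>TR. f a e b)"
  by (rule sum.reindex_bij_witness[where i = "\<lambda>(a, b, e). (a, e, b)" and j = "\<lambda>(a, b, e). (a, e, b)"])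
    (auto simp: TR_def add_ac)

lemma sum_TR_swap12: "(\<Sum>(a, b, e)\<in>TR. f a b e) = (\<Sum>(a, b, e)\<in>TR. f b a e)"
  by (rule sum.reindex_bij_witness[where i = "\<lambda>(a, b, e). (b, a, e)" and j = "\<lambda>(a, b, e). (b, a, e)"])
    (auto simp: TR_def add_ac)

lemma sum_TR_uminus: "(\<Sum>(a, b, e)\<in>TR. f a b e) = (\<Sum>(a, b, e)\<in>TR. f (- a) (- b) (- e))"
proof -
  have *: "(- a, - b, - e) \<in> TR" if "(a, b, e) \<in> TR" for a b e
  proof -
    have "- (- a + - b) = - (- (a + b))" by (simp add: add.commute)
    then show ?thesis
      using that R_uminus unfolding TR_iff by metis
  qed
  show ?thesis
    by (rule sum.reindex_bij_witness[where i = "\<lambda>(a, b, e). (- a, - b, - e)" and j = "\<lambda>(a, b, e). (- a, - b, - e)"])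
      (auto dest: *)
qed

text \<open>The commutator of \<open>L (- a)\<close> and \<open>L' (- b)\<close> has weight -(a +
  b). It is a Cartan term if this weight is zero, a combination of \<open>L e\<close> and
  \<open>L' e\<close> if it is a root e, and zero otherwise. Indexing the second case by triples
  exposes the symmetry in a, b, e exploited afterwards.\<close>

lemma commutator_Q_decomp:
  "commutator (\<Sum>a\<in>R. L (- a) * L a) (\<Sum>a\<in>R. L' (- a) * L' a) =
     - (\<Sum>a\<in>R. s (c a) * B (- a) a (E a)) - (\<Sum>a\<in>R. s (d a) * B (- a) a (W a))
     - (\<Sum>(a, b, e)\<in>TR. s (G (- a) (- b) (- e) * c b) * B a b (L e))
     + (\<Sum>(a, b, e)\<in>TR. s (G (- a) (- b) (- e) * c (- a)) * B a b (L' e))"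
proof -
  let ?D = "\<lambda>a. s (c (- a)) * B a (- a) (E a) + s (d (- a)) * B a (- a) (W a)"
  let ?O = "\<lambda>a b e. - (s (G (- a) (- b) (- e) * c b) * B a b (L e)) +
     s (G (- a) (- b) (- e) * c (- a)) * B a b (L' e)"
  have *: "B a b (commutator (L (- a)) (L' (- b))) =
     (if b = - a then ?D a else 0) + (if - (a + b) \<in> R then ?O a b (- (a + b)) else 0)"
    if ab: "a \<in> R" "b \<in> R" for a b
  proof -
    have na: "- a \<in> R" and nb: "- b \<in> R" using ab R_uminus by auto
    consider "b = - a" | "b \<noteq> - a" "- (a + b) \<in> R" | "b \<noteq> - a" "- (a + b) \<notin> R" by blast
    then show ?thesis
    proof cases
      case 1
      have "- (a + b) \<notin> R" using 1 R_nonzero by force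
      moreover have "commutator (L (- a)) (L' (- b)) = s (c (- a)) * E a + s (d (- a)) * W a"
        using commutator_L_L'_uminus[OF na] 1 ab by (simp add: E_uminus W_uminus)
      ultimately show ?thesis
        using 1 ab na by (simp add: B_add B_s)
    next
      case 2
      have "commutator (L (- a)) (L' (- b)) =
        s (G (- a) (- b) (a + b)) * (- s (c b) * L (- (a + b)) + s (c (- a)) * L' (- (a + b)))"
        using commutator_L_L'_add[OF na nb] 2 by (simp add: algebra_simps)
      also have "\<dots> = - (s (G (- a) (- b) (a + b) * c b) * L (- (a + b))) +
        s (G (- a) (- b) (a + b) * c (- a)) * L' (- (a + b))"
        by (simp only: distrib_left mult_minus_left mult_minus_right s_mult_assoc)
      finally show ?thesis
        using 2 ab by (simp add: B_add B_s B_uminus del: minus_add_distrib minus_add)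
          (simp only: B_diff B_add B_s B_uminus ab)?
    next
      case 3
      have "- a + - b \<notin> R" "- a + - b \<noteq> 0" using 3 by (auto simp: add_eq_0_iff)
      then have "commutator (L (- a)) (L' (- b)) = 0"
        using commutator_L_L'_zero[OF na nb] by simp
      then show ?thesis using 3 by (simp add: B_zero)
    qed
  qed
  have "commutator (\<Sum>a\<in>R. L (- a) * L a) (\<Sum>a\<in>R. L' (- a) * L' a) =
     (\<Sum>a\<in>R. \<Sum>b\<in>R. if b = - a then ?D a else 0) + (\<Sum>(a, b, e)\<in>TR. ?O a b e)"
    unfolding commutator_Q sum_TR sum.distrib[symmetric]
    by (intro sum.cong refl) (rule *)
  also have "(\<Sum>a\<in>R. \<Sum>b\<in>R. if b = - a then ?D a else 0) = (\<Sum>a\<in>R. ?D a)"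
    by (intro sum.cong refl) (use R_uminus fin_R in auto)
  also have "\<dots> = (\<Sum>a\<in>R. ?D (- a))"
    by (rule sum_R_uminus[symmetric])
  also have "\<dots> = - (\<Sum>a\<in>R. s (c a) * B (- a) a (E a)) - (\<Sum>a\<in>R. s (d a) * B (- a) a (W a))"
    by (simp add: E_uminus W_uminus B_uminus sum_subtractf sum_negf)
  also have "(\<Sum>(a, b, e)\<in>TR. ?O a b e) = 
    - (\<Sum>(a, b, e)\<in>TR. s (G (- a) (- b) (- e) * c b) * B a b (L e))
     + (\<Sum>(a, b, e)\<in>TR. s (G (- a) (- b) (- e) * c (- a)) * B a b (L' e))"
    by (simp only: sum.distrib sum_negf split_def)
  finally show ?thesis by (simp add: algebra_simps)
qed

lemma G_swap13: "a \<in> R \<Longrightarrow> b \<in> R \<Longrightarrow> e \<in> R \<Longrightarrow> G e b a = - G a b e"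
  using G_swap12[of b e a] G_swap23[of b a e] G_swap12[of a b e] by simp

text \<open>Exchange b and e: the four products in \<open>B a b (L' e)\<close> are only permuted and
  the factor \<open>c (- a)\<close> is untouched, while the structure constant changes sign.\<close>

lemma sum_B_L'_eq_0: "(\<Sum>(a, b, e)\<in>TR. s (G (- a) (- b) (- e) * c (- a)) * B a b (L' e)) = 0"
  (is "?S = 0")
proof (rule eq_zero_of_add_self)
  have "?S = (\<Sum>(a, b, e)\<in>TR. s (G (- a) (- e) (- b) * c (- a)) * B a e (L' b))"
    by (rule sum_TR_swap23)
  also have "\<dots> = (\<Sum>(a, b, e)\<in>TR. - (s (G (- a) (- b) (- e) * c (- a)) * B a b (L' e)))"
  proof (intro sum.cong refl, clarify)
    fix a b e assume "(a, b, e) \<in> TR"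
    then have "G (- a) (- e) (- b) = - G (- a) (- b) (- e)"
      by (intro G_swap23) (auto simp: TR_def R_uminus)
    moreover have "B a e (L' b) = B a b (L' e)"
      by (simp add: B_def)
    ultimately show "s (G (- a) (- e) (- b) * c (- a)) * B a e (L' b) =
        - (s (G (- a) (- b) (- e) * c (- a)) * B a b (L' e))"
      by (simp add: s_uminus)
  qed
  also have "\<dots> = - ?S"
    by (simp only: split_def sum_negf)
  finally show "?S + ?S = 0"
    by (simp only: eq_neg_iff_add_eq_0)
qed

text \<open>Both commutators stay within a single tensor factor and the total weight a + e + b is
  zero, so the cubic expression collapses to the Cartan elements \<open>T i b\<close>.\<close>

lemma double_commutator:
  assumes "(a, b, e) \<in> TR"
  shows "commutator (commutator (L a) (L e)) (L' b) =
    (\<Sum>i\<in>I. s (G a b e * (A a i * A e i * A' b i)) * T i b)"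
proof -
  have abe: "a \<in> R" "b \<in> R" "e \<in> R" "- b \<in> R" "a + e = - b"
    using assms by (auto simp: TR_def R_uminus eq_neg_iff_add_eq_0 add_ac)
  have "commutator (L a) (L e) = (\<Sum>i\<in>I. s (A a i * A e i) * (s (G a e b) * X i (- b)))"
    unfolding L_def
    by (subst commutator_local_sums) (use abe in \<open>auto simp: fin_I X_s XX_diff XX_add\<close>)
  also have "\<dots> = (\<Sum>i\<in>I. s (A a i * A e i * G a e b) * X i (- b))"
    by (simp only: s_mult_assoc)
  finally have "commutator (commutator (L a) (L e)) (L' b) =
      (\<Sum>i\<in>I. s (A a i * A e i * G a e b * A' b i) * commutator (X i (- b)) (X i b))"
    unfolding L'_def
    by simp (subst commutator_local_sums, use abe in \<open>auto simp: fin_I X_s XX_diff\<close>)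
  also have "\<dots> = (\<Sum>i\<in>I. s (G a b e * (A a i * A e i * A' b i)) * T i b)"
  proof (intro sum.cong refl)
    fix i assume i: "i \<in> I"
    have "commutator (X i (- b)) (X i b) = - T i b"
      using XX_uminus[OF i abe(4)] by (simp add: T_uminus i abe)
    moreover have "G a e b = - G a b e"
      using abe by (intro G_swap23)
    ultimately show "s (A a i * A e i * G a e b * A' b i) * commutator (X i (- b)) (X i b) =
        s (G a b e * (A a i * A e i * A' b i)) * T i b"
      by (simp add: s_uminus mult_ac)
  qed
  finally show ?thesis .
qed

lemma E_add: "a \<in> R \<Longrightarrow> b \<in> R \<Longrightarrow> a + b \<in> R \<Longrightarrow> E (a + b) = E a + E b"
  by (simp add: E_def T_add distrib_left sum.distrib)

text \<open>Antisymmetry in a and e replaces \<open>B a b (L e)\<close> by a double commutator,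
  which is linear in the Cartan elements. Adding the sum over the negated roots removes the products
  of A at opposite roots. The remaining coefficient of E is symmetric in the three roots, so that
  part vanishes, and only multiples of total weights are left.\<close>

lemma sum_B_L:
  "\<exists>k. (\<Sum>(a, b, e)\<in>TR. s (G (- a) (- b) (- e) * c b) * B a b (L e)) = (\<Sum>(a, b, e)\<in>TR. s (k a b e) * W b)"
proof -
  define S where "S = (\<Sum>(a, b, e)\<in>TR. s (G (- a) (- b) (- e) * c b) * B a b (L e))"
  \<comment> \<open>As a product of two structure constants, g is symmetric in the three roots of a
    triple and unchanged when all of them are negated.\<close>
  define g where "g a b e = G (- a) (- b) (- e) * G a b e" for a b e
  define k where "k a b e i = c b * (A a i * A e i * A' b i)" for a b e i
  define r where "r a b e = c a * c b * c e - c (- a) * c (- b) * c (- e)" for a b e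
  define m where "m a b e = c a * c b * d e - c (- a) * c (- b) * d (- e)" for a b e
  define V where "V = (\<Sum>(a, b, e)\<in>TR. s (g a b e * r a b e) * E b)"
  define Z where "Z = (\<Sum>(a, b, e)\<in>TR. s (g a b e * m a b e) * W b)"
  have SS: "S + S = (\<Sum>(a, b, e)\<in>TR. \<Sum>i\<in>I. s (g a b e * k a b e i) * T i b)"
  proof -
    have "S = (\<Sum>(a, b, e)\<in>TR. s (G (- e) (- b) (- a) * c b) * B e b (L a))"
      unfolding S_def by (rule sum_TR_swap13)
    then have "S + S = (\<Sum>(a, b, e)\<in>TR. s (G (- a) (- b) (- e) * c b) * B a b (L e)) +
        (\<Sum>(a, b, e)\<in>TR. s (G (- e) (- b) (- a) * c b) * B e b (L a))"
      by (simp only: S_def[symmetric])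
    also have "\<dots> = (\<Sum>(a, b, e)\<in>TR. s (G (- a) (- b) (- e) * c b) * B a b (L e)
        + s (G (- e) (- b) (- a) * c b) * B e b (L a))"
      by (simp only: sum.distrib split_def)
    also have "\<dots> = (\<Sum>(a, b, e)\<in>TR. \<Sum>i\<in>I. s (g a b e * k a b e i) * T i b)"
    proof (intro sum.cong refl, clarify)
      fix a b e assume abe: "(a, b, e) \<in> TR"
      then have "G (- e) (- b) (- a) = - G (- a) (- b) (- e)"
        by (intro G_swap13) (auto simp: TR_def R_uminus)
      then have "s (G (- a) (- b) (- e) * c b) * B a b (L e) + s (G (- e) (- b) (- a) * c b) * B e b (L a)
          = s (G (- a) (- b) (- e) * c b) * (B a b (L e) - B e b (L a))"
        by (simp add: s_uminus right_diff_distrib)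
      also have "B a b (L e) - B e b (L a) = commutator (commutator (L a) (L e)) (L' b)"
        by (simp add: B_def commutator_def algebra_simps)
      finally show "s (G (- a) (- b) (- e) * c b) * B a b (L e) + s (G (- e) (- b) (- a) * c b) * B e b (L a)
          = (\<Sum>i\<in>I. s (g a b e * k a b e i) * T i b)"
        by (simp add: double_commutator[OF abe] sum_distrib_left s_mult_assoc g_def k_def mult_ac)
    qed
    finally show ?thesis .
  qed
  \<comment> \<open>Add the same sum over the negated triples: since
    \<open>T i (- b) = - T i b\<close>, the two coefficients k enter as a difference.\<close>
  have "(S + S) + (S + S) = - V - Z"
  proof -
    have "S + S = (\<Sum>(a, b, e)\<in>TR. \<Sum>i\<in>I. s (g (- a) (- b) (- e) * k (- a) (- b) (- e) i) * T i (- b))"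
      unfolding SS by (rule sum_TR_uminus)
    then have "(S + S) + (S + S) = (\<Sum>(a, b, e)\<in>TR. \<Sum>i\<in>I. s (g a b e * k a b e i) * T i b
         + s (g (- a) (- b) (- e) * k (- a) (- b) (- e) i) * T i (- b))"
      unfolding SS by (simp only: sum.distrib split_def)
    also have "\<dots> = (\<Sum>(a, b, e)\<in>TR. - (s (g a b e * r a b e) * E b) - s (g a b e * m a b e) * W b)"
    proof (intro sum.cong refl, clarify)
      fix a b e assume abe: "(a, b, e) \<in> TR"
      have R: "a \<in> R" "b \<in> R" "e \<in> R" "- a \<in> R" "- b \<in> R" "- e \<in> R" "a + b = - e" "- a + - b = e"
        using abe by (auto simp: TR_def R_uminus eq_neg_iff_add_eq_0) (metis add_eq_0_iff minus_add_distrib minus_minus uminus_add_conv_diff add.commute)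
      have k: "k a b e i - k (- a) (- b) (- e) i = - r a b e * (p i - q i) - m a b e" if i: "i \<in> I" for i
      proof -
        have 1: "A a i * A' b i = - c (- b) * A (- e) i + c a * A' (- e) i"
          using fay[OF i, of a b] R by simp
        have 2: "A (- a) i * A' (- b) i = - c b * A e i + c (- a) * A' e i"
          using fay[OF i, of "- a" "- b"] R by simp
        have 3: "A e i * A' (- e) i = c e * (q i - p i) - d e"
          by (rule fay_opposite[OF i R(3)])
        have 4: "A (- e) i * A' e i = c (- e) * (q i - p i) - d (- e)"
          using fay_opposite[OF i R(6)] by simp
        have "k a b e i = c b * A e i * (A a i * A' b i)" by (simp add: k_def)
        \<comment> \<open>The first term is the same for the negated triple and cancels in the
          difference; the second is evaluated by the degenerate identity.\<close>
        also have "\<dots> = - c b * c (- b) * A e i * A (- e) i + c a * c b * (A e i * A' (- e) i)"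
          unfolding 1 by (simp add: algebra_simps)
        finally have 5: "k a b e i = - c b * c (- b) * A e i * A (- e) i + c a * c b * (c e * (q i - p i) - d e)"
          unfolding 3 .
        have "k (- a) (- b) (- e) i = c (- b) * A (- e) i * (A (- a) i * A' (- b) i)" by (simp add: k_def)
        also have "\<dots> = - c b * c (- b) * A e i * A (- e) i + c (- a) * c (- b) * (A (- e) i * A' e i)"
          unfolding 2 by (simp add: algebra_simps)
        finally have 6: "k (- a) (- b) (- e) i = - c b * c (- b) * A e i * A (- e) i
           + c (- a) * c (- b) * (c (- e) * (q i - p i) - d (- e))"
          unfolding 4 .
        show ?thesis
          unfolding 5 6 r_def m_def by (simp add: algebra_simps)
      qed
      have "s (g a b e * k a b e i) * T i b + s (g (- a) (- b) (- e) * k (- a) (- b) (- e) i) * T i (- b)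
          = - (s (g a b e * r a b e) * (s (p i - q i) * T i b)) - s (g a b e * m a b e) * T i b"
        if i: "i \<in> I" for i
      proof -
        have "s (g a b e * k a b e i) * T i b + s (g (- a) (- b) (- e) * k (- a) (- b) (- e) i) * T i (- b)
          = s (g a b e * (k a b e i - k (- a) (- b) (- e) i)) * T i b"
          using i R by (simp add: T_uminus g_def s_diff right_diff_distrib left_diff_distrib mult_ac)
        also have "\<dots> = (- s (g a b e * r a b e * (p i - q i)) - s (g a b e * m a b e)) * T i b"
          unfolding k[OF i] s_uminus[symmetric] s_diff[symmetric] by (simp add: algebra_simps)
        finally show ?thesis
          by (simp add: left_diff_distrib s_mult_assoc)
      qed
      then show "(\<Sum>i\<in>I. s (g a b e * k a b e i) * T i b
           + s (g (- a) (- b) (- e) * k (- a) (- b) (- e) i) * T i (- b)) =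
          - (s (g a b e * r a b e) * E b) - s (g a b e * m a b e) * W b"
        by (simp add: sum_subtractf sum_negf E_def W_def sum_distrib_left)
    qed
    also have "\<dots> = - V - Z"
      by (simp only: V_def Z_def sum_subtractf sum_negf split_def)
    finally show ?thesis .
  qed
  \<comment> \<open>By symmetry of the coefficient, three times V carries the factor E a + E b + E
    e, which is zero because E is additive and odd.\<close>
  moreover have "V = 0"
  proof (rule eq_zero_of_add_self3)
    have 1: "V = (\<Sum>(a, b, e)\<in>TR. s (g a b e * r a b e) * E a)"
    proof -
      have "V = (\<Sum>(a, b, e)\<in>TR. s (g b a e * r b a e) * E a)"
        unfolding V_def by (rule sum_TR_swap12)
      also have "\<dots> = (\<Sum>(a, b, e)\<in>TR. s (g a b e * r a b e) * E a)"
      proof (intro sum.cong refl, clarify)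
        fix a b e assume "(a, b, e) \<in> TR"
        then have "g b a e = g a b e" "r b a e = r a b e"
          using G_swap12[of a b e] G_swap12[of "- a" "- b" "- e"] by (auto simp: g_def r_def TR_def R_uminus)
        then show "s (g b a e * r b a e) * E a = s (g a b e * r a b e) * E a" by simp
      qed
      finally show ?thesis .
    qed
    have 2: "V = (\<Sum>(a, b, e)\<in>TR. s (g a b e * r a b e) * E e)"
    proof -
      have "V = (\<Sum>(a, b, e)\<in>TR. s (g a e b * r a e b) * E e)"
        unfolding V_def by (rule sum_TR_swap23)
      also have "\<dots> = (\<Sum>(a, b, e)\<in>TR. s (g a b e * r a b e) * E e)"
      proof (intro sum.cong refl, clarify)
        fix a b e assume "(a, b, e) \<in> TR"
        then have "g a e b = g a b e" "r a e b = r a b e"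
          using G_swap23[of a b e] G_swap23[of "- a" "- b" "- e"] by (auto simp: g_def r_def TR_def R_uminus)
        then show "s (g a e b * r a e b) * E e = s (g a b e * r a b e) * E e" by simp
      qed
      finally show ?thesis .
    qed
    have "V + V + V = (\<Sum>(a, b, e)\<in>TR. s (g a b e * r a b e) * E a) + (\<Sum>(a, b, e)\<in>TR. s (g a b e * r a b e) * E b)
       + (\<Sum>(a, b, e)\<in>TR. s (g a b e * r a b e) * E e)"
      by (simp only: 1[symmetric] 2[symmetric] V_def[symmetric])
    also have "\<dots> = (\<Sum>(a, b, e)\<in>TR. s (g a b e * r a b e) * (E a + E b + E e))"
      by (simp only: sum.distrib[symmetric] split_def distrib_left)
    also have "\<dots> = 0"
    proof (intro sum.neutral ballI, clarify)
      fix a b e assume abe: "(a, b, e) \<in> TR"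
      have "E (- e) = E a + E b"
        using E_add[of a b] abe R_uminus[of e] by (auto simp: TR_def add_eq_0_iff2)
      then have "E a + E b + E e = 0"
        using abe by (simp add: E_uminus TR_def) (metis neg_eq_iff_add_eq_0 add.commute)
      then show "s (g a b e * r a b e) * (E a + E b + E e) = 0" by simp
    qed
    finally show "V + V + V = 0" .
  qed
  ultimately have "S + S + (S + S) = - Z" by simp
  \<comment> \<open>S has been doubled twice, by exchanging a with e and by negating the roots;
    hence the factor 1/4.\<close>
  then have "s (1/4) * (S + S + (S + S)) = - (s (1/4) * Z)"
    by simp
  moreover have "s (1/4) * (S + S + (S + S)) = s (1/4 + 1/4 + (1/4 + 1/4)) * S"
    by (simp only: s_add distrib_left distrib_right)
  ultimately have "S = (\<Sum>(a, b, e)\<in>TR. s (- (1/4 * (g a b e * m a b e))) * W b)"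
    by (simp add: s_one Z_def sum_distrib_left split_def s_mult_assoc s_uminus sum_negf)
  then show ?thesis
    unfolding S_def by (intro exI[of _ "\<lambda>a b e. - (1/4 * (g a b e * m a b e))"])
qed

section \<open>Cartan terms, covariant derivatives and the identity on zero weight\<close>

lemma commutator_W_sum:
  assumes "a \<in> R" "b \<in> R"
  shows "commutator (W a) (\<Sum>i\<in>I. s (f i) * X i b) = s (ip a b) * (\<Sum>i\<in>I. s (f i) * X i b)"
proof -
  have "commutator (W a) (\<Sum>i\<in>I. s (f i) * X i b) = (\<Sum>i\<in>I. s (1 * f i) * commutator (T i a) (X i b))"
    unfolding W_eq by (rule commutator_local_sums) (use assms in \<open>auto simp: fin_I X_s T_s TX_diff\<close>)
  also have "\<dots> = (\<Sum>i\<in>I. s (ip a b) * (s (f i) * X i b))"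
    by (intro sum.cong refl) (use assms in \<open>simp add: TX_same s_mult_assoc mult.commute\<close>)
  finally show ?thesis
    by (simp only: sum_distrib_left)
qed

lemma commutator_W_L: "a \<in> R \<Longrightarrow> b \<in> R \<Longrightarrow> commutator (W a) (L b) = s (ip a b) * L b"
  and commutator_W_L': "a \<in> R \<Longrightarrow> b \<in> R \<Longrightarrow> commutator (W a) (L' b) = s (ip a b) * L' b"
  unfolding L_def L'_def by (rule commutator_W_sum; assumption)+

text \<open>\<open>W a\<close> is moved to the left, where it will be annihilated. Passing
  \<open>L (- a)\<close> and \<open>L' a\<close> costs \<open>ip a a\<close> with opposite signs,
  and these corrections add up to one commutator of \<open>L (- a)\<close> with
  \<open>L' a\<close>.\<close>

lemma B_W:
  assumes "a \<in> R"
  shows "B (- a) a (W a) = W a * (L (- a) * L' a + L (- a) * L' a + L' a * L (- a) + L' a * L (- a))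
    + s (ip a a * c (- a)) * E a + s (ip a a * d (- a)) * W a"
proof -
  have na: "- a \<in> R" using assms by (rule R_uminus)
  have 1: "L (- a) * W a = W a * L (- a) + s (ip a a) * L (- a)"
    using commutator_W_L[OF assms na] assms by (simp add: commutator_def ip_uminus s_uminus algebra_simps)
  have 2: "L' a * W a = W a * L' a - s (ip a a) * L' a"
    using commutator_W_L'[OF assms assms] by (simp add: commutator_def algebra_simps)
  have 3: "L (- a) * (s k * x) = s k * (L (- a) * x)" for k x
    by (metis mult.assoc L_s[OF na])
  have L_W: "L (- a) * (W a * x) = W a * (L (- a) * x) + s (ip a a) * (L (- a) * x)" for x
    by (simp only: mult.assoc[symmetric] 1 distrib_right)
  have L'_W: "L' a * (W a * x) = W a * (L' a * x) - s (ip a a) * (L' a * x)" for x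
    by (simp only: mult.assoc[symmetric] 2 left_diff_distrib)
  have "B (- a) a (W a) = W a * (L (- a) * L' a + L (- a) * L' a + L' a * L (- a) + L' a * L (- a))
     + s (ip a a) * commutator (L (- a)) (L' a)"
    by (simp only: B_def commutator_def mult.assoc L_W L'_W 1 2 3 distrib_left right_diff_distrib)
      (simp add: algebra_simps)
  also have "commutator (L (- a)) (L' a) = s (c (- a)) * E a + s (d (- a)) * W a"
    using commutator_L_L'_uminus[OF na] assms by (simp add: E_uminus W_uminus)
  finally show ?thesis
    by (simp add: distrib_left s_mult_assoc)
qed

text \<open>This double commutator is the difference between the anticommutator of
  \<open>E a\<close> with \<open>L (- a) * L' a + L' a * L (- a)\<close>, which comes from the
  Laplacians, and \<open>B (- a) a (E a)\<close>, which comes from the quadratic parts. Computed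
  factor by factor, it is linear in the Cartan elements.\<close>

lemma commutator_E_L_L':
  assumes "a \<in> R"
  shows "commutator (commutator (E a) (L (- a))) (L' a) =
    (\<Sum>i\<in>I. s (ip a a * (p i - q i) * (- c (- a) * (p i - q i) - d (- a))) * T i a)"
proof -
  have na: "- a \<in> R" using assms by (rule R_uminus)
  have "commutator (E a) (L (- a)) = (\<Sum>i\<in>I. s ((p i - q i) * A (- a) i) * (s (ip a (- a)) * X i (- a)))"
    unfolding L_def E_def
    by (subst commutator_local_sums) (use assms na in \<open>auto simp: fin_I X_s T_s TX_diff TX_same\<close>)
  also have "\<dots> = (\<Sum>i\<in>I. s ((p i - q i) * A (- a) i * ip a (- a)) * X i (- a))"
    by (simp only: s_mult_assoc)
  finally have "commutator (commutator (E a) (L (- a))) (L' a) =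
      (\<Sum>i\<in>I. s ((p i - q i) * A (- a) i * ip a (- a) * A' a i) * commutator (X i (- a)) (X i a))"
    unfolding L'_def
    by simp (subst commutator_local_sums, use assms na in \<open>auto simp: fin_I X_s XX_diff\<close>)
  also have "\<dots> = (\<Sum>i\<in>I. s (ip a a * (p i - q i) * (- c (- a) * (p i - q i) - d (- a))) * T i a)"
  proof (intro sum.cong refl)
    fix i assume i: "i \<in> I"
    have 1: "commutator (X i (- a)) (X i a) = - T i a"
      using XX_uminus[OF i na] by (simp add: T_uminus i assms)
    have 2: "A (- a) i * A' a i = - c (- a) * (p i - q i) - d (- a)"
      using fay_opposite[OF i na] by (simp add: algebra_simps)
    have "(p i - q i) * A (- a) i * ip a (- a) * A' a i = - (ip a a * (p i - q i) * (A (- a) i * A' a i))"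
      using assms by (simp add: ip_uminus)
    then show "s ((p i - q i) * A (- a) i * ip a (- a) * A' a i) * commutator (X i (- a)) (X i a) =
        s (ip a a * (p i - q i) * (- c (- a) * (p i - q i) - d (- a))) * T i a"
      unfolding 1 2 by (simp add: s_uminus)
  qed
  finally show ?thesis .
qed

text \<open>\<open>M a\<close> will be the derivative of \<open>L' a\<close> along the connection of
  the other parameter, and the sum the derivative of the quadratic part. Since g is odd, the terms
  with z cancel between \<open>M a * L' (- a)\<close> and \<open>L' a * M (- a)\<close>.\<close>

lemma commutator_L_L'_sum:
  assumes g: "\<And>a. a \<in> R \<Longrightarrow> g (- a) = - g a"
    and M: "\<And>a. a \<in> R \<Longrightarrow> M a = s (g a) * (- s (c (- a)) * L a + s z * L' a)"
  shows "(\<Sum>a\<in>R. M a * L' (- a) + L' a * M (- a)) = (\<Sum>a\<in>R. s (g a * c a) * (L (- a) * L' a + L' a * L (- a)))"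
proof -
  have 1: "M a * L' (- a) + L' a * M (- a) = s (g a * c a) * (L' a * L (- a)) + s (g (- a) * c (- a)) * (L a * L' (- a))"
    if a: "a \<in> R" for a
  proof -
    have L's: "L' a * (s k * x) = s k * (L' a * x)" for k x
      by (metis mult.assoc L'_s[OF a])
    have "M a * L' (- a) = - (s (g a * c (- a)) * (L a * L' (- a))) + s (g a * z) * (L' a * L' (- a))"
      by (simp only: M[OF a] distrib_left distrib_right mult_minus_left mult_minus_right mult.assoc s_mult_assoc)
    moreover have "L' a * M (- a) = s (g a * c a) * (L' a * L (- a)) - s (g a * z) * (L' a * L' (- a))"
      unfolding M[OF R_uminus[OF a]] g[OF a]
      by (simp add: distrib_left right_diff_distrib L's s_mult_assoc s_uminus)
    ultimately show ?thesis
      by (simp add: g[OF a] s_uminus)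
  qed
  have "(\<Sum>a\<in>R. M a * L' (- a) + L' a * M (- a)) =
     (\<Sum>a\<in>R. s (g a * c a) * (L' a * L (- a))) + (\<Sum>a\<in>R. s (g (- a) * c (- a)) * (L a * L' (- a)))"
    unfolding sum.distrib[symmetric] by (intro sum.cong refl 1)
  also have "(\<Sum>a\<in>R. s (g (- a) * c (- a)) * (L a * L' (- a))) = (\<Sum>a\<in>R. s (g a * c a) * (L (- a) * L' a))"
    using sum_R_uminus[of "\<lambda>a. s (g a * c a) * (L (- a) * L' a)"] by simp
  finally show ?thesis
    by (simp add: distrib_left sum.distrib add.commute)
qed

text \<open>The mirror image, for the derivative of \<open>L a\<close>. That the right-hand side is
  the same as in \<open>commutator_L_L'_sum\<close> is what removes the derivatives of the section
  from the commutator of the operators.\<close>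

lemma commutator_L'_L_sum:
  assumes g: "\<And>a. a \<in> R \<Longrightarrow> g (- a) = - g a"
    and M: "\<And>a. a \<in> R \<Longrightarrow> M a = s (g a) * (s (c a) * L' a - s z * L a)"
  shows "(\<Sum>a\<in>R. M a * L (- a) + L a * M (- a)) = (\<Sum>a\<in>R. s (g a * c a) * (L (- a) * L' a + L' a * L (- a)))"
proof -
  have 1: "M a * L (- a) + L a * M (- a) = s (g a * c a) * (L' a * L (- a)) + s (g (- a) * c (- a)) * (L a * L' (- a))"
    if a: "a \<in> R" for a
  proof -
    have Ls: "L a * (s k * x) = s k * (L a * x)" for k x
      by (metis mult.assoc L_s[OF a])
    have "M a * L (- a) = s (g a * c a) * (L' a * L (- a)) - s (g a * z) * (L a * L (- a))"
      by (simp only: M[OF a] right_diff_distrib left_diff_distrib mult.assoc s_mult_assoc)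
    moreover have "L a * M (- a) = s (g (- a) * c (- a)) * (L a * L' (- a)) + s (g a * z) * (L a * L (- a))"
      unfolding M[OF R_uminus[OF a]] g[OF a]
      by (simp add: right_diff_distrib Ls s_mult_assoc s_uminus)
    ultimately show ?thesis by simp
  qed
  have "(\<Sum>a\<in>R. M a * L (- a) + L a * M (- a)) =
     (\<Sum>a\<in>R. s (g a * c a) * (L' a * L (- a))) + (\<Sum>a\<in>R. s (g (- a) * c (- a)) * (L a * L' (- a)))"
    unfolding sum.distrib[symmetric] by (intro sum.cong refl 1)
  also have "(\<Sum>a\<in>R. s (g (- a) * c (- a)) * (L a * L' (- a))) = (\<Sum>a\<in>R. s (g a * c a) * (L (- a) * L' a))"
    using sum_R_uminus[of "\<lambda>a. s (g a * c a) * (L (- a) * L' a)"] by simp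
  finally show ?thesis
    by (simp add: distrib_left sum.distrib add.commute)
qed

text \<open>\<open>\<phi>\<close> stands for x -> Phi(x v) with a form Phi of weight zero, so it
  kills every product that begins with some \<open>W a\<close>. The first sum is the contribution of
  the Laplacians.\<close>

theorem fibre_identity:
  fixes \<phi> :: "'r \<Rightarrow> complex"
  assumes \<phi>_add: "\<And>x y. \<phi> (x + y) = \<phi> x + \<phi> y"
    and \<phi>_W: "\<And>a y. a \<in> R \<Longrightarrow> \<phi> (W a * y) = 0"
  shows "\<phi> ((\<Sum>a\<in>R. s (c a) * (E a * (L (- a) * L' a + L' a * L (- a)) + (L (- a) * L' a + L' a * L (- a)) * E a))
     + commutator (\<Sum>a\<in>R. L (- a) * L a) (\<Sum>a\<in>R. L' (- a) * L' a)) = 0"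
proof -
  let ?M = "\<lambda>a. L (- a) * L' a + L' a * L (- a)"
  define Q where "Q = commutator (\<Sum>a\<in>R. L (- a) * L a) (\<Sum>a\<in>R. L' (- a) * L' a)"
  interpret \<phi>: additive \<phi> by unfold_locales (rule \<phi>_add)
  have \<phi>_sW: "\<phi> (s k * W a) = 0" if "a \<in> R" for k a
    using \<phi>_W[OF that, of "s k"] W_s[OF that, of k] by simp
  have \<phi>_sWy: "\<phi> (s k * (W a * y)) = 0" if "a \<in> R" for k a y
    using \<phi>_W[OF that, of "s k * y"] W_s[OF that, of k] by (metis mult.assoc)

  obtain k where k: "(\<Sum>(a, b, e)\<in>TR. s (G (- a) (- b) (- e) * c b) * B a b (L e)) = (\<Sum>(a, b, e)\<in>TR. s (k a b e) * W b)"
    using sum_B_L by blast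
  have cubic: "\<phi> (\<Sum>(a, b, e)\<in>TR. s (k a b e) * W b) = 0"
    unfolding \<phi>.sum by (intro sum.neutral) (auto simp: TR_def \<phi>_sW)

  \<comment> \<open>The coefficient of \<open>E a\<close> is even under a -> -a, while
    \<open>E\<close> is odd.\<close>
  define Y where "Y = (\<Sum>a\<in>R. s (ip a a * (c a * d (- a) + d a * c (- a))) * E a)"
  have "Y = (\<Sum>a\<in>R. s (ip (- a) (- a) * (c (- a) * d (- (- a)) + d (- a) * c (- (- a)))) * E (- a))"
    unfolding Y_def by (rule sum_R_uminus[symmetric])
  also have "\<dots> = (\<Sum>a\<in>R. - (s (ip a a * (c a * d (- a) + d a * c (- a))) * E a))"
    by (intro sum.cong refl) (simp add: ip_uminus E_uminus mult.commute add.commute)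
  also have "\<dots> = - Y" by (simp add: Y_def sum_negf)
  finally have Y: "Y = 0" by (metis eq_zero_of_add_self eq_neg_iff_add_eq_0)

  \<comment> \<open>Again an even coefficient stands against the odd \<open>T i a\<close>.\<close>
  define U where "U = (\<Sum>a\<in>R. \<Sum>i\<in>I. s (ip a a * c a * c (- a) * (p i - q i)^2) * T i a)"
  have "U = (\<Sum>a\<in>R. \<Sum>i\<in>I. s (ip (- a) (- a) * c (- a) * c (- (- a)) * (p i - q i)^2) * T i (- a))"
    unfolding U_def by (rule sum_R_uminus[symmetric])
  also have "\<dots> = (\<Sum>a\<in>R. \<Sum>i\<in>I. - (s (ip a a * c a * c (- a) * (p i - q i)^2) * T i a))"
    by (intro sum.cong refl) (simp add: ip_uminus T_uminus mult_ac)
  also have "\<dots> = - U" by (simp add: U_def sum_negf)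
  finally have U: "U = 0" by (metis eq_zero_of_add_self eq_neg_iff_add_eq_0)

  have 1: "s (c a) * (E a * ?M a + ?M a * E a) - s (c a) * B (- a) a (E a) =
      (\<Sum>i\<in>I. - (s (ip a a * c a * c (- a) * (p i - q i)^2) * T i a)) - s (ip a a * (c a * d (- a))) * E a"
    if a: "a \<in> R" for a
  proof -
    have "s (c a) * (E a * ?M a + ?M a * E a) - s (c a) * B (- a) a (E a) =
        s (c a) * commutator (commutator (E a) (L (- a))) (L' a)"
      unfolding right_diff_distrib[symmetric]
      by (rule arg_cong[where f = "(*) (s (c a))"]) (simp add: B_def commutator_def algebra_simps)
    also have "\<dots> = (\<Sum>i\<in>I. s (c a * (ip a a * (p i - q i) * (- c (- a) * (p i - q i) - d (- a)))) * T i a)"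
      by (simp add: commutator_E_L_L'[OF a] sum_distrib_left s_mult_assoc)
    also have "\<dots> = (\<Sum>i\<in>I. - (s (ip a a * c a * c (- a) * (p i - q i)^2) * T i a) -
        s (ip a a * (c a * d (- a))) * (s (p i - q i) * T i a))"
    proof (intro sum.cong refl)
      fix i
      have "c a * (ip a a * (p i - q i) * (- c (- a) * (p i - q i) - d (- a))) =
        - (ip a a * c a * c (- a) * (p i - q i)^2) - ip a a * (c a * d (- a)) * (p i - q i)"
        by (simp add: algebra_simps power2_eq_square)
      then show "s (c a * (ip a a * (p i - q i) * (- c (- a) * (p i - q i) - d (- a)))) * T i a =
        - (s (ip a a * c a * c (- a) * (p i - q i)^2) * T i a) -
        s (ip a a * (c a * d (- a))) * (s (p i - q i) * T i a)"
        by (simp only: s_uminus_diff_mult)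
    qed
    finally show ?thesis
      by (simp add: sum_subtractf sum_negf E_def sum_distrib_left)
  qed
  define P where "P = (\<Sum>a\<in>R. s (c a) * (E a * ?M a + ?M a * E a))"
  define D where "D = (\<Sum>a\<in>R. s (c a) * B (- a) a (E a))"
  define D' where "D' = (\<Sum>a\<in>R. s (d a) * B (- a) a (W a))"
  define Z where "Z = (\<Sum>a\<in>R. s (ip a a * (c a * d (- a))) * E a)"
  define Z' where "Z' = (\<Sum>a\<in>R. s (ip a a * (d a * c (- a))) * E a)"
  have "P - D = - U - Z"
    unfolding P_def D_def Z_def sum_subtractf[symmetric] U_def sum_negf[symmetric]
    by (intro sum.cong refl) (simp only: 1)
  then have P: "P = (- U - Z) + D"
    by (simp only: diff_eq_eq)
  have Q: "Q = - D - D' - (\<Sum>(a, b, e)\<in>TR. s (k a b e) * W b)"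
    by (simp only: Q_def commutator_Q_decomp sum_B_L'_eq_0 k D_def D'_def add_0_right)
  have "\<phi> (P + Q) = - \<phi> Z - \<phi> D'"
    unfolding P Q U \<phi>_add \<phi>.diff \<phi>.minus \<phi>.zero cubic by simp
  \<comment> \<open>Of the summands in \<open>B_W\<close> only the one with \<open>E a\<close>
    survives under \<open>\<phi>\<close>; it is the half of Y that is missing in Z.\<close>
  moreover have "\<phi> D' = \<phi> Z'"
    unfolding D'_def Z'_def \<phi>.sum
  proof (intro sum.cong refl)
    fix a assume a: "a \<in> R"
    show "\<phi> (s (d a) * B (- a) a (W a)) = \<phi> (s (ip a a * (d a * c (- a))) * E a)"
      by (simp only: B_W[OF a] distrib_left[of "s (d a)"] \<phi>_add \<phi>_sWy[OF a] \<phi>_sW[OF a] s_mult_assoc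
          add_0_left add_0_right mult.left_commute[of "d a"])
  qed
  moreover have "\<phi> Z + \<phi> Z' = \<phi> Y"
    unfolding Y_def Z_def Z'_def \<phi>.sum sum.distrib[symmetric]
    by (intro sum.cong refl) (simp only: distrib_left[of "ip _ _"] s_add distrib_right \<phi>_add)
  moreover have "\<phi> Y = 0"
    by (simp only: Y \<phi>.zero)
  ultimately have "\<phi> (P + Q) = 0"
    by (simp add: add_eq_0_iff)
  then show ?thesis
    by (simp only: P_def Q_def)
qed

end

section \<open>Theta functions\<close>

lemma exp_abs_int_summable: "(\<lambda>n::int. exp (- \<bar>real_of_int n\<bar>)) summable_on UNIV"
proof -
  have "summable (\<lambda>n. exp (-1) ^ n :: real)"
    by (rule summable_geometric) simp
  then have "(\<lambda>n::nat. exp (-1) ^ n :: real) summable_on UNIV"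
    by (subst summable_on_UNIV_nonneg_real_iff) auto
  then have nat: "(\<lambda>n::nat. exp (- real n)) summable_on UNIV"
    by (simp add: exp_of_nat_mult[symmetric])
  have 1: "(\<lambda>n::int. exp (- \<bar>real_of_int n\<bar>)) summable_on range int"
    by (subst summable_on_reindex) (auto simp: o_def nat)
  have 2: "(\<lambda>n::int. exp (- \<bar>real_of_int n\<bar>)) summable_on range (\<lambda>n. - int n)"
    by (subst summable_on_reindex) (auto simp: o_def nat inj_def)
  have "range int \<union> range (\<lambda>n. - int n) = UNIV"
    by (auto simp: image_iff) (metis int_cases2)
  then show ?thesis
    using summable_on_union[OF 1 2] by simp
qed

text \<open>Complete the square in |x|. The 1 in |b| + 1 pays for the -|x| on the right, which makes
  the majorant geometric.\<close>

lemma gauss_exponent_bound: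
  fixes k b x :: real
  assumes "k > 0"
  shows "- k * x\<^sup>2 + b * x \<le> (\<bar>b\<bar> + 1)\<^sup>2 / (4 * k) - \<bar>x\<bar>"
proof -
  have "0 \<le> k * (\<bar>x\<bar> - (\<bar>b\<bar> + 1) / (2 * k))\<^sup>2"
    using assms by simp
  also have "\<dots> = k * x\<^sup>2 - (\<bar>b\<bar> + 1) * \<bar>x\<bar> + (\<bar>b\<bar> + 1)\<^sup>2 / (4 * k)"
    using assms by (simp add: power2_eq_square field_simps)
  finally have "(\<bar>b\<bar> + 1) * \<bar>x\<bar> - k * x\<^sup>2 \<le> (\<bar>b\<bar> + 1)\<^sup>2 / (4 * k)" by simp
  moreover have "b * x \<le> \<bar>b\<bar> * \<bar>x\<bar>"
    by (metis abs_ge_self abs_mult)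
  ultimately show ?thesis
    by (simp add: algebra_simps)
qed

text \<open>One majorant serves all slopes b with |b| at most c, hence a whole disc of arguments of
  the theta series. The shift h is 1/2 for \<open>theta11\<close> and 0 for the series obtained by
  the splitting according to parity.\<close>

lemma gauss_majorant:
  fixes k c h :: real
  assumes "k > 0"
  obtains M :: "int \<Rightarrow> real" where "M summable_on UNIV"
    and "\<And>n b. \<bar>b\<bar> \<le> c \<Longrightarrow> exp (- k * (of_int n + h)\<^sup>2 + b * (of_int n + h)) \<le> M n"
proof
  let ?M = "\<lambda>n::int. exp ((c + 1)\<^sup>2 / (4 * k) + \<bar>h\<bar>) * exp (- \<bar>real_of_int n\<bar>)"
  show "?M summable_on UNIV"
    by (intro summable_on_cmult_right exp_abs_int_summable)
  fix n :: int and b :: real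
  assume b: "\<bar>b\<bar> \<le> c"
  have "- k * (of_int n + h)\<^sup>2 + b * (of_int n + h) \<le> (\<bar>b\<bar> + 1)\<^sup>2 / (4 * k) - \<bar>of_int n + h\<bar>"
    by (rule gauss_exponent_bound[OF assms])
  also have "\<dots> \<le> (c + 1)\<^sup>2 / (4 * k) + \<bar>h\<bar> - \<bar>real_of_int n\<bar>"
  proof -
    have "(\<bar>b\<bar> + 1)\<^sup>2 / (4 * k) \<le> (c + 1)\<^sup>2 / (4 * k)"
      using b assms by (intro divide_right_mono power_mono) auto
    then show ?thesis by linarith
  qed
  finally show "exp (- k * (of_int n + h)\<^sup>2 + b * (of_int n + h)) \<le> ?M n"
    by (simp add: exp_add[symmetric])
qed

lemma exp_pi_i_even: "even p \<Longrightarrow> exp (of_real pi * \<i> * of_int p) = (1 :: complex)"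
  by (elim evenE) (use exp_integer_2pi in \<open>force simp: mult_ac\<close>)

lemma exp_pi_i_odd:
  assumes "odd p"
  shows "exp (of_real pi * \<i> * of_int p) = (- 1 :: complex)"
proof -
  have "exp (of_real pi * \<i> * of_int p) = exp (of_real pi * \<i> * of_int (p - 1)) * exp (of_real pi * \<i>)"
    unfolding exp_add[symmetric] by (rule arg_cong[of _ _ exp]) (simp add: algebra_simps)
  then show ?thesis
    using exp_pi_i_even[of "p - 1"] assms by (simp add: mult.commute)
qed

lemma abs_summable_on_mult_Times:
  fixes f :: "'a \<Rightarrow> complex" and g :: "'b \<Rightarrow> complex"
  assumes "(\<lambda>x. norm (f x)) summable_on A" "(\<lambda>x. norm (g x)) summable_on B"
  shows "(\<lambda>z. norm (case z of (x, y) \<Rightarrow> f x * g y)) summable_on (A \<times> B)"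
proof -
  have "(\<lambda>y. norm (f x * g y)) summable_on B" for x
    using assms(2) by (simp add: norm_mult summable_on_cmult_right)
  moreover have "(\<lambda>x. \<Sum>\<^sub>\<infinity>y\<in>B. norm (f x * g y)) summable_on A"
    using assms by (simp add: norm_mult infsum_cmult_right' summable_on_cmult_left)
  ultimately show ?thesis
    unfolding Infinite_Sum.abs_summable_on_Sigma_iff
    by (simp add: infsum_nonneg)
qed

lemma infsum_mult_Times:
  fixes f :: "'a \<Rightarrow> complex" and g :: "'b \<Rightarrow> complex"
  assumes "(\<lambda>x. norm (f x)) summable_on A" "(\<lambda>x. norm (g x)) summable_on B"
  shows "infsum f A * infsum g B = (\<Sum>\<^sub>\<infinity>(x, y)\<in>A \<times> B. f x * g y)"
proof -
  have "(\<lambda>(x, y). f x * g y) summable_on (A \<times> B)"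
    using abs_summable_on_mult_Times[OF assms] by (rule abs_summable_summable)
  from infsum_Sigma'_banach[OF this] show ?thesis
    by (simp only: infsum_cmult_right') (simp only: infsum_cmult_left')
qed

locale upper_half_plane =
  fixes \<tau> :: complex
  assumes Im_pos: "Im \<tau> > 0"
begin

abbreviation \<theta> where "\<theta> \<equiv> theta11 \<tau>"
abbreviation \<Lambda> where "\<Lambda> \<equiv> period_lattice \<tau>"

section \<open>The theta series: holomorphy, oddness and quasi-periods\<close>

definition theta_term :: "int \<Rightarrow> complex \<Rightarrow> complex" where
  "theta_term n z = exp (of_real pi * \<i> * \<tau> * (of_int n + 1/2)^2
          + 2 * of_real pi * \<i> * (z + 1/2) * (of_int n + 1/2))"

lemma theta11_eq: "\<theta> z = (\<Sum>\<^sub>\<infinity>n. theta_term n z)"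
  by (simp add: theta11_def theta_term_def)

lemma theta_term_majorant:
  obtains M :: "int \<Rightarrow> real" where "M summable_on UNIV"
    and "\<And>n z. norm z \<le> c \<Longrightarrow> norm (theta_term n z) \<le> M n"
proof -
  obtain M :: "int \<Rightarrow> real" where M: "M summable_on UNIV"
    "\<And>n b. \<bar>b\<bar> \<le> 2 * pi * c \<Longrightarrow>
       exp (- (pi * Im \<tau>) * (of_int n + 1/2)\<^sup>2 + b * (of_int n + 1/2)) \<le> M n"
    using gauss_majorant[of "pi * Im \<tau>" "2 * pi * c" "1/2"] Im_pos by auto
  show ?thesis
  proof (rule that[OF M(1)])
    fix n and z :: complex
    assume z: "norm z \<le> c"
    have "norm (theta_term n z) =
        exp (- (pi * Im \<tau>) * (of_int n + 1/2)\<^sup>2 + (- 2 * pi * Im z) * (of_int n + 1/2))"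
      unfolding theta_term_def norm_exp_eq_Re
      by (simp add: power2_eq_square algebra_simps)
    also have "\<dots> \<le> M n"
      using z abs_Im_le_cmod[of z] by (intro M(2)) (simp add: abs_mult)
    finally show "norm (theta_term n z) \<le> M n" .
  qed
qed

lemma theta_term_abs_summable: "(\<lambda>n. norm (theta_term n z)) summable_on UNIV"
proof -
  obtain M where "M summable_on UNIV" "\<And>n w. norm w \<le> norm z \<Longrightarrow> norm (theta_term n w) \<le> M n"
    by (rule theta_term_majorant[of "norm z"]) blast
  then show ?thesis
    by (intro Infinite_Sum.abs_summable_on_comparison_test'[of M]) auto
qed

lemma theta_uniform_limit:
  "uniform_limit (cball 0 c) (\<lambda>X z. \<Sum>n\<in>X. theta_term n z) \<theta> (finite_subsets_at_top UNIV)"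
proof -
  obtain M where "M summable_on UNIV" "\<And>n w. norm w \<le> c \<Longrightarrow> norm (theta_term n w) \<le> M n"
    by (rule theta_term_majorant[of c]) blast
  then show ?thesis
    using Weierstrass_m_test_general[of UNIV "cball 0 c" theta_term M] by (simp add: theta11_eq[abs_def])
qed

lemma theta_term_holomorphic [holomorphic_intros]: "theta_term n holomorphic_on A"
  unfolding theta_term_def by (intro holomorphic_intros)

lemma theta_holomorphic: "\<theta> holomorphic_on UNIV"
proof -
  have "\<theta> holomorphic_on ball 0 c" for c
  proof (rule holomorphic_uniform_limit[OF _ theta_uniform_limit])
    show "\<forall>\<^sub>F X in finite_subsets_at_top UNIV. continuous_on (cball 0 c) (\<lambda>z. \<Sum>n\<in>X. theta_term n z)
       \<and> (\<lambda>z. \<Sum>n\<in>X. theta_term n z) holomorphic_on ball 0 c"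
      by (intro always_eventually allI conjI holomorphic_on_imp_continuous_on holomorphic_intros)
  qed auto
  then have "\<theta> field_differentiable at z" for z
    by (metis holomorphic_on_imp_differentiable_at open_ball centre_in_ball mem_ball_0 less_add_one)
  then show ?thesis
    by (simp add: holomorphic_on_def field_differentiable_at_within)
qed

lemma theta_DERIV: "(\<theta> has_field_derivative deriv \<theta> z) (at z)"
  using theta_holomorphic by (auto intro: holomorphic_derivI)

lemma theta_uminus: "\<theta> (- z) = - \<theta> z"
proof -
  have "\<theta> (- z) = (\<Sum>\<^sub>\<infinity>n. theta_term (- 1 - n) (- z))"
    unfolding theta11_eq
    by (rule infsum_reindex_bij_witness[where i = "\<lambda>n. -1 - n" and j = "\<lambda>n. -1 - n"]) auto
  also have "\<dots> = (\<Sum>\<^sub>\<infinity>n. - theta_term n z)"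
  proof (rule infsum_cong)
    fix n :: int
    have "theta_term (- 1 - n) (- z) = theta_term n z * exp (- (of_real pi * \<i> * (2 * of_int n + 1)))"
      unfolding theta_term_def exp_add[symmetric]
      by (rule arg_cong[of _ _ exp]) (simp add: power2_eq_square field_simps)
    also have "exp (- (of_real pi * \<i> * (2 * of_int n + 1))) = exp (of_real pi * \<i> * of_int (- 2 * n - 1))"
      by (rule arg_cong[of _ _ exp]) (simp add: algebra_simps)
    also have "\<dots> = -1"
      by (rule exp_pi_i_odd) simp
    finally show "theta_term (- 1 - n) (- z) = - theta_term n z" by simp
  qed
  finally show ?thesis
    by (simp add: infsum_uminus theta11_eq)
qed

lemma theta_0 [simp]: "\<theta> 0 = 0"
  using theta_uminus[of 0] by simp

text \<open>The factor of automorphy for the translation by m + n \<tau>. The sign (-1)^m is written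
  as an exponential, so that multipliers can be compared through their exponents.\<close>

definition multiplier :: "int \<Rightarrow> int \<Rightarrow> complex \<Rightarrow> complex" where
  "multiplier m n z = exp (of_real pi * \<i> * of_int m - of_real pi * \<i> * \<tau> * of_int n ^ 2
     - 2 * of_real pi * \<i> * (z + 1/2) * of_int n)"

lemma multiplier_nonzero [simp]: "multiplier m n z \<noteq> 0"
  by (simp add: multiplier_def)

lemma theta_lattice: "\<theta> (z + of_int m + of_int n * \<tau>) = multiplier m n z * \<theta> z"
proof -
  have "\<theta> (z + of_int m + of_int n * \<tau>) = (\<Sum>\<^sub>\<infinity>k. multiplier m n z * theta_term (k + n) z)"
    unfolding theta11_eq
  proof (rule infsum_cong)
    fix k :: int
    have "theta_term k (z + of_int m + of_int n * \<tau>) =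
       multiplier m n z * theta_term (k + n) z * exp (2 * of_real pi * \<i> * of_int (m * k))"
      unfolding theta_term_def multiplier_def exp_add[symmetric]
      by (rule arg_cong[of _ _ exp]) (simp add: power2_eq_square field_simps)
    also have "2 * of_real pi * \<i> * of_int (m * k) = of_real pi * \<i> * of_int (2 * m * k)"
      by simp
    also have "exp \<dots> = 1"
      by (rule exp_pi_i_even) simp
    finally show "theta_term k (z + of_int m + of_int n * \<tau>) = multiplier m n z * theta_term (k + n) z"
      by simp
  qed
  also have "\<dots> = multiplier m n z * (\<Sum>\<^sub>\<infinity>k. theta_term (k + n) z)"
    by (rule infsum_cmult_right')
  also have "(\<Sum>\<^sub>\<infinity>k. theta_term (k + n) z) = \<theta> z"
    unfolding theta11_eq
    by (rule infsum_reindex_bij_witness[where i = "\<lambda>k. k - n" and j = "\<lambda>k. k + n"]) auto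
  finally show ?thesis .
qed

section \<open>Splitting of theta products and the Weierstrass relation\<close>

definition quad_term :: "int \<Rightarrow> complex \<Rightarrow> complex" where
  "quad_term p x = exp (of_real pi * \<i> * \<tau> / 2 * of_int p ^ 2 + 2 * of_real pi * \<i> * x * of_int p)"

text \<open>These are theta series of modulus 2 \<tau> at the argument 2 x: even p give
  characteristic 0, odd p characteristic 1/2.\<close>

definition even_part :: "complex \<Rightarrow> complex" where
  "even_part x = (\<Sum>\<^sub>\<infinity>p\<in>{p. even p}. quad_term p x)"

definition odd_part :: "complex \<Rightarrow> complex" where
  "odd_part x = (\<Sum>\<^sub>\<infinity>p\<in>{p. odd p}. quad_term p x)"

lemma quad_term_abs_summable: "(\<lambda>p. norm (quad_term p x)) summable_on A"
proof -
  obtain M :: "int \<Rightarrow> real" where M: "M summable_on UNIV"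
    "\<And>n b. \<bar>b\<bar> \<le> \<bar>2 * pi * Im x\<bar> \<Longrightarrow> exp (- (pi * Im \<tau> / 2) * (of_int n + 0)\<^sup>2 + b * (of_int n + 0)) \<le> M n"
    using gauss_majorant[of "pi * Im \<tau> / 2" "\<bar>2 * pi * Im x\<bar>" 0] Im_pos by auto
  have "norm (quad_term p x) \<le> M p" for p
  proof -
    have "norm (quad_term p x) = exp (- (pi * Im \<tau> / 2) * (of_int p + 0)\<^sup>2 + (- 2 * pi * Im x) * (of_int p + 0))"
      unfolding quad_term_def norm_exp_eq_Re by (simp add: power2_eq_square algebra_simps)
    also have "\<dots> \<le> M p" by (rule M(2)) simp
    finally show ?thesis .
  qed
  then have "(\<lambda>p. norm (quad_term p x)) summable_on UNIV"
    using M(1) by (intro Infinite_Sum.abs_summable_on_comparison_test'[of M]) auto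
  then show ?thesis
    by (rule summable_on_subset_banach) simp
qed

text \<open>The substitution \<open>p = m + n + 1\<close>, \<open>q = m - n\<close> in the product of the two theta series makes the
  exponent a sum of a function of \<open>p\<close> and a function of \<open>q\<close>; it maps onto the pairs with \<open>p + q\<close> odd.\<close>

lemma theta_mult: "\<theta> (x + y) * \<theta> (x - y) = even_part x * odd_part y - odd_part x * even_part y"
proof -
  define f where "f = (\<lambda>(p, q). exp (of_real pi * \<i> * of_int p) * (quad_term p x * quad_term q y))"
  let ?Ev = "{p::int. even p}" and ?Od = "{p::int. odd p}"
  have sm: "(\<lambda>(p, q). quad_term p x * quad_term q y) summable_on (A \<times> B)" for A B
    by (rule abs_summable_summable[OF abs_summable_on_mult_Times]) (rule quad_term_abs_summable)+
  have "\<theta> (x + y) * \<theta> (x - y) = (\<Sum>\<^sub>\<infinity>(m, n)\<in>UNIV \<times> UNIV. theta_term m (x + y) * theta_term n (x - y))"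
    unfolding theta11_eq by (rule infsum_mult_Times[OF theta_term_abs_summable theta_term_abs_summable])
  also have "\<dots> = (\<Sum>\<^sub>\<infinity>mn\<in>UNIV \<times> UNIV. f (fst mn + snd mn + 1, fst mn - snd mn))"
  proof (rule infsum_cong, clarify)
    fix m n :: int
    show "theta_term m (x + y) * theta_term n (x - y) = f (fst (m, n) + snd (m, n) + 1, fst (m, n) - snd (m, n))"
      unfolding f_def theta_term_def quad_term_def split exp_add[symmetric]
      by (rule arg_cong[of _ _ exp]) (simp add: power2_eq_square field_simps)
  qed
  also have "\<dots> = infsum f ((?Ev \<times> ?Od) \<union> (?Od \<times> ?Ev))"
  proof (rule infsum_reindex_bij_witness[where j = "\<lambda>mn. (fst mn + snd mn + 1, fst mn - snd mn)"
        and i = "\<lambda>pq. ((fst pq + snd pq - 1) div 2, (fst pq - snd pq - 1) div 2)"])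
    fix b :: "int \<times> int"
    assume "b \<in> (?Ev \<times> ?Od) \<union> (?Od \<times> ?Ev)"
    then have "even (fst b + snd b - 1)" "even (fst b - snd b - 1)" by auto
    then have "2 * ((fst b + snd b - 1) div 2) = fst b + snd b - 1"
        "2 * ((fst b - snd b - 1) div 2) = fst b - snd b - 1"
      by simp_all
    then show "(fst ((fst b + snd b - 1) div 2, (fst b - snd b - 1) div 2) +
         snd ((fst b + snd b - 1) div 2, (fst b - snd b - 1) div 2) + 1,
         fst ((fst b + snd b - 1) div 2, (fst b - snd b - 1) div 2) -
         snd ((fst b + snd b - 1) div 2, (fst b - snd b - 1) div 2)) = b"
      unfolding fst_conv snd_conv by (intro prod_eqI; simp; linarith)
  qed auto
  also have "\<dots> = infsum f (?Ev \<times> ?Od) + infsum f (?Od \<times> ?Ev)"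
  proof (rule infsum_Un_disjoint)
    show "f summable_on (?Ev \<times> ?Od)"
      using sm[of ?Ev ?Od] by (rule summable_on_cong[THEN iffD1, rotated]) (auto simp: f_def exp_pi_i_even)
    have "(\<lambda>z. - (case z of (p, q) \<Rightarrow> quad_term p x * quad_term q y)) summable_on (?Od \<times> ?Ev)"
      using sm[of ?Od ?Ev] by (simp add: summable_on_uminus)
    then show "f summable_on (?Od \<times> ?Ev)"
      by (rule summable_on_cong[THEN iffD1, rotated]) (auto simp: f_def exp_pi_i_odd)
  qed auto
  also have "infsum f (?Ev \<times> ?Od) = (\<Sum>\<^sub>\<infinity>(p, q)\<in>?Ev \<times> ?Od. quad_term p x * quad_term q y)"
    by (rule infsum_cong) (auto simp: f_def exp_pi_i_even)
  also have "\<dots> = even_part x * odd_part y"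
    unfolding even_part_def odd_part_def
    by (rule infsum_mult_Times[symmetric]) (rule quad_term_abs_summable)+
  also have "infsum f (?Od \<times> ?Ev) = (\<Sum>\<^sub>\<infinity>z\<in>?Od \<times> ?Ev. - (case z of (p, q) \<Rightarrow> quad_term p x * quad_term q y))"
    by (rule infsum_cong) (auto simp: f_def exp_pi_i_odd)
  also have "\<dots> = - (odd_part x * even_part y)"
    unfolding even_part_def odd_part_def infsum_uminus
    by (subst infsum_mult_Times) (auto intro: quad_term_abs_summable)
  finally show ?thesis by simp
qed

text \<open>By \<open>theta_mult\<close> every product theta(x + y) theta(x - y) is the 2 by 2 minor
  formed by the columns (\<open>even_part\<close>, \<open>odd_part\<close>) at x and y. This is the
  Pluecker relation between the minors of four such columns.\<close>

lemma weierstrass_three_term: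
  "\<theta> (x + y) * \<theta> (x - y) * (\<theta> (z + w) * \<theta> (z - w)) - \<theta> (x + z) * \<theta> (x - z) * (\<theta> (y + w) * \<theta> (y - w))
   + \<theta> (x + w) * \<theta> (x - w) * (\<theta> (y + z) * \<theta> (y - z)) = 0"
  unfolding theta_mult by (simp add: algebra_simps)

text \<open>Differentiate the three-term relation in w at w = z. There theta(z - w) vanishes, so the
  first product contributes only through the derivative of this factor, which is -theta'(0).\<close>

lemma weierstrass_derivative:
  "\<theta> (x + y) * \<theta> (x - y) * \<theta> (2 * z) * deriv \<theta> 0 =
     \<theta> (y + z) * \<theta> (y - z) * (deriv \<theta> (x + z) * \<theta> (x - z) - \<theta> (x + z) * deriv \<theta> (x - z))
   - \<theta> (x + z) * \<theta> (x - z) * (deriv \<theta> (y + z) * \<theta> (y - z) - \<theta> (y + z) * deriv \<theta> (y - z))"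
proof -
  note [derivative_intros] = DERIV_chain2[OF theta_DERIV]
  let ?f = "\<lambda>w. \<theta> (x + y) * \<theta> (x - y) * (\<theta> (z + w) * \<theta> (z - w)) - \<theta> (x + z) * \<theta> (x - z) * (\<theta> (y + w) * \<theta> (y - w))
   + \<theta> (x + w) * \<theta> (x - w) * (\<theta> (y + z) * \<theta> (y - z))"
  have "(?f has_field_derivative
      (\<theta> (x + y) * \<theta> (x - y) * (deriv \<theta> (z + z) * \<theta> (z - z) - \<theta> (z + z) * deriv \<theta> (z - z))
     - \<theta> (x + z) * \<theta> (x - z) * (deriv \<theta> (y + z) * \<theta> (y - z) - \<theta> (y + z) * deriv \<theta> (y - z))
     + (deriv \<theta> (x + z) * \<theta> (x - z) - \<theta> (x + z) * deriv \<theta> (x - z)) * (\<theta> (y + z) * \<theta> (y - z)))) (at z)"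
    by (auto intro!: derivative_eq_intros simp: algebra_simps)
  moreover have "(?f has_field_derivative 0) (at z)"
    unfolding weierstrass_three_term by simp
  ultimately have "\<theta> (x + y) * \<theta> (x - y) * (deriv \<theta> (z + z) * \<theta> (z - z) - \<theta> (z + z) * deriv \<theta> (z - z))
     - \<theta> (x + z) * \<theta> (x - z) * (deriv \<theta> (y + z) * \<theta> (y - z) - \<theta> (y + z) * deriv \<theta> (y - z))
     + (deriv \<theta> (x + z) * \<theta> (x - z) - \<theta> (x + z) * deriv \<theta> (x - z)) * (\<theta> (y + z) * \<theta> (y - z)) = 0"
    by (rule DERIV_unique)
  then show ?thesis by (simp add: algebra_simps)
qed

text \<open>The factor exp(- pi i x) turns the half-integral frequencies of theta into integral
  ones. The mean over [0, 1] of the resulting Fourier series is its coefficient \<open>c 0\<close>,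
  an exponential and hence nonzero; uniform convergence permits integration term by term.\<close>

lemma theta_not_identically_0: "\<exists>x. \<theta> x \<noteq> 0"
proof (rule ccontr)
  assume "\<not> ?thesis"
  then have th0: "\<theta> x = 0" for x by blast
  define c where "c n = exp (of_real pi * \<i> * \<tau> * (of_int n + 1/2)^2 + of_real pi * \<i> * (of_int n + 1/2))" for n :: int
  define g where "g n x = c n * exp (2 * of_real pi * \<i> * of_int n * of_real x)" for n and x :: real
  have g: "g n x = exp (- (of_real pi * \<i> * of_real x)) * theta_term n (of_real x)" for n x
    unfolding g_def c_def theta_term_def exp_add[symmetric]
    by (rule arg_cong[of _ _ exp]) (simp add: power2_eq_square field_simps)
  obtain M where M: "M summable_on UNIV" "\<And>n w. norm w \<le> 1 \<Longrightarrow> norm (theta_term n w) \<le> M n"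
    by (rule theta_term_majorant[of 1]) blast
  have "uniform_limit {0..1} (\<lambda>X x. \<Sum>n\<in>X. g n x) (\<lambda>x. \<Sum>\<^sub>\<infinity>n. g n x) (finite_subsets_at_top UNIV)"
  proof (rule Weierstrass_m_test_general[OF _ M(1)])
    fix n :: int and x :: real
    assume "x \<in> {0..1}"
    then show "norm (g n x) \<le> M n"
      using M(2)[of "of_real x" n] by (simp add: g norm_mult norm_exp_eq_Re)
  qed
  moreover have "(\<Sum>\<^sub>\<infinity>n. g n x) = 0" for x
    using th0[of "of_real x"] by (simp add: g infsum_cmult_right' theta11_eq)
  ultimately have "uniform_limit {0..1} (\<lambda>X x. \<Sum>n\<in>X. g n x) (\<lambda>x. 0) (finite_subsets_at_top UNIV)"
    by simp
  then obtain I J where I: "\<And>X. ((\<lambda>x. \<Sum>n\<in>X. g n x) has_integral I X) {0..1::real}"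
      and J: "((\<lambda>x. 0) has_integral J) {0..1::real}" and lim: "(I \<longlongrightarrow> J) (finite_subsets_at_top (UNIV :: int set))"
    by (rule uniform_limit_integral) (auto simp: g_def intro!: continuous_intros)
  have [simp]: "J = 0" using J by (simp add: has_integral_0_eq)
  have int: "(g n has_integral (if n = 0 then c 0 else 0)) {0..1}" for n
  proof (cases "n = 0")
    case True
    then show ?thesis
      using has_integral_const_real[of "c 0" 0 1] by (simp add: g_def[abs_def])
  next
    case False
    define k :: complex where "k = 2 * of_real pi * \<i> * of_int n"
    have k: "k \<noteq> 0" using False by (simp add: k_def)
    have "((\<lambda>x. c n * exp (k * of_real x)) has_integral
        (c n / k * exp (k * of_real 1) - c n / k * exp (k * of_real 0))) {0..1}"
    proof (rule fundamental_theorem_of_calculus)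
      fix x :: real
      have "((\<lambda>z. c n / k * exp (k * z)) has_field_derivative c n * exp (k * of_real x)) (at (of_real x))"
        using DERIV_cmult[OF DERIV_chain2[OF DERIV_exp DERIV_cmult[OF DERIV_ident]], of "c n / k" k "of_real x" UNIV] k
        by simp
      then show "((\<lambda>x. c n / k * exp (k * of_real x)) has_vector_derivative c n * exp (k * of_real x)) (at x within {0..1})"
        by (rule has_vector_derivative_at_within[OF has_vector_derivative_real_field])
    qed auto
    moreover have "exp k = 1"
      using exp_pi_i_even[of "2 * n"] by (simp add: mult_ac k_def)
    ultimately show ?thesis
      using False by (simp add: g_def[abs_def] k_def)
  qed
  have "I X = c 0" if "finite X" "0 \<in> X" for X
  proof (rule has_integral_unique[OF I])
    have "((\<lambda>x. \<Sum>n\<in>X. g n x) has_integral (\<Sum>n\<in>X. if n = 0 then c 0 else 0)) {0..1}"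
      by (intro has_integral_sum that int)
    then show "((\<lambda>x. \<Sum>n\<in>X. g n x) has_integral c 0) {0..1}"
      using that by simp
  qed
  then have "(I \<longlongrightarrow> c 0) (finite_subsets_at_top UNIV)"
    by (intro tendsto_eventually eventually_finite_subsets_at_top[THEN iffD2] exI[of _ "{0}"]) auto
  then have "c 0 = 0"
    using tendsto_unique[OF _ lim] by simp
  then show False by (simp add: c_def)
qed

lemma theta_entire [holomorphic_intros]: "f holomorphic_on A \<Longrightarrow> (\<lambda>z. \<theta> (f z)) holomorphic_on A"
  using holomorphic_on_compose_gen[OF _ theta_holomorphic, of f A] by (simp add: o_def)

lemma theta_shift_eq_of_ball:
  assumes "\<And>z. z \<in> ball p r \<Longrightarrow> \<theta> (z + a) = C * exp (b * z) * \<theta> z" "r > 0"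
  shows "\<theta> (z + a) = C * exp (b * z) * \<theta> z"
  by (rule analytic_continuation_open[of "ball p r" UNIV "\<lambda>z. \<theta> (z + a)" "\<lambda>z. C * exp (b * z) * \<theta> z"])
    (use assms in \<open>auto intro!: holomorphic_intros\<close>)

text \<open>Otherwise the translate would vanish on a ball around a point where theta does not,
  hence everywhere.\<close>

lemma theta_shift_not_both_0: "\<exists>p. \<theta> (p + a) \<noteq> 0 \<and> \<theta> p \<noteq> 0"
proof (rule ccontr)
  assume "\<not> ?thesis"
  then have *: "\<theta> (p + a) = 0 \<or> \<theta> p = 0" for p by blast
  obtain p where p: "\<theta> p \<noteq> 0" using theta_not_identically_0 by blast
  have "isCont \<theta> p"
    using theta_DERIV DERIV_isCont by blast
  then obtain r where r: "r > 0" "\<And>z. dist p z < r \<Longrightarrow> \<theta> z \<noteq> 0"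
    using p continuous_at_avoid by blast
  \<comment> \<open>With C = 0 and b = 0, \<open>theta_shift_eq_of_ball\<close> is the identity
    theorem for the zero function.\<close>
  have "\<theta> (z + a) = 0 * exp (0 * z) * \<theta> z" for z
    by (rule theta_shift_eq_of_ball[OF _ r(1), of p]) (use * r(2) in auto)
  then have "\<theta> z = 0" for z
    by (metis diff_add_cancel mult_zero_left)
  then show False using theta_not_identically_0 by blast
qed

lemma in_period_lattice: "z \<in> \<Lambda> \<longleftrightarrow> (\<exists>m n. z = of_int m + of_int n * \<tau>)"
  by (auto simp: period_lattice_def)

text \<open>A zero \<open>a\<close> of \<open>\<theta>\<close> kills one of the three Weierstrass terms, so that
  \<open>\<theta>(p + a) \<theta>(q + a) / (\<theta>(p) \<theta>(q))\<close> depends on \<open>p + q\<close> only. Hence \<open>\<theta>(p + a) / \<theta>(p)\<close> is an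
  exponential, and comparison of the quasi-periods puts \<open>a\<close> into the lattice.\<close>

lemma theta_zero_imp_lattice:
  assumes a: "\<theta> a = 0"
  shows "a \<in> \<Lambda>"
proof -
  let ?f = "\<lambda>p. \<theta> (p + a)"
  have key: "?f p * ?f q * (\<theta> r * \<theta> s) = ?f r * ?f s * (\<theta> p * \<theta> q)" if "p + q = r + s" for p q r s
  proof -
    \<comment> \<open>Chosen so that y + z = p, y - z = q, y + w = r and y - w = s. With y + a as
      first argument, the three-term relation loses the term that contains theta(a).\<close>
    define y z w where "y = (p + q) / 2" and "z = (p - q) / 2" and "w = (r - s) / 2"
    have e: "y + a + z = p + a" "y + a - z = q + a" "y + w = r" "y - w = s" "y + a + w = r + a"
       "y + a - w = s + a" "y + z = p" "y - z = q" "y + a - y = a"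
    proof -
      have q: "q = r + s - p" using that by (simp add: algebra_simps)
      show "y + a + z = p + a" "y + a - z = q + a" "y + w = r" "y - w = s" "y + a + w = r + a"
        "y + a - w = s + a" "y + z = p" "y - z = q" "y + a - y = a"
        unfolding y_def z_def w_def q by (simp_all add: field_simps)
    qed
    show ?thesis
      using weierstrass_three_term[of "y + a" y z w] unfolding e a by simp
  qed
  obtain p0 where p0: "?f p0 \<noteq> 0" "\<theta> p0 \<noteq> 0"
    using theta_shift_not_both_0 by blast
  \<comment> \<open>The logarithmic derivative of theta(p + a) / theta(p) at p0. Differentiating
    \<open>key\<close> for the pair p + h, p0 - h at h = 0 carries the value over to every p, with
    denominators cleared.\<close>
  define b where "b = (deriv \<theta> (p0 + a) * \<theta> p0 - ?f p0 * deriv \<theta> p0) / (?f p0 * \<theta> p0)"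
  have ode: "deriv \<theta> (p + a) * \<theta> p - ?f p * deriv \<theta> p = b * (?f p * \<theta> p)" for p
  proof -
    have f': "((\<lambda>h. \<theta> (c + h)) has_field_derivative deriv \<theta> c) (at 0)" for c
      using DERIV_chain2[OF theta_DERIV DERIV_add[OF DERIV_const DERIV_ident], of c 0] by simp
    have g': "((\<lambda>h. \<theta> (c - h)) has_field_derivative - deriv \<theta> c) (at 0)" for c
      using DERIV_chain2[OF theta_DERIV DERIV_diff[OF DERIV_const DERIV_ident], of c 0] by simp
    have "((\<lambda>h. \<theta> (p + a + h) * \<theta> (p0 + a - h) * (\<theta> p * \<theta> p0) - ?f p * ?f p0 * (\<theta> (p + h) * \<theta> (p0 - h)))
      has_field_derivative
        (deriv \<theta> (p + a) * ?f p0 - deriv \<theta> (p0 + a) * ?f p) * (\<theta> p * \<theta> p0)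
        - ?f p * ?f p0 * (deriv \<theta> p * \<theta> p0 - deriv \<theta> p0 * \<theta> p)) (at 0)"
      by (rule derivative_eq_intros f' g' refl)+ (simp add: algebra_simps)
    moreover have "\<theta> (p + a + h) * \<theta> (p0 + a - h) * (\<theta> p * \<theta> p0) - ?f p * ?f p0 * (\<theta> (p + h) * \<theta> (p0 - h)) = 0" for h
      using key[of "p + h" "p0 - h" p p0] by (simp add: algebra_simps)
    ultimately have "((\<lambda>h. 0) has_field_derivative
        (deriv \<theta> (p + a) * ?f p0 - deriv \<theta> (p0 + a) * ?f p) * (\<theta> p * \<theta> p0)
        - ?f p * ?f p0 * (deriv \<theta> p * \<theta> p0 - deriv \<theta> p0 * \<theta> p)) (at 0)"
      by (simp only:)
    then have "(deriv \<theta> (p + a) * ?f p0 - deriv \<theta> (p0 + a) * ?f p) * (\<theta> p * \<theta> p0)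
        - ?f p * ?f p0 * (deriv \<theta> p * \<theta> p0 - deriv \<theta> p0 * \<theta> p) = 0"
      by (rule DERIV_unique[OF _ DERIV_const])
    then have "(deriv \<theta> (p + a) * \<theta> p - ?f p * deriv \<theta> p) * (?f p0 * \<theta> p0) =
        (deriv \<theta> (p0 + a) * \<theta> p0 - ?f p0 * deriv \<theta> p0) * (?f p * \<theta> p)"
      by (simp add: algebra_simps)
    then show ?thesis
      using p0 unfolding b_def times_divide_eq_left by (subst eq_divide_eq) (simp add: algebra_simps)
  qed
  have "isCont \<theta> p0"
    using theta_DERIV DERIV_isCont by blast
  then obtain r where r: "r > 0" "\<And>z. dist p0 z < r \<Longrightarrow> \<theta> z \<noteq> 0"
    using p0 continuous_at_avoid by blast
  define C where "C = ?f p0 / \<theta> p0 * exp (- b * p0)"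
  have "?f z / \<theta> z * exp (- b * z) = C" if z: "z \<in> ball p0 r" for z
  proof -
    have "((\<lambda>z. ?f z / \<theta> z * exp (- b * z)) has_field_derivative 0) (at x within ball p0 r)" if x: "x \<in> ball p0 r" for x
    proof -
      have nz: "\<theta> x \<noteq> 0" using r(2) x by simp
      have 1: "(?f has_field_derivative deriv \<theta> (x + a)) (at x within ball p0 r)"
        using DERIV_chain2[OF theta_DERIV DERIV_add[OF DERIV_ident DERIV_const], of a x "ball p0 r"] by simp
      have 2: "(\<theta> has_field_derivative deriv \<theta> x) (at x within ball p0 r)"
        using theta_DERIV has_field_derivative_at_within by blast
      have 3: "((\<lambda>z. exp (- b * z)) has_field_derivative exp (- b * x) * (- b)) (at x within ball p0 r)"
        using DERIV_chain2[OF DERIV_exp DERIV_cmult[OF DERIV_ident, where c = "- b"]] by simp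
      have "((\<lambda>z. ?f z / \<theta> z * exp (- b * z)) has_field_derivative
         (deriv \<theta> (x + a) * \<theta> x - ?f x * deriv \<theta> x) / (\<theta> x * \<theta> x) * exp (- b * x) + exp (- b * x) * (- b) * (?f x / \<theta> x))
         (at x within ball p0 r)"
        by (rule DERIV_mult[OF DERIV_divide[OF 1 2 nz] 3])
      also have "(deriv \<theta> (x + a) * \<theta> x - ?f x * deriv \<theta> x) / (\<theta> x * \<theta> x) * exp (- b * x) + exp (- b * x) * (- b) * (?f x / \<theta> x) = 0"
        unfolding ode using nz by simp
      finally show ?thesis .
    qed
    from has_field_derivative_zero_constant[OF convex_ball this]
    obtain C' where C': "\<And>x. x \<in> ball p0 r \<Longrightarrow> ?f x / \<theta> x * exp (- b * x) = C'"
      by blast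
    show ?thesis
      using C'[OF z] C'[of p0] r(1) by (simp add: C_def)
  qed
  note quot = this
  have "\<theta> (z + a) = C * exp (b * z) * \<theta> z" if "z \<in> ball p0 r" for z
  proof -
    have "exp (- b * z) * exp (b * z) = 1"
      by (simp add: exp_add[symmetric])
    then show ?thesis
      using r(2)[of z] that unfolding quot[OF that, symmetric] by (simp add: mult.assoc[of _ "exp _" "exp _"])
  qed
  then have f: "\<theta> (z + a) = C * exp (b * z) * \<theta> z" for z
    by (rule theta_shift_eq_of_ball[OF _ r(1)])
  have "C \<noteq> 0" using f[of p0] p0 by auto
  \<comment> \<open>Translate theta(z + a) = C exp(b z) theta(z) by a period. The multipliers of
    theta(z + a) and theta(z) differ by the exponential on the left; exp(b z) gains the one on the
    right.\<close>
  have mult: "exp (- (2 * of_real pi * \<i> * a * of_int n)) = exp (b * (of_int m + of_int n * \<tau>))" for m n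
  proof -
    have "\<theta> (p0 + of_int m + of_int n * \<tau> + a) = multiplier m n (p0 + a) * \<theta> (p0 + a)"
      using theta_lattice[of "p0 + a" m n] by (simp add: algebra_simps)
    moreover have "multiplier m n (p0 + a) = multiplier m n p0 * exp (- (2 * of_real pi * \<i> * a * of_int n))"
      unfolding multiplier_def exp_add[symmetric] by (rule arg_cong[of _ _ exp]) (simp add: algebra_simps)
    moreover have "\<theta> (p0 + of_int m + of_int n * \<tau> + a) =
        C * exp (b * (p0 + of_int m + of_int n * \<tau>)) * (multiplier m n p0 * \<theta> p0)"
      unfolding f theta_lattice ..
    moreover have "exp (b * (p0 + of_int m + of_int n * \<tau>)) = exp (b * p0) * exp (b * (of_int m + of_int n * \<tau>))"
      unfolding exp_add[symmetric] by (rule arg_cong[of _ _ exp]) (simp add: algebra_simps)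
    ultimately have "exp (- (2 * of_real pi * \<i> * a * of_int n)) * (C * exp (b * p0) * \<theta> p0 * multiplier m n p0) =
        exp (b * (of_int m + of_int n * \<tau>)) * (C * exp (b * p0) * \<theta> p0 * multiplier m n p0)"
      using f[of p0] by (simp add: mult_ac)
    then show ?thesis
      using \<open>C \<noteq> 0\<close> p0 by simp
  qed
  \<comment> \<open>The period 1 makes b an integral multiple of 2 pi i; the period \<tau> then
    makes -2 pi i a equal to b \<tau> up to another such multiple.\<close>
  have "exp b = 1" using mult[of 0 1] by simp
  then obtain k where k: "b = of_int (2 * k) * of_real pi * \<i>"
    using exp_eq[of b 0] by auto
  have "exp (- (2 * of_real pi * \<i> * a)) = exp (b * \<tau>)" using mult[of 1 0] by simp
  then obtain j where "- (2 * of_real pi * \<i> * a) = b * \<tau> + of_real (of_int (2 * j) * pi) * \<i>"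
    unfolding exp_eq by blast
  then have "2 * of_real pi * \<i> * (a + of_int k * \<tau> + of_int j) = 0"
    by (simp add: k algebra_simps add_eq_0_iff)
  then have "a + of_int k * \<tau> + of_int j = 0" by simp
  then have "a = - of_int j + - of_int k * \<tau>"
    by algebra
  then have "a = of_int (- j) + of_int (- k) * \<tau>"
    by simp
  then show ?thesis
    unfolding in_period_lattice by blast
qed

lemma theta_nonzero: "z \<notin> \<Lambda> \<Longrightarrow> \<theta> z \<noteq> 0"
  using theta_zero_imp_lattice by blast

lemma lattice_uminus: "- z \<in> \<Lambda> \<longleftrightarrow> z \<in> \<Lambda>"
proof -
  have "- z \<in> \<Lambda>" if "z \<in> \<Lambda>" for z
  proof -
    from that obtain m n where "z = of_int m + of_int n * \<tau>" unfolding in_period_lattice by blast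
    then have "- z = of_int (- m) + of_int (- n) * \<tau>" by simp
    then show ?thesis unfolding in_period_lattice by blast
  qed
  from this[of z] this[of "- z"] show ?thesis by auto
qed

section \<open>Fay identities and quasi-periods of \<open>w_fun\<close> and
  \<open>zeta11\<close>\<close>

abbreviation w where "w \<equiv> w_fun \<tau>"
abbreviation \<zeta> where "\<zeta> \<equiv> zeta11 \<tau>"

text \<open>The derivative of \<open>w c z\<close> in the index c. In the application c is
  \<alpha>(H), the quantity that moves with the point of \<open>h\<close>.\<close>

definition dw :: "complex \<Rightarrow> complex \<Rightarrow> complex" where
  "dw c z = deriv \<theta> 0 / \<theta> z * (\<theta> (z - c) * deriv \<theta> (- c) - deriv \<theta> (z - c) * \<theta> (- c)) / (\<theta> (- c))\<^sup>2"

lemma w_uminus: "w (- c) (- z) = - w c z"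
  using theta_uminus[of "z - c"] theta_uminus[of c] theta_uminus[of z] by (simp add: w_fun_def)

lemma w_DERIV:
  assumes "c \<notin> \<Lambda>"
  shows "((\<lambda>c. w c z) has_field_derivative dw c z) (at c)"
proof -
  have nz: "\<theta> (- c) \<noteq> 0" using assms by (simp add: theta_nonzero lattice_uminus)
  have 1: "((\<lambda>c. \<theta> (z - c)) has_field_derivative - deriv \<theta> (z - c)) (at c)"
    using DERIV_chain2[OF theta_DERIV DERIV_diff[OF DERIV_const DERIV_ident], of z c] by simp
  have 2: "((\<lambda>c. \<theta> (- c)) has_field_derivative - deriv \<theta> (- c)) (at c)"
    using DERIV_chain2[OF theta_DERIV DERIV_minus[OF DERIV_ident], of c] by simp
  have "((\<lambda>c. deriv \<theta> 0 / \<theta> z * (\<theta> (z - c) / \<theta> (- c))) has_field_derivative dw c z) (at c)"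
    using DERIV_cmult[OF DERIV_divide[OF 1 2 nz], of "deriv \<theta> 0 / \<theta> z"]
    by (simp add: dw_def power2_eq_square algebra_simps)
  then show ?thesis
    by (simp add: w_fun_def[abs_def])
qed

lemma fay:
  assumes "x \<notin> \<Lambda>" "y \<notin> \<Lambda>" "x - y \<notin> \<Lambda>" "a \<notin> \<Lambda>" "b \<notin> \<Lambda>" "a + b \<notin> \<Lambda>"
  shows "w a x * w b y = w (a + b) x * w b (y - x) + w (a + b) y * w a (x - y)"
proof -
  have nz: "\<theta> x \<noteq> 0" "\<theta> y \<noteq> 0" "\<theta> (x - y) \<noteq> 0" "\<theta> a \<noteq> 0" "\<theta> b \<noteq> 0" "\<theta> (a + b) \<noteq> 0"
    using assms by (simp_all add: theta_nonzero)
  have minus: "\<theta> (- a) = - \<theta> a" "\<theta> (- b) = - \<theta> b" "\<theta> (- (a + b)) = - \<theta> (a + b)" "\<theta> (y - x) = - \<theta> (x - y)"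
    using theta_uminus[of "x - y"] by (simp_all only: theta_uminus minus_diff_eq)
  \<comment> \<open>The half-sums make p + q = x - a, p - q = y - b, r + s = a + b and r - s = x -
    y, so that the first product of the three-term relation contains the numerator of the left-hand
    side.\<close>
  define p q r s where "p = (x + y - a - b) / 2" and "q = (x - y - a + b) / 2"
    and "r = (a + b + x - y) / 2" and "s = (a + b - x + y) / 2"
  have e: "p + q = x - a" "p - q = y - b" "r + s = a + b" "r - s = x - y" "p + r = x" "p - r = y - (a + b)"
    "q + s = b" "q - s = x - y - a" "p + s = y" "p - s = x - (a + b)" "q + r = - (y - x - b)" "q - r = - a"
    by (simp_all add: p_def q_def r_def s_def field_simps)
  have key: "\<theta> (x - a) * \<theta> (y - b) * (\<theta> (a + b) * \<theta> (x - y)) - \<theta> x * \<theta> (y - (a + b)) * (\<theta> b * \<theta> (x - y - a))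
      + \<theta> y * \<theta> (x - (a + b)) * (\<theta> (y - x - b) * \<theta> a) = 0"
    using weierstrass_three_term[of p q r s] unfolding e theta_uminus by simp
  define k where "k = deriv \<theta> 0"
  have "w a x * w b y = k\<^sup>2 * (\<theta> (x - a) * \<theta> (y - b) * (\<theta> (a + b) * \<theta> (x - y)))
     / (\<theta> x * \<theta> y * \<theta> a * \<theta> b * \<theta> (a + b) * \<theta> (x - y))"
    using nz unfolding w_fun_def k_def[symmetric] minus by (simp add: field_simps power2_eq_square)
  also have "\<theta> (x - a) * \<theta> (y - b) * (\<theta> (a + b) * \<theta> (x - y)) = \<theta> x * \<theta> (y - (a + b)) * (\<theta> b * \<theta> (x - y - a))
      - \<theta> y * \<theta> (x - (a + b)) * (\<theta> (y - x - b) * \<theta> a)"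
    using key by (simp add: algebra_simps)
  also have "k\<^sup>2 * (\<theta> x * \<theta> (y - (a + b)) * (\<theta> b * \<theta> (x - y - a))
      - \<theta> y * \<theta> (x - (a + b)) * (\<theta> (y - x - b) * \<theta> a)) / (\<theta> x * \<theta> y * \<theta> a * \<theta> b * \<theta> (a + b) * \<theta> (x - y))
     = w (a + b) x * w b (y - x) + w (a + b) y * w a (x - y)"
    using nz unfolding w_fun_def k_def[symmetric] minus by (simp add: field_simps power2_eq_square)
  finally show ?thesis .
qed

lemma deriv_theta_uminus: "deriv \<theta> (- z) = deriv \<theta> z"
proof -
  have "((\<lambda>z. \<theta> (- z)) has_field_derivative - deriv \<theta> (- z)) (at z)"
    using DERIV_chain2[OF theta_DERIV DERIV_minus[OF DERIV_ident], of z] by simp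
  moreover have "((\<lambda>z. \<theta> (- z)) has_field_derivative - deriv \<theta> z) (at z)"
    unfolding theta_uminus by (rule DERIV_minus[OF theta_DERIV])
  ultimately show ?thesis
    using DERIV_unique by fastforce
qed

text \<open>The limit of \<open>fay\<close> for b -> -a, where the poles at a + b = 0 of the two
  terms on the right cancel. The differentiated three-term relation gives it directly.\<close>

lemma fay_degenerate:
  assumes "x \<notin> \<Lambda>" "y \<notin> \<Lambda>" "x - y \<notin> \<Lambda>" "a \<notin> \<Lambda>"
  shows "w a x * w (- a) y = w a (x - y) * (\<zeta> y - \<zeta> x) - dw a (x - y)"
proof -
  have nz: "\<theta> x \<noteq> 0" "\<theta> y \<noteq> 0" "\<theta> (x - y) \<noteq> 0" "\<theta> a \<noteq> 0"
    using assms by (simp_all add: theta_nonzero)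
  define p q r where "p = (x + y) / 2" and "q = (x - y) / 2 - a" and "r = (x - y) / 2"
  have e: "p + q = x - a" "p - q = y - - a" "2 * r = x - y" "p + r = x" "p - r = y" "q + r = x - y - a" "q - r = - a"
    by (simp_all add: p_def q_def r_def field_simps)
  define k where "k = deriv \<theta> 0"
  have key: "\<theta> (x - a) * \<theta> (y - - a) * \<theta> (x - y) * k =
      \<theta> (x - y - a) * - \<theta> a * (deriv \<theta> x * \<theta> y - \<theta> x * deriv \<theta> y)
      - \<theta> x * \<theta> y * (deriv \<theta> (x - y - a) * - \<theta> a - \<theta> (x - y - a) * deriv \<theta> a)"
    using weierstrass_derivative[of p q r] unfolding e theta_uminus deriv_theta_uminus k_def .
  have "w a x * w (- a) y = - (k * (\<theta> (x - a) * \<theta> (y - - a) * \<theta> (x - y) * k) / (\<theta> x * \<theta> y * (\<theta> a)\<^sup>2 * \<theta> (x - y)))"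
    using nz unfolding w_fun_def k_def[symmetric] theta_uminus minus_minus by (simp add: field_simps power2_eq_square)
  also have "\<dots> = w a (x - y) * (\<zeta> y - \<zeta> x) - dw a (x - y)"
    unfolding key using nz unfolding w_fun_def dw_def zeta11_def k_def[symmetric] theta_uminus deriv_theta_uminus
    by (simp add: field_simps power2_eq_square)
  finally show ?thesis .
qed

lemma zeta_uminus: "\<zeta> (- z) = - \<zeta> z"
  by (simp add: zeta11_def theta_uminus deriv_theta_uminus)

text \<open>For x = z_i - u and y = z_i - u' the left-hand sides are, up to \<alpha>(h_r), the
  coefficients in the derivative of L at one parameter along the connection of the other. Both are
  \<open>fay_degenerate\<close>, applied to the pair x, x - y and to the pair y, y - x.\<close>

lemma fay_dw:
  assumes "x \<notin> \<Lambda>" "y \<notin> \<Lambda>" "x - y \<notin> \<Lambda>" "a \<notin> \<Lambda>"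
  shows "dw a y + \<zeta> x * w a y = - w (- a) (x - y) * w a x + \<zeta> (x - y) * w a y"
    and "dw a x + \<zeta> y * w a x = w a (x - y) * w a y - \<zeta> (x - y) * w a x"
proof -
  show "dw a y + \<zeta> x * w a y = - w (- a) (x - y) * w a x + \<zeta> (x - y) * w a y"
    using fay_degenerate[of x "x - y" a] assms by (simp add: algebra_simps)
  have "w a y * w (- a) (y - x) = w a x * (\<zeta> (y - x) - \<zeta> y) - dw a x"
    using fay_degenerate[of y "y - x" a] assms lattice_uminus[of "x - y"] by simp
  moreover have "w (- a) (y - x) = - w a (x - y)" "\<zeta> (y - x) = - \<zeta> (x - y)"
    using w_uminus[of a "x - y"] zeta_uminus[of "x - y"] by simp_all
  ultimately show "dw a x + \<zeta> y * w a x = w a (x - y) * w a y - \<zeta> (x - y) * w a x"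
    by (simp add: algebra_simps)
qed

lemma w_lattice: "w c (z + of_int m + of_int n * \<tau>) = exp (2 * of_real pi * \<i> * c * of_int n) * w c z"
proof -
  have "multiplier m n (z - c) = exp (2 * of_real pi * \<i> * c * of_int n) * multiplier m n z"
    unfolding multiplier_def exp_add[symmetric] by (rule arg_cong[of _ _ exp]) (simp add: algebra_simps)
  moreover have "\<theta> (z + of_int m + of_int n * \<tau> - c) = multiplier m n (z - c) * \<theta> (z - c)"
    using theta_lattice[of "z - c" m n] by (simp add: algebra_simps)
  ultimately show ?thesis
    by (simp add: w_fun_def theta_lattice)
qed

lemma zeta_lattice:
  assumes "z \<notin> \<Lambda>"
  shows "\<zeta> (z + of_int m + of_int n * \<tau>) = \<zeta> z - 2 * of_real pi * \<i> * of_int n"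
proof -
  let ?l = "of_int m + of_int n * \<tau>" and ?c = "2 * of_real pi * \<i> * of_int n"
  have nz: "\<theta> z \<noteq> 0" using assms by (rule theta_nonzero)
  have 1: "((\<lambda>z. \<theta> (z + ?l)) has_field_derivative deriv \<theta> (z + ?l)) (at z)"
    using DERIV_chain2[OF theta_DERIV DERIV_add[OF DERIV_ident DERIV_const], of ?l z] by simp
  have "((\<lambda>z. of_real pi * \<i> * of_int m - of_real pi * \<i> * \<tau> * of_int n ^ 2 - ?c * (z + 1/2))
      has_field_derivative 0 - ?c * (1 + 0)) (at z)"
    by (intro DERIV_diff DERIV_const DERIV_cmult DERIV_add DERIV_ident)
  from DERIV_chain2[OF DERIV_exp this]
  have "(multiplier m n has_field_derivative multiplier m n z * - ?c) (at z)"
    by (simp add: multiplier_def[abs_def] mult_ac)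
  from DERIV_mult[OF this theta_DERIV]
  have "((\<lambda>z. \<theta> (z + ?l)) has_field_derivative multiplier m n z * - ?c * \<theta> z + deriv \<theta> z * multiplier m n z) (at z)"
    by (simp only: theta_lattice[unfolded add.assoc])
  then have "deriv \<theta> (z + ?l) = multiplier m n z * (deriv \<theta> z - ?c * \<theta> z)"
    using DERIV_unique[OF 1] by (simp add: algebra_simps)
  then have "\<zeta> (z + ?l) = multiplier m n z * (deriv \<theta> z - ?c * \<theta> z) / (multiplier m n z * \<theta> z)"
    by (simp only: zeta11_def theta_lattice[unfolded add.assoc])
  also have "\<dots> = \<zeta> z - ?c"
    using nz by (simp add: zeta11_def diff_divide_distrib)
  finally show ?thesis
    by (simp only: add.assoc)
qed

text \<open>The lattice is the zero set of the continuous function theta. This makes the regular set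
  open, so that one can differentiate on it.\<close>

lemma closed_lattice: "closed \<Lambda>"
proof -
  have "closed {z. \<theta> z = 0}"
    by (rule closed_Collect_eq) (auto intro!: continuous_at_imp_continuous_on DERIV_isCont[OF theta_DERIV])
  moreover have "{z. \<theta> z = 0} = \<Lambda>"
    using theta_zero_imp_lattice theta_lattice[of 0] by (auto simp: in_period_lattice)
  ultimately show ?thesis by simp
qed

end

section \<open>Holomorphic partial derivatives\<close>

text \<open>The ambient space is only a real normed space; the complex structure enters through the
  lines s -> x + d k s, along which the partial derivatives are taken.\<close>

locale complex_directions =
  fixes D :: "'e::real_normed_vector set" and d :: "'k \<Rightarrow> complex \<Rightarrow> 'e"
  assumes open_D: "open D" and linear_d: "bounded_linear (d k)"
begin

lemma d_add: "d k (s + t) = d k s + d k t"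
  and d_0 [simp]: "d k 0 = 0"
  using linear_d[of k] by (simp_all add: linear_simps)

text \<open>Holomorphy on each line separately, together with continuity in all variables at once;
  the latter makes Cauchy integrals depend continuously on the base point.\<close>

definition holo :: "('e \<Rightarrow> complex) \<Rightarrow> bool" where
  "holo f \<longleftrightarrow> continuous_on D f \<and> (\<forall>x\<in>D. \<forall>k. (\<lambda>s. f (x + d k s)) field_differentiable at 0)"

definition dpart :: "'k \<Rightarrow> ('e \<Rightarrow> complex) \<Rightarrow> 'e \<Rightarrow> complex" where
  "dpart k f x = deriv (\<lambda>s. f (x + d k s)) 0"

lemma holo_DERIV:
  assumes "holo f" "x + d k s \<in> D"
  shows "((\<lambda>s. f (x + d k s)) has_field_derivative dpart k f (x + d k s)) (at s)"
proof -
  have "((\<lambda>h. f (x + d k s + d k h)) has_field_derivative dpart k f (x + d k s)) (at 0)"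
    using assms DERIV_deriv_iff_field_differentiable unfolding holo_def dpart_def by blast
  then have "((\<lambda>h. f (x + d k (h + s))) has_field_derivative dpart k f (x + d k s)) (at 0)"
    by (simp add: d_add add_ac)
  then show ?thesis
    using DERIV_shift[of "\<lambda>s. f (x + d k s)" _ 0 s] by (simp add: add.commute)
qed

lemma holo_DERIV_0: "holo f \<Longrightarrow> x \<in> D \<Longrightarrow> ((\<lambda>s. f (x + d k s)) has_field_derivative dpart k f x) (at 0)"
  using holo_DERIV[of f x k 0] by simp

lemma holo_isCont: "holo f \<Longrightarrow> x \<in> D \<Longrightarrow> isCont f x"
  using open_D by (auto simp: holo_def continuous_on_eq_continuous_at)

lemma dpart_unique: "((\<lambda>s. f (x + d k s)) has_field_derivative f') (at 0) \<Longrightarrow> dpart k f x = f'"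
  unfolding dpart_def by (rule DERIV_imp_deriv)

lemma holoI:
  assumes "\<And>x. x \<in> D \<Longrightarrow> isCont f x"
    and "\<And>x k. x \<in> D \<Longrightarrow> ((\<lambda>s. f (x + d k s)) has_field_derivative f' x k) (at 0)"
  shows "holo f"
  using assms unfolding holo_def field_differentiable_def
  by (auto intro: continuous_at_imp_continuous_on)

text \<open>A single radius works for all base points near x0, so that their Cauchy integrals run
  over the same circle.\<close>

lemma neighbourhood_polydisc:
  assumes "x0 \<in> D"
  obtains \<rho> R where "\<rho> > 0" "R > 0" "\<And>x s. x \<in> ball x0 \<rho> \<Longrightarrow> s \<in> cball 0 R \<Longrightarrow> x + d k s \<in> D"
proof -
  obtain \<epsilon> where \<epsilon>: "\<epsilon> > 0" "ball x0 \<epsilon> \<subseteq> D"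
    using open_D assms open_contains_ball by blast
  obtain K where K: "K > 0" "\<And>s. norm (d k s) \<le> norm s * K"
    using bounded_linear.pos_bounded[OF linear_d] by blast
  show ?thesis
  proof (rule that[of "\<epsilon> / 2" "\<epsilon> / (2 * K)"])
    fix x s assume x: "x \<in> ball x0 (\<epsilon> / 2)" and s: "s \<in> cball (0::complex) (\<epsilon> / (2 * K))"
    have "norm (d k s) \<le> norm s * K" by (rule K)
    also have "\<dots> \<le> \<epsilon> / (2 * K) * K"
      using s K by (intro mult_right_mono) auto
    also have "\<dots> = \<epsilon> / 2" using K by simp
    finally have "norm (d k s) \<le> \<epsilon> / 2" .
    moreover have "dist x0 (x + d k s) \<le> dist x0 x + norm (d k s)"
      by (metis add_diff_cancel_left' dist_norm dist_triangle dist_commute)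
    ultimately have "x + d k s \<in> ball x0 \<epsilon>" using x by simp
    then show "x + d k s \<in> D" using \<epsilon> by blast
  qed (use \<epsilon> K in auto)
qed

definition circ :: "real \<Rightarrow> real \<Rightarrow> complex" where
  "circ R t = of_real R * exp (2 * of_real pi * \<i> * of_real t)"

lemma circ: "R > 0 \<Longrightarrow> circ R t \<in> cball 0 R" "R > 0 \<Longrightarrow> circ R t \<noteq> 0"
  by (simp_all add: circ_def norm_mult norm_exp_eq_Re)

text \<open>Cauchy's formula for the derivative. The velocity of the circle is 2 pi i times its
  position relative to the centre, which cancels the prefactor and one power of the denominator.
  Over a fixed real interval, limits and derivatives in x can be taken under the integral.\<close>

lemma cauchy_dpart:
  assumes f: "holo f" and R: "R > 0" and D: "\<And>s. s \<in> cball 0 R \<Longrightarrow> x + d k s \<in> D"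
  shows "dpart k f x = integral (cbox 0 1) (\<lambda>t. f (x + d k (circ R t)) / circ R t)"
proof -
  let ?g = "\<lambda>s. f (x + d k s)"
  have hol: "?g field_differentiable at s" if "s \<in> cball 0 R" for s
    using holo_DERIV[OF f D[OF that]] field_differentiable_def by blast
  have "(?g has_field_derivative (1 / (2 * of_real pi * \<i>) * contour_integral (circlepath 0 R) (\<lambda>s. ?g s / (s - 0)^2))) (at 0)"
  proof (rule Cauchy_derivative_integral_circlepath)
    show "continuous_on (cball 0 R) ?g"
      using hol field_differentiable_imp_continuous_at continuous_at_imp_continuous_on by blast
    show "?g holomorphic_on ball 0 R"
      unfolding holomorphic_on_def using hol field_differentiable_at_within ball_subset_cball by blast
  qed (use R in auto)
  then have "dpart k f x = 1 / (2 * of_real pi * \<i>) * contour_integral (circlepath 0 R) (\<lambda>s. ?g s / (s - 0)^2)"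
    by (rule dpart_unique)
  also have "\<dots> = 1 / (2 * of_real pi * \<i>) * integral {0..1} (\<lambda>t. (2 * of_real pi * \<i>) * (?g (circ R t) / circ R t))"
  proof -
    have "?g (circlepath 0 R t) / (circlepath 0 R t - 0)^2 * vector_derivative (circlepath 0 R) (at t) =
        (2 * of_real pi * \<i>) * (?g (circ R t) / circ R t)" for t
    proof -
      have "circlepath 0 R t = circ R t" "vector_derivative (circlepath 0 R) (at t) = 2 * of_real pi * \<i> * circ R t"
        by (simp_all only: vector_derivative_circlepath) (simp_all add: circlepath circ_def)
      then show ?thesis
        using circ(2)[OF R, of t] by (simp add: power2_eq_square)
    qed
    then show ?thesis
      by (simp only: contour_integral_integral)
  qed
  also have "\<dots> = integral (cbox 0 1) (\<lambda>t. ?g (circ R t) / circ R t)"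
    by (subst integral_mult_right) simp
  finally show ?thesis .
qed

lemma continuous_on_circ: "continuous_on A (circ R)"
  unfolding circ_def by (intro continuous_intros)

lemma continuous_on_cauchy_kernel:
  assumes f: "continuous_on D f" and R: "R > 0"
    and D: "\<And>x s. x \<in> U \<Longrightarrow> s \<in> cball 0 R \<Longrightarrow> h x + d k s \<in> D" and h: "continuous_on U h"
  shows "continuous_on (U \<times> A) (\<lambda>(x, t). f (h x + d k (circ R t)) / circ R t)"
proof -
  have "continuous_on (U \<times> A) (\<lambda>p. h (fst p))"
    by (rule continuous_on_compose2[OF h continuous_on_fst]) (auto intro: continuous_intros)
  moreover have "continuous_on (U \<times> A) (\<lambda>p. circ R (snd p))"
    by (rule continuous_on_compose2[OF continuous_on_circ continuous_on_snd]) (auto intro: continuous_intros)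
  moreover from this have "continuous_on (U \<times> A) (\<lambda>p. d k (circ R (snd p)))"
    by (rule bounded_linear.continuous_on[OF linear_d])
  ultimately have "continuous_on (U \<times> A) (\<lambda>p. f (h (fst p) + d k (circ R (snd p))) / circ R (snd p))"
    by (intro continuous_on_divide continuous_on_compose2[OF f] continuous_on_add)
      (use D circ[OF R] in auto)
  then show ?thesis by (simp add: case_prod_unfold)
qed

lemma dpart_continuous:
  assumes f: "holo f"
  shows "continuous_on D (dpart k f)"
proof -
  have "isCont (dpart k f) x0" if x0: "x0 \<in> D" for x0
  proof -
    obtain \<rho> R where \<rho>: "\<rho> > 0" and R: "R > 0"
      and D: "\<And>x s. x \<in> ball x0 \<rho> \<Longrightarrow> s \<in> cball 0 R \<Longrightarrow> x + d k s \<in> D"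
      by (rule neighbourhood_polydisc[OF x0, of k]) blast
    have "continuous_on (ball x0 \<rho>) (\<lambda>x. integral (cbox 0 1) (\<lambda>t. f (x + d k (circ R t)) / circ R t))"
      using f D R by (intro integral_continuous_on_param continuous_on_cauchy_kernel) (auto simp: holo_def)
    then have "continuous_on (ball x0 \<rho>) (dpart k f)"
      by (rule continuous_on_eq) (rule cauchy_dpart[symmetric], use f R D in auto)
    then show ?thesis
      using \<rho> by (simp add: continuous_on_eq_continuous_at)
  qed
  then show ?thesis
    by (simp add: continuous_at_imp_continuous_on)
qed

text \<open>Cauchy's formula for \<open>dpart k f\<close> is differentiated in the direction l under
  the integral. The result is Cauchy's formula again, now for \<open>dpart l f\<close>; this yields
  both the existence of second derivatives and their symmetry.\<close>

lemma dpart_dpart: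
  assumes f: "holo f" and x0: "x0 \<in> D"
  obtains R where "R > 0" "\<And>s. s \<in> cball 0 R \<Longrightarrow> x0 + d k s \<in> D"
    "((\<lambda>p. dpart k f (x0 + d l p)) has_field_derivative
       integral (cbox 0 1) (\<lambda>t. dpart l f (x0 + d k (circ R t)) / circ R t)) (at 0)"
proof -
  obtain \<rho> R where \<rho>: "\<rho> > 0" and R: "R > 0"
    and D: "\<And>x s. x \<in> ball x0 \<rho> \<Longrightarrow> s \<in> cball 0 R \<Longrightarrow> x + d k s \<in> D"
    by (rule neighbourhood_polydisc[OF x0, of k]) blast
  have cont: "isCont (\<lambda>p. x0 + d l p) 0"
    by (intro isCont_add continuous_const bounded_linear.isCont[OF linear_d] continuous_ident)
  then obtain \<epsilon> where \<epsilon>: "\<epsilon> > 0" "\<And>p. p \<in> ball 0 \<epsilon> \<Longrightarrow> x0 + d l p \<in> ball x0 \<rho>"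
    using \<rho> unfolding continuous_at_eps_delta by (auto simp: dist_commute)
  let ?U = "ball 0 \<epsilon> :: complex set"
  have D': "x0 + d l p + d k s \<in> D" if "p \<in> ?U" "s \<in> cball 0 R" for p s
    using D \<epsilon> that by blast
  have hc: "continuous_on ?U (\<lambda>p. x0 + d l p)"
    by (intro continuous_on_add continuous_on_const bounded_linear.continuous_on[OF linear_d] continuous_on_id)
  have "((\<lambda>p. integral (cbox 0 1) (\<lambda>t. f (x0 + d l p + d k (circ R t)) / circ R t)) has_field_derivative
     integral (cbox 0 1) (\<lambda>t. dpart l f (x0 + d l 0 + d k (circ R t)) / circ R t)) (at 0 within ?U)"
  proof (rule leibniz_rule_field_derivative)
    fix p and t :: real assume p: "p \<in> ?U"
    have "((\<lambda>p. f (x0 + d k (circ R t) + d l p)) has_field_derivative dpart l f (x0 + d k (circ R t) + d l p)) (at p)"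
      using holo_DERIV[OF f, of "x0 + d k (circ R t)" l p] D'[OF p circ(1)[OF R]] by (simp add: add_ac)
    then have "((\<lambda>p. f (x0 + d l p + d k (circ R t))) has_field_derivative dpart l f (x0 + d l p + d k (circ R t))) (at p)"
      by (simp add: add_ac)
    then show "((\<lambda>p. f (x0 + d l p + d k (circ R t)) / circ R t) has_field_derivative
        dpart l f (x0 + d l p + d k (circ R t)) / circ R t) (at p within ?U)"
      by (intro DERIV_cdivide) (rule has_field_derivative_at_within)
  next
    fix p assume p: "p \<in> ?U"
    have "continuous_on ({p} \<times> cbox 0 1) (\<lambda>(p, t). f (x0 + d l p + d k (circ R t)) / circ R t)"
      using f D' p R by (intro continuous_on_cauchy_kernel) (auto simp: holo_def)
    moreover have "continuous_on (cbox 0 1) (\<lambda>t::real. (p, t))"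
      by (intro continuous_on_Pair continuous_on_const continuous_on_id)
    ultimately have "continuous_on (cbox 0 1) (\<lambda>t. case (p, t) of (p, t) \<Rightarrow> f (x0 + d l p + d k (circ R t)) / circ R t)"
      by (rule continuous_on_compose2) auto
    then show "(\<lambda>t. f (x0 + d l p + d k (circ R t)) / circ R t) integrable_on cbox 0 1"
      by (intro integrable_continuous) simp
  next
    show "continuous_on (?U \<times> cbox 0 1) (\<lambda>(p, t). dpart l f (x0 + d l p + d k (circ R t)) / circ R t)"
      using D' R hc by (intro continuous_on_cauchy_kernel dpart_continuous f)
  qed (use \<epsilon> in auto)
  then have der: "((\<lambda>p. integral (cbox 0 1) (\<lambda>t. f (x0 + d l p + d k (circ R t)) / circ R t)) has_field_derivative
     integral (cbox 0 1) (\<lambda>t. dpart l f (x0 + d k (circ R t)) / circ R t)) (at 0)"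
    using \<epsilon>(1) by (simp add: at_within_open[of 0 ?U])
  have eq: "integral (cbox 0 1) (\<lambda>t. f (x0 + d l p + d k (circ R t)) / circ R t) = dpart k f (x0 + d l p)"
    if "p \<in> ?U" for p
    using cauchy_dpart[OF f R, of "x0 + d l p" k] D' that by simp
  have "((\<lambda>p. dpart k f (x0 + d l p)) has_field_derivative
     integral (cbox 0 1) (\<lambda>t. dpart l f (x0 + d k (circ R t)) / circ R t)) (at 0)"
    by (rule has_field_derivative_transform_within_open[OF der, of ?U]) (use \<epsilon>(1) eq in auto)
  then show thesis
    using that[of R] R D[of x0] \<rho> by simp
qed

lemma holo_dpart: "holo f \<Longrightarrow> holo (dpart k f)"
  unfolding holo_def[of "dpart k f"] field_differentiable_def
  by (auto intro: dpart_continuous elim: dpart_dpart[of f])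

lemma dpart_commute:
  assumes "holo f" "x \<in> D"
  shows "dpart k (dpart l f) x = dpart l (dpart k f) x"
proof -
  obtain R where R: "R > 0" "\<And>s. s \<in> cball 0 R \<Longrightarrow> x + d k s \<in> D"
    and *: "((\<lambda>p. dpart k f (x + d l p)) has_field_derivative
       integral (cbox 0 1) (\<lambda>t. dpart l f (x + d k (circ R t)) / circ R t)) (at 0)"
    using dpart_dpart[OF assms] by blast
  show ?thesis
    using cauchy_dpart[OF holo_dpart[OF assms(1), of l] R] dpart_unique[OF *] by simp
qed

lemma holo_const: "holo (\<lambda>x. c)"
  by (rule holoI[where f' = "\<lambda>x k. 0"]) auto

lemma holo_add: "holo f \<Longrightarrow> holo g \<Longrightarrow> holo (\<lambda>x. f x + g x)"
  by (rule holoI[where f' = "\<lambda>x k. dpart k f x + dpart k g x"])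
    (intro DERIV_add holo_DERIV_0 isCont_add holo_isCont; assumption)+

lemma holo_mult: "holo f \<Longrightarrow> holo g \<Longrightarrow> holo (\<lambda>x. f x * g x)"
  \<comment> \<open>The unevaluated \<open>d k 0\<close> keeps the derivative in the literal shape
    that \<open>DERIV_mult\<close> produces.\<close>
  by (rule holoI[where f' = "\<lambda>x k. dpart k f x * g (x + d k 0) + dpart k g x * f (x + d k 0)"])
    (intro DERIV_mult holo_DERIV_0 isCont_mult holo_isCont; assumption)+

lemma holo_cmult: "holo f \<Longrightarrow> holo (\<lambda>x. c * f x)"
  by (intro holo_mult holo_const)

lemma holo_cong:
  assumes "\<And>x. x \<in> D \<Longrightarrow> f x = g x" "holo f"
  shows "holo g"
proof -
  have "continuous_on D g"
    using assms continuous_on_cong[of D D f g] by (auto simp: holo_def)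
  moreover have "(\<lambda>s. g (x + d k s)) field_differentiable at 0" if x: "x \<in> D" for x k
  proof -
    have "open ((\<lambda>s. x + d k s) -` D)"
      using open_D by (intro open_vimage continuous_on_add continuous_on_const bounded_linear.continuous_on[OF linear_d] continuous_on_id)
    then have "((\<lambda>s. g (x + d k s)) has_field_derivative dpart k f x) (at 0)"
      by (rule has_field_derivative_transform_within_open[OF holo_DERIV_0[OF assms(2) x]])
        (use x assms(1) in auto)
    then show ?thesis by (auto simp: field_differentiable_def)
  qed
  ultimately show ?thesis by (simp add: holo_def)
qed

lemma dpart_cong:
  assumes "\<And>y. y \<in> D \<Longrightarrow> f y = g y" "x \<in> D"
  shows "dpart k f x = dpart k g x"
proof -
  have "open ((\<lambda>s. x + d k s) -` D)"
    using open_D by (intro open_vimage continuous_on_add continuous_on_const bounded_linear.continuous_on[OF linear_d] continuous_on_id)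
  then have "eventually (\<lambda>s. s \<in> (\<lambda>s. x + d k s) -` D) (nhds 0)"
    using assms by (intro eventually_nhds_in_open) auto
  then have "eventually (\<lambda>s. f (x + d k s) = g (x + d k s)) (nhds 0)"
    by eventually_elim (use assms(1) in auto)
  then show ?thesis
    unfolding dpart_def by (intro deriv_cong_ev refl)
qed

lemma dpart_add: "holo f \<Longrightarrow> holo g \<Longrightarrow> x \<in> D \<Longrightarrow> dpart k (\<lambda>x. f x + g x) x = dpart k f x + dpart k g x"
  by (rule dpart_unique) (intro DERIV_add holo_DERIV_0)

lemma dpart_cmult: "holo f \<Longrightarrow> x \<in> D \<Longrightarrow> dpart k (\<lambda>x. c * f x) x = c * dpart k f x"
  by (rule dpart_unique) (intro DERIV_cmult holo_DERIV_0)

lemma dpart_mult: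
  assumes "holo f" "holo g" "x \<in> D"
  shows "dpart k (\<lambda>x. f x * g x) x = dpart k f x * g x + f x * dpart k g x"
  using DERIV_mult[OF holo_DERIV_0[OF assms(1,3), of k] holo_DERIV_0[OF assms(2,3), of k]]
  by (intro dpart_unique) (simp add: mult.commute add.commute)

end

section \<open>Root systems of simple Lie algebras\<close>

context lie_algebra
begin

lemma br_add_left: "bracket (x + y) z = bracket x z + bracket y z"
  and br_scale_left: "bracket (scale c x) z = scale c (bracket x z)"
  and br_add_right: "bracket z (x + y) = bracket z x + bracket z y"
  and br_scale_right: "bracket z (scale c x) = scale c (bracket z x)"
  using bracket_linear_left[of z] bracket_linear_right[of z]
  unfolding Vector_Spaces.linear_iff by auto

lemma br_zero_left [simp]: "bracket 0 z = 0" and br_zero_right [simp]: "bracket z 0 = 0"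
  using br_add_left[of 0 0 z] br_add_right[of z 0 0] by auto

lemma br_uminus_left: "bracket (- x) z = - bracket x z"
  and br_uminus_right: "bracket z (- x) = - bracket z x"
  using br_add_left[of x "- x" z] br_add_right[of z x "- x"] by (simp_all add: eq_neg_iff_add_eq_0 add.commute)

lemma br_diff_left: "bracket (x - y) z = bracket x z - bracket y z"
  and br_diff_right: "bracket z (x - y) = bracket z x - bracket z y"
  using br_add_left[of x "- y" z] br_add_right[of z x "- y"] by (simp_all add: br_uminus_left br_uminus_right)

lemma br_sum_left: "bracket (sum f A) z = (\<Sum>i\<in>A. bracket (f i) z)"
  and br_sum_right: "bracket z (sum f A) = (\<Sum>i\<in>A. bracket z (f i))"
  by (induction A rule: infinite_finite_induct) (simp_all add: br_add_left br_add_right)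

lemma br_anticomm: "bracket y x = - bracket x y"
proof -
  have "bracket x y + bracket y x = 0"
    using bracket_self[of "x + y"] unfolding br_add_left br_add_right by (simp add: bracket_self add.commute)
  then show ?thesis
    by (metis add.commute eq_neg_iff_add_eq_0)
qed

lemma br_derivation: "bracket x (bracket y z) = bracket (bracket x y) z + bracket y (bracket x z)"
proof -
  have "bracket y (bracket z x) = - bracket y (bracket x z)"
    by (simp only: br_anticomm[of z x] br_uminus_right)
  moreover have "bracket z (bracket x y) = - bracket (bracket x y) z"
    by (rule br_anticomm)
  ultimately show ?thesis
    using jacobi[of x y z] by (simp add: diff_eq_eq)
qed

end

locale finite_dim_lie_algebra = lie_algebra scale bracket
  for scale :: "complex \<Rightarrow> 'g::ab_group_add \<Rightarrow> 'g" and bracket +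
  assumes fin_dim: finite_dim
begin

text \<open>Names the basis chosen inside \<open>endo_trace\<close>, so that all traces are sums
  over the same matrix entries.\<close>

definition trace_basis :: "'g set" where
  "trace_basis = (SOME B. independent B \<and> span B = UNIV)"

lemma trace_basis: "independent trace_basis" "span trace_basis = UNIV"
proof -
  have "\<exists>B. independent B \<and> span B = UNIV"
    using maximal_independent_subset[of UNIV] by (metis UNIV_I subset_antisym subset_UNIV)
  then show "independent trace_basis" "span trace_basis = UNIV"
    unfolding trace_basis_def by (metis (mono_tags, lifting) someI_ex)+
qed

lemma independent_imp_finite: "independent S \<Longrightarrow> finite S"
  using fin_dim independent_span_bound[of _ S] unfolding finite_dim_def by auto

lemma endo_trace_eq: "endo_trace f = (\<Sum>b\<in>trace_basis. representation trace_basis (f b) b)"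
  by (simp add: endo_trace_def trace_basis_def Let_def)

lemma endo_trace_add: "endo_trace (\<lambda>x. f x + g x) = endo_trace f + endo_trace g"
  by (simp add: endo_trace_eq representation_add trace_basis sum.distrib)

lemma endo_trace_diff: "endo_trace (\<lambda>x. f x - g x) = endo_trace f - endo_trace g"
  by (simp add: endo_trace_eq representation_diff trace_basis sum_subtractf)

lemma endo_trace_scale: "endo_trace (\<lambda>x. scale c (f x)) = c * endo_trace f"
  by (simp add: endo_trace_eq representation_scale trace_basis sum_distrib_left)

text \<open>The double sum over matrix entries is symmetric in f and g, which gives the cyclicity of
  the trace.\<close>

lemma endo_trace_comp:
  assumes f_add: "\<And>x y. f (x + y) = f x + f y" and f_scale: "\<And>c x. f (scale c x) = scale c (f x)"
  shows "endo_trace (\<lambda>x. f (g x)) =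
    (\<Sum>b\<in>trace_basis. \<Sum>c\<in>trace_basis. representation trace_basis (g b) c * representation trace_basis (f c) b)"
proof -
  let ?B = trace_basis
  have fin: "finite ?B" by (rule independent_imp_finite[OF trace_basis(1)])
  have f_0: "f 0 = 0" using f_add[of 0 0] by simp
  have f_sum: "f (sum k A) = (\<Sum>i\<in>A. f (k i))" for k and A :: "'g set"
    by (induction A rule: infinite_finite_induct) (simp_all add: f_0 f_add)
  have "f (g b) = (\<Sum>c\<in>?B. scale (representation ?B (g b) c) (f c))" for b
  proof -
    have "f (g b) = f (\<Sum>c\<in>?B. scale (representation ?B (g b) c) c)"
      by (subst sum_representation_eq) (use trace_basis fin in auto)
    then show ?thesis by (simp add: f_sum f_scale)
  qed
  then have "representation ?B (f (g b)) = (\<lambda>d. \<Sum>c\<in>?B. representation ?B (g b) c * representation ?B (f c) d)" for b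
    by (simp add: representation_sum representation_scale trace_basis)
  then show ?thesis
    by (simp add: endo_trace_eq)
qed

lemma endo_trace_commute:
  assumes "\<And>x y. f (x + y) = f x + f y" "\<And>c x. f (scale c x) = scale c (f x)"
    and "\<And>x y. g (x + y) = g x + g y" "\<And>c x. g (scale c x) = scale c (g x)"
  shows "endo_trace (\<lambda>x. f (g x)) = endo_trace (\<lambda>x. g (f x))"
  unfolding endo_trace_comp[of f g, OF assms(1,2)] endo_trace_comp[of g f, OF assms(3,4)]
  by (subst sum.swap) (simp add: mult.commute)

section \<open>The Killing form and eigenvectors in finite dimension\<close>

definition killing :: "'g \<Rightarrow> 'g \<Rightarrow> complex" where
  "killing x y = endo_trace (\<lambda>z. bracket x (bracket y z))"

lemma killing_add_left: "killing (x + x') y = killing x y + killing x' y"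
  and killing_scale_left: "killing (scale c x) y = c * killing x y"
  by (simp_all add: killing_def br_add_left br_scale_left endo_trace_add endo_trace_scale)

lemma killing_commute: "killing x y = killing y x"
  unfolding killing_def
  by (rule endo_trace_commute) (simp_all add: br_add_right br_scale_right)

lemma killing_invariant: "killing (bracket x y) z = killing x (bracket y z)"
proof -
  have "endo_trace (\<lambda>v. bracket y (bracket x (bracket z v))) = endo_trace (\<lambda>v. bracket x (bracket z (bracket y v)))"
    by (rule endo_trace_commute[of "bracket y" "\<lambda>v. bracket x (bracket z v)"])
      (simp_all add: br_add_right br_scale_right)
  moreover have "bracket (bracket x y) v = bracket x (bracket y v) - bracket y (bracket x v)" for x y v
    using br_derivation[of x y v] by simp
  ultimately show ?thesis
    by (simp add: killing_def br_diff_right endo_trace_diff)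
qed

text \<open>Applying f and subtracting \<open>\<kappa> a\<close> times the sum removes the summand a
  and multiplies every other one by the nonzero number \<open>\<kappa> j - \<kappa> a\<close>;
  induction does the rest.\<close>

lemma eigenvectors_sum_0:
  assumes "finite J" "inj_on \<kappa> J"
    and f_add: "\<And>x y. f (x + y) = f x + f y" and f_scale: "\<And>c x. f (scale c x) = scale c (f x)"
    and "\<And>j. j \<in> J \<Longrightarrow> f (g j) = scale (\<kappa> j) (g j)" "(\<Sum>j\<in>J. g j) = 0" "j \<in> J"
  shows "g j = 0"
  using assms(1,2,5-7)
proof (induction J arbitrary: g j rule: finite_induct)
  case (insert a J)
  have f_0: "f 0 = 0" using f_add[of 0 0] by simp
  have f_sum: "f (sum k A) = (\<Sum>i\<in>A. f (k i))" for k and A :: "'c set"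
    by (induction A rule: infinite_finite_induct) (simp_all add: f_0 f_add)
  have sum: "g a + (\<Sum>j\<in>J. g j) = 0" using insert by simp
  have fa: "f (g a) = scale (\<kappa> a) (g a)" and fJ: "(\<Sum>j\<in>J. f (g j)) = (\<Sum>j\<in>J. scale (\<kappa> j) (g j))"
    using insert.prems by auto
  have "0 = f (g a) + (\<Sum>j\<in>J. f (g j)) - scale (\<kappa> a) (g a + (\<Sum>j\<in>J. g j))"
    by (simp only: f_add[symmetric] f_sum[symmetric] sum f_0 scale_zero_right diff_self)
  also have "\<dots> = (\<Sum>j\<in>J. scale (\<kappa> j) (g j)) - scale (\<kappa> a) (\<Sum>j\<in>J. g j)"
    unfolding fa fJ scale_right_distrib by simp
  also have "\<dots> = (\<Sum>j\<in>J. scale (\<kappa> j - \<kappa> a) (g j))"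
    by (simp add: scale_sum_right scale_left_diff_distrib sum_subtractf)
  finally have "(\<Sum>j\<in>J. scale (\<kappa> j - \<kappa> a) (g j)) = 0" by simp
  then have "scale (\<kappa> j - \<kappa> a) (g j) = 0" if "j \<in> J" for j
    using insert.prems that by (intro insert.IH[of "\<lambda>j. scale (\<kappa> j - \<kappa> a) (g j)"])
      (auto simp: f_scale mult.commute scale_left_commute)
  moreover have "\<kappa> j \<noteq> \<kappa> a" if "j \<in> J" for j
    using insert.prems(1) insert.hyps that by (auto simp: inj_on_def)
  ultimately have J: "g j = 0" if "j \<in> J" for j
    using that by force
  then have "g a = 0" using sum by simp
  then show ?case using J insert.prems by auto
qed simp

text \<open>Nonzero eigenvectors for infinitely many distinct eigenvalues would be independent,
  against finite dimension. All strings of weight vectors below are cut off by this.\<close>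

lemma eigenvector_sequence_vanishes:
  assumes f_add: "\<And>x y. f (x + y) = f x + f y" and f_scale: "\<And>c x. f (scale c x) = scale c (f x)"
    and ev: "\<And>n::nat. f (v n) = scale (\<kappa> n) (v n)" and "inj \<kappa>"
  shows "\<exists>n. v n = 0"
proof (rule ccontr)
  assume "\<not> ?thesis"
  then have nz: "v n \<noteq> 0" for n by blast
  have "inj v"
    by (rule injI) (metis assms(4) ev injD nz scale_cancel_right)
  have "independent (range v)"
    unfolding independent_explicit_finite_subsets
  proof (intro allI impI ballI)
    fix A u w assume A: "A \<subseteq> range v" "finite A" "(\<Sum>x\<in>A. scale (u x) x) = 0" "w \<in> A"
    then obtain N where N: "A = v ` N" "inj_on v N"
      by (meson subset_image_inj)
    then have "finite N" using A finite_imageD by blast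
    have sum: "(\<Sum>n\<in>N. scale (u (v n)) (v n)) = 0"
      using A(3) N by (simp add: sum.reindex)
    have "scale (u (v n)) (v n) = 0" if "n \<in> N" for n
      by (rule eigenvectors_sum_0[of N \<kappa> f "\<lambda>n. scale (u (v n)) (v n)" n])
        (use assms(4) that sum \<open>finite N\<close> in \<open>auto simp: f_add f_scale ev mult.commute inj_on_def inj_def\<close>)
    then show "u w = 0"
      using A(4) N nz by auto
  qed
  then have "finite (range v)" by (rule independent_imp_finite)
  then show False
    using \<open>inj v\<close> finite_imageD by blast
qed

text \<open>The \<open>sl\<^sub>2\<close> argument: if the lowest vector \<open>u\<close> had only nonzero coefficients
  \<open>n c + n (n - 1) / 2 b\<close> in \<open>[y, x\<^sup>n u]\<close>, all \<open>x\<^sup>n u\<close> would be nonzero of distinct weights.\<close>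

lemma lowest_vector_string:
  assumes "u \<noteq> 0" "bracket y u = 0" "bracket H u = scale \<delta> u" "bracket H x = scale a x" "a \<noteq> 0"
    and t: "bracket x y = t" "bracket t u = scale c u" "bracket t x = scale b x"
  shows "\<exists>n\<ge>1. of_nat n * c + of_nat n * (of_nat n - 1) / 2 * b = 0"
proof (rule ccontr)
  assume "\<not> ?thesis"
  then have nz: "of_nat n * c + of_nat n * (of_nat n - 1) / 2 * b \<noteq> 0" if "n \<ge> 1" for n
    using that by blast
  define v where "v n = (bracket x ^^ n) u" for n
  have v_Suc: "v (Suc n) = bracket x (v n)" and v_0: "v 0 = u" for n
    by (simp_all add: v_def)
  have Hv: "bracket H (v n) = scale (\<delta> + of_nat n * a) (v n)" for n
    by (induction n) (simp_all add: v_0 v_Suc assms br_derivation[of H x] br_scale_left br_scale_right br_add_right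
        scale_left_distrib algebra_simps)
  have tv: "bracket t (v n) = scale (c + of_nat n * b) (v n)" for n
    by (induction n) (simp_all add: v_0 v_Suc t(2,3) br_derivation[of t x] br_scale_left br_scale_right br_add_right
        scale_left_distrib algebra_simps)
  have yv: "bracket y (v (Suc n)) = scale (- (of_nat (Suc n) * c + of_nat (Suc n) * of_nat n / 2 * b)) (v n)" for n
  proof (induction n)
    case 0
    then show ?case
      using assms(2) t br_anticomm[of y x] by (simp add: v_0 v_Suc br_derivation[of y x] br_uminus_left)
  next
    case (Suc n)
    have "bracket y (v (Suc (Suc n))) = - bracket t (v (Suc n)) + bracket x (bracket y (v (Suc n)))"
      using br_anticomm[of y x] t by (simp add: v_Suc[of "Suc n"] br_derivation[of y x] br_uminus_left)
    also have "bracket x (bracket y (v (Suc n))) = scale (- (of_nat (Suc n) * c + of_nat (Suc n) * of_nat n / 2 * b)) (v (Suc n))"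
      by (simp only: Suc.IH br_scale_right v_Suc[symmetric])
    also have "- bracket t (v (Suc n)) + \<dots> =
        scale (- (c + of_nat (Suc n) * b) + - (of_nat (Suc n) * c + of_nat (Suc n) * of_nat n / 2 * b)) (v (Suc n))"
      by (simp only: tv scale_minus_left[symmetric] scale_left_distrib[symmetric])
    also have "- (c + of_nat (Suc n) * b) + - (of_nat (Suc n) * c + of_nat (Suc n) * of_nat n / 2 * b) =
        - (of_nat (Suc (Suc n)) * c + of_nat (Suc (Suc n)) * of_nat (Suc n) / 2 * b)"
      by (simp add: field_simps)
    finally show ?case .
  qed
  have "v n \<noteq> 0" for n
  proof (induction n)
    case (Suc n)
    show ?case
    proof
      assume "v (Suc n) = 0"
      then have "scale (- (of_nat (Suc n) * c + of_nat (Suc n) * of_nat n / 2 * b)) (v n) = 0"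
        unfolding yv[symmetric] by simp
      then have "of_nat (Suc n) * c + of_nat (Suc n) * of_nat n / 2 * b = 0"
        using Suc unfolding scale_eq_0_iff neg_equal_0_iff_equal by blast
      then show False using nz[of "Suc n"] by simp
    qed
  qed (simp add: v_0 assms)
  moreover have "inj (\<lambda>n. \<delta> + of_nat n * a)"
    using assms(5) by (auto simp: inj_def)
  ultimately show False
    using eigenvector_sequence_vanishes[of "bracket H" v "\<lambda>n. \<delta> + of_nat n * a"] Hv
    by (auto simp: br_add_right br_scale_right)
qed

text \<open>The components are indexed by the eigenvalue itself, so that distinct indices carry
  distinct eigenvalues, as \<open>eigenvectors_sum_0\<close> demands.\<close>

lemma eigen_decomposition:
  assumes "span {x. \<exists>c. bracket H x = scale c x} = UNIV"
  obtains C g where "finite C" "\<And>c. bracket H (g c) = scale c (g c)" "x = (\<Sum>c\<in>C. g c)"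
proof -
  let ?P = "\<lambda>x. \<exists>C g. finite C \<and> (\<forall>c. bracket H (g c) = scale c (g c)) \<and> (\<forall>c. c \<notin> C \<longrightarrow> g c = 0) \<and> x = (\<Sum>c\<in>C. g c)"
  have "x \<in> span {x. \<exists>c. bracket H x = scale c x}" using assms by simp
  then have "?P x"
  proof (induction rule: span_induct_alt)
    case base
    show ?case by (intro exI[of _ "{}"] exI[of _ "\<lambda>_. 0"]) simp
  next
    case (step k v y)
    from step(1) obtain c0 where c0: "bracket H v = scale c0 v" by blast
    from step(2) obtain C g where g: "finite C" "\<And>c. bracket H (g c) = scale c (g c)" "\<And>c. c \<notin> C \<Longrightarrow> g c = 0" "y = (\<Sum>c\<in>C. g c)"
      by blast
    let ?g = "\<lambda>c. (if c = c0 then scale k v else 0) + g c"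
    have "(\<Sum>c\<in>insert c0 C. g c) = y"
      unfolding g(4) by (rule sum.mono_neutral_right) (use g in auto)
    then have "scale k v + y = (\<Sum>c\<in>insert c0 C. ?g c)"
      using g(1) unfolding sum.distrib by (subst sum.delta) auto
    moreover have "bracket H (?g c) = scale c (?g c)" for c
      by (simp add: br_add_right br_scale_right g c0 scale_right_distrib scale_left_commute)
    moreover have "?g c = 0" if "c \<notin> insert c0 C" for c using that g by simp
    ultimately show ?case using g(1)
      by (intro exI[of _ "insert c0 C"] exI[of _ ?g]) blast
  qed
  then show thesis using that by blast
qed

text \<open>As t commutes with H, each difference \<open>bracket t (g c) - scale k (g c)\<close> is
  again an eigenvector of H for c. These differences add up to zero, so each of them is
  zero.\<close>

lemma eigen_component_commuting:
  assumes "finite C" "\<And>c. bracket H (g c) = scale c (g c)" "x = (\<Sum>c\<in>C. g c)"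
    and "bracket H t = 0" "bracket t x = scale k x" "c \<in> C"
  shows "bracket t (g c) = scale k (g c)"
proof -
  have "bracket t (g c) - scale k (g c) = 0"
  proof (rule eigenvectors_sum_0[OF assms(1), of "\<lambda>c. c" "bracket H"])
    show "(\<Sum>c\<in>C. bracket t (g c) - scale k (g c)) = 0"
      using assms(5) unfolding assms(3) by (simp add: br_sum_right sum_subtractf scale_sum_right)
  qed (use assms in \<open>auto simp: br_add_right br_scale_right br_diff_right br_derivation[of H t] scale_right_diff_distrib scale_left_commute\<close>)
  then show ?thesis by simp
qed

end

locale root_data = finite_dim_lie_algebra scale bracket
  for scale :: "complex \<Rightarrow> 'g::ab_group_add \<Rightarrow> 'g" and bracket +
  fixes h :: "'g set" and hb :: "'l::finite \<Rightarrow> 'g" and e :: "('g \<Rightarrow> complex) \<Rightarrow> 'g"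
  assumes simple: simple_lie and cartan: "cartan_subalgebra h" and span_hb: "span (range hb) = h"
    and orthonormal: "inner_form h (hb p) (hb q) = (if p = q then 1 else 0)"
    and e_root: "\<alpha> \<in> roots h \<Longrightarrow> e \<alpha> \<in> root_space h \<alpha>"
    and e_dual: "\<alpha> \<in> roots h \<Longrightarrow> \<beta> \<in> roots h \<Longrightarrow>
      inner_form h (e \<alpha>) (e (- \<beta>)) = (if \<alpha> = \<beta> then 1 else 0)"
begin

section \<open>The normalised invariant form and the Cartan subalgebra\<close>

abbreviation K where "K \<equiv> inner_form h"

lemma K_eq: "K x y = 1 / (2 * dual_coxeter_number h) * killing x y"
  by (simp add: inner_form_def killing_def)

lemma K_add_left: "K (x + x') y = K x y + K x' y"
  and K_scale_left: "K (scale c x) y = c * K x y"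
  and K_commute: "K x y = K y x"
  and K_invariant: "K (bracket x y) z = K x (bracket y z)"
proof -
  show "K (x + x') y = K x y + K x' y" "K (scale c x) y = c * K x y"
    by (simp_all add: K_eq killing_add_left killing_scale_left add_divide_distrib)
  show "K x y = K y x" "K (bracket x y) z = K x (bracket y z)"
    by (simp_all add: K_eq killing_commute[of x y] killing_invariant)
qed

lemma K_add_right: "K x (y + y') = K x y + K x y'"
  and K_scale_right: "K x (scale c y) = c * K x y"
  by (simp_all add: K_commute[of x] K_add_left K_scale_left)

lemma K_zero_left [simp]: "K 0 y = 0" and K_zero_right [simp]: "K x 0 = 0"
  using K_scale_left[of 0 0 y] K_scale_right[of x 0 0] by simp_all

lemma K_uminus_left: "K (- x) y = - K x y" and K_uminus_right: "K x (- y) = - K x y"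
  using K_scale_left[of "- 1" x y] K_scale_right[of x "- 1" y] by simp_all

lemma K_sum_left: "K (sum f A) y = (\<Sum>i\<in>A. K (f i) y)"
  and K_sum_right: "K y (sum f A) = (\<Sum>i\<in>A. K y (f i))"
  by (induction A rule: infinite_finite_induct) (simp_all add: K_add_left K_add_right)

text \<open>By invariance the radical is an ideal, and a unit vector of the orthonormal basis lies
  outside it; simplicity leaves only zero.\<close>

lemma K_nondegenerate:
  assumes "\<And>y. K x y = 0"
  shows "x = 0"
proof -
  let ?J = "{x. \<forall>y. K x y = 0}"
  have "subspace ?J"
    by (auto simp: subspace_def K_add_left K_scale_left)
  moreover have "bracket x y \<in> ?J" if "y \<in> ?J" for x y
    using that by (auto simp: br_anticomm[of x y] K_uminus_left K_invariant)
  ultimately have "lie_ideal ?J"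
    by (simp add: lie_ideal_def)
  \<comment> \<open>\<open>undefined\<close> is just some index: a type of class
    \<open>finite\<close> has at least one element.\<close>
  moreover have "hb undefined \<notin> ?J"
    using orthonormal[of undefined undefined] by (auto intro!: exI[of _ "hb undefined"])
  ultimately have "?J = {0}"
    using simple unfolding simple_lie_def by blast
  then show ?thesis using assms by blast
qed

lemma h_subspace: "subspace h"
  using cartan by (simp add: cartan_subalgebra_def abelian_subalgebra_def)

lemma h_abelian: "x \<in> h \<Longrightarrow> y \<in> h \<Longrightarrow> bracket x y = 0"
  using cartan by (simp add: cartan_subalgebra_def abelian_subalgebra_def)

lemma hb_in_h: "hb p \<in> h"
  using span_hb span_base[of "hb p" "range hb"] by auto

lemma h_diagonalizable: "H \<in> h \<Longrightarrow> span {x. \<exists>c. bracket H x = scale c x} = UNIV"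
  using cartan by (simp add: cartan_subalgebra_def)

lemma h_expansion:
  assumes "x \<in> h"
  shows "x = (\<Sum>p\<in>UNIV. scale (K x (hb p)) (hb p))"
proof -
  have "x \<in> span (range hb)" using assms span_hb by simp
  then show ?thesis
  proof (induction rule: span_induct_alt)
    case (step c v y)
    then obtain q where q: "v = hb q" by blast
    have "(\<Sum>p\<in>UNIV. scale (K (hb q) (hb p)) (hb p)) = (\<Sum>p\<in>UNIV. if p = q then hb p else 0)"
      by (intro sum.cong) (auto simp: orthonormal)
    then have "(\<Sum>p\<in>UNIV. scale (K (hb q) (hb p)) (hb p)) = hb q" by simp
    then have "(\<Sum>p\<in>UNIV. scale (K (scale c v + y) (hb p)) (hb p)) = scale c v + (\<Sum>p\<in>UNIV. scale (K y (hb p)) (hb p))"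
      by (simp add: q K_add_left K_scale_left scale_left_distrib sum.distrib scale_sum_right[symmetric]
        flip: scale_scale)
    then show ?case using step by simp
  qed simp
qed

text \<open>Adjoining z to \<open>h\<close> gives an abelian subalgebra, so maximality of
  \<open>h\<close> puts z into it.\<close>

lemma centralizer_h:
  assumes z: "\<And>H. H \<in> h \<Longrightarrow> bracket H z = 0"
  shows "z \<in> h"
proof -
  have span_h: "span h = h" using h_subspace span_eq_iff by blast
  let ?k = "span (insert z h)"
  have "bracket x y = 0" if "x \<in> ?k" "y \<in> ?k" for x y
  proof -
    from that obtain a b where ab: "x - scale a z \<in> h" "y - scale b z \<in> h"
      by (auto simp: span_insert span_h)
    define u v where "u = x - scale a z" and "v = y - scale b z"
    have "x = u + scale a z" "y = v + scale b z" by (simp_all add: u_def v_def)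
    then show ?thesis
      using ab z h_abelian br_anticomm[of z v]
      by (simp add: u_def[symmetric] v_def[symmetric] br_add_left br_add_right br_scale_left br_scale_right bracket_self)
  qed
  then have "abelian_subalgebra ?k"
    by (auto simp: abelian_subalgebra_def)
  moreover have "h \<subseteq> ?k" using span_superset by blast
  ultimately have "?k = h"
    using cartan unfolding cartan_subalgebra_def by blast
  then show ?thesis using span_base[of z "insert z h"] by auto
qed

lemma root_linear:
  assumes "\<alpha> \<in> roots h"
  shows "\<And>x y. x \<in> h \<Longrightarrow> y \<in> h \<Longrightarrow> \<alpha> (x + y) = \<alpha> x + \<alpha> y"
    and "\<And>c x. x \<in> h \<Longrightarrow> \<alpha> (scale c x) = c * \<alpha> x"
  using assms by (auto simp: roots_def linear_on_subspace_def)

lemma root_sum: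
  assumes "\<alpha> \<in> roots h" "\<And>i. i \<in> A \<Longrightarrow> f i \<in> h"
  shows "\<alpha> (sum f A) = (\<Sum>i\<in>A. \<alpha> (f i))"
  using assms(2)
proof (induction A rule: infinite_finite_induct)
  case (insert i A)
  then have "sum f A \<in> h" by (intro subspace_sum h_subspace) auto
  then show ?case using insert root_linear(1)[OF assms(1)] by simp
qed (use root_linear(2)[OF assms(1) hb_in_h, of 0] in auto)

lemma root_expansion:
  assumes "\<alpha> \<in> roots h" "H \<in> h"
  shows "\<alpha> H = (\<Sum>p\<in>UNIV. K H (hb p) * \<alpha> (hb p))"
proof -
  have "\<alpha> H = \<alpha> (\<Sum>p\<in>UNIV. scale (K H (hb p)) (hb p))"
    using h_expansion[OF assms(2)] by simp
  then show ?thesis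
    using assms(1) by (simp add: root_sum root_linear(2) hb_in_h subspace_scale[OF h_subspace])
qed

lemma root_nonzero: "\<alpha> \<in> roots h \<Longrightarrow> \<exists>p. \<alpha> (hb p) \<noteq> 0"
proof (rule ccontr)
  assume \<alpha>: "\<alpha> \<in> roots h" "\<not> (\<exists>p. \<alpha> (hb p) \<noteq> 0)"
  then have "\<alpha> H = 0" if "H \<in> h" for H using root_expansion[OF \<alpha>(1) that] by simp
  then show False using \<alpha>(1) by (auto simp: roots_def)
qed

lemma roots_neq_0: "\<alpha> \<in> roots h \<Longrightarrow> \<alpha> \<noteq> 0"
  using root_nonzero[of \<alpha>] by auto

lemma root_spaceD: "x \<in> root_space h \<alpha> \<Longrightarrow> H \<in> h \<Longrightarrow> bracket H x = scale (\<alpha> H) x"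
  by (simp add: root_space_def)

text \<open>A vector that pairs nontrivially with \<open>e \<alpha>\<close> has a simultaneous
  eigencomponent under \<open>h\<close> that still does, and invariance of the form forces the
  weight of this component to be -\<alpha>.\<close>

lemma root_uminus:
  assumes \<alpha>: "\<alpha> \<in> roots h"
  shows "- \<alpha> \<in> roots h"
proof -
  have e\<alpha>: "bracket H (e \<alpha>) = scale (\<alpha> H) (e \<alpha>)" if "H \<in> h" for H
    using e_root[OF \<alpha>] that by (rule root_spaceD)
  have "e \<alpha> \<noteq> 0" using e_dual[OF \<alpha> \<alpha>] by auto
  \<comment> \<open>Induction on the set of basis vectors already diagonalised: the vector is
    replaced by one of its components under the next \<open>hb q\<close> that still pairs with
    \<open>e \<alpha>\<close>.\<close>
  have "\<exists>y. K (e \<alpha>) y \<noteq> 0 \<and> (\<forall>p\<in>P. bracket (hb p) y = scale (- \<alpha> (hb p)) y)" if "finite P" for P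
    using that
  proof (induction P rule: finite_induct)
    case empty
    then show ?case using K_nondegenerate[of "e \<alpha>"] \<open>e \<alpha> \<noteq> 0\<close> by auto
  next
    case (insert q P)
    then obtain y where y: "K (e \<alpha>) y \<noteq> 0" "\<And>p. p \<in> P \<Longrightarrow> bracket (hb p) y = scale (- \<alpha> (hb p)) y"
      by blast
    obtain C g where g: "finite C" "\<And>c. bracket (hb q) (g c) = scale c (g c)" "y = (\<Sum>c\<in>C. g c)"
      by (rule eigen_decomposition[OF h_diagonalizable[OF hb_in_h]]) blast
    obtain c where c: "c \<in> C" "K (e \<alpha>) (g c) \<noteq> 0"
      using y(1) unfolding g(3) K_sum_right by (meson sum.neutral)
    have "bracket (hb p) (g c) = scale (- \<alpha> (hb p)) (g c)" if "p \<in> P" for p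
      using eigen_component_commuting[OF g h_abelian[OF hb_in_h hb_in_h] y(2)[OF that] c(1)] .
    moreover have "c = - \<alpha> (hb q)"
    proof -
      have "c * K (e \<alpha>) (g c) = K (e \<alpha>) (bracket (hb q) (g c))"
        by (simp add: g K_scale_right)
      also have "\<dots> = K (bracket (e \<alpha>) (hb q)) (g c)"
        by (simp add: K_invariant)
      also have "\<dots> = - \<alpha> (hb q) * K (e \<alpha>) (g c)"
        using e\<alpha>[OF hb_in_h, of q] br_anticomm[of "e \<alpha>" "hb q"] by (simp add: K_scale_left K_uminus_left)
      finally show ?thesis using c(2) by (metis mult_cancel_right)
    qed
    ultimately show ?case
      using c(2) g(2)[of c] by auto
  qed
  from this[of UNIV] obtain y where y: "K (e \<alpha>) y \<noteq> 0" "\<And>p. bracket (hb p) y = scale (- \<alpha> (hb p)) y"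
    by auto
  have "bracket H y = scale ((- \<alpha>) H) y" if H: "H \<in> h" for H
  proof -
    have "bracket H y = bracket (\<Sum>p\<in>UNIV. scale (K H (hb p)) (hb p)) y"
      using h_expansion[OF H] by simp
    also have "\<dots> = (\<Sum>p\<in>UNIV. scale (K H (hb p) * (- \<alpha> (hb p))) y)"
      by (simp only: br_sum_left br_scale_left y scale_scale)
    also have "\<dots> = scale (\<Sum>p\<in>UNIV. K H (hb p) * (- \<alpha> (hb p))) y"
      by (simp only: scale_sum_left)
    also have "(\<Sum>p\<in>UNIV. K H (hb p) * (- \<alpha> (hb p))) = (- \<alpha>) H"
      by (simp add: root_expansion[OF \<alpha> H] sum_negf)
    finally show ?thesis .
  qed
  then have "y \<in> root_space h (- \<alpha>)"
    by (simp add: root_space_def)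
  moreover have "y \<noteq> 0" using y(1) by auto
  ultimately have "root_space h (- \<alpha>) \<noteq> {0}" by blast
  then show ?thesis
    using \<alpha> by (auto simp: roots_def linear_on_subspace_def)
qed

text \<open>The element of \<open>h\<close> that represents \<alpha> with respect to
  \<open>K\<close>, as \<open>K_t\<close> shows.\<close>

definition t :: "('g \<Rightarrow> complex) \<Rightarrow> 'g" where
  "t \<alpha> = (\<Sum>p\<in>UNIV. scale (\<alpha> (hb p)) (hb p))"

lemma t_in_h: "t \<alpha> \<in> h"
  unfolding t_def by (intro subspace_sum subspace_scale h_subspace hb_in_h)

lemma K_t: "K (t \<alpha>) (hb p) = \<alpha> (hb p)"
  by (simp add: t_def K_sum_left K_scale_left orthonormal if_distrib cong: if_cong)

text \<open>The bracket has weight zero, hence lies in \<open>h\<close>; invariance then computes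
  its inner products with the orthonormal basis.\<close>

lemma bracket_root_vectors_uminus:
  assumes \<alpha>: "\<alpha> \<in> roots h" and x: "x \<in> root_space h \<alpha>"
  shows "bracket x (e (- \<alpha>)) = scale (K x (e (- \<alpha>))) (t \<alpha>)"
proof -
  let ?y = "e (- \<alpha>)"
  have y: "bracket H ?y = scale (- \<alpha> H) ?y" if "H \<in> h" for H
    using root_spaceD[OF e_root[OF root_uminus[OF \<alpha>]] that] by simp
  have "bracket H (bracket x ?y) = 0" if "H \<in> h" for H
    using root_spaceD[OF x that] y[OF that]
    by (simp add: br_derivation[of H x] br_scale_left br_uminus_right br_scale_right)
  then have xy: "bracket x ?y \<in> h" by (rule centralizer_h)
  have "K (bracket x ?y) (hb p) = K x ?y * \<alpha> (hb p)" for p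
  proof -
    have "bracket ?y (hb p) = scale (\<alpha> (hb p)) ?y"
      using y[OF hb_in_h, of p] br_anticomm[of ?y "hb p"] by simp
    then show ?thesis by (simp add: K_invariant K_scale_right)
  qed
  then show ?thesis
    using h_expansion[OF xy] by (simp add: t_def scale_sum_right)
qed

lemma bracket_e_uminus: "\<alpha> \<in> roots h \<Longrightarrow> bracket (e \<alpha>) (e (- \<alpha>)) = t \<alpha>"
  using bracket_root_vectors_uminus[OF _ e_root] e_dual[of \<alpha> \<alpha>] by simp

text \<open>T acts diagonalisably. Were all its eigenvalues zero, T would lie in the centre, a
  proper ideal of a simple algebra.\<close>

lemma nonzero_eigenvalue:
  assumes "T \<in> h" "T \<noteq> 0"
  obtains v c where "v \<noteq> 0" "c \<noteq> 0" "bracket T v = scale c v"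
proof -
  have "\<exists>v c. v \<noteq> 0 \<and> c \<noteq> 0 \<and> bracket T v = scale c v"
  proof (rule ccontr)
    assume "\<not> ?thesis"
    then have "bracket T v = 0" if "bracket T v = scale c v" for v c
      using that by (metis br_zero_right scale_zero_left)
    then have 0: "bracket T v = 0" if "v \<in> {x. \<exists>c. bracket T x = scale c x}" for v
      using that by blast
    have T: "bracket T x = 0" for x
    proof -
      have "x \<in> span {x. \<exists>c. bracket T x = scale c x}"
        using h_diagonalizable[OF assms(1)] by simp
      then show ?thesis
        by (induction rule: span_induct_alt) (simp_all only: br_zero_right br_add_right br_scale_right 0 scale_zero_right add_0_left)
    qed
    let ?J = "{x. \<forall>y. bracket x y = 0}"
    have "subspace ?J" by (auto simp: subspace_def br_add_left br_scale_left)
    moreover have "bracket x y \<in> ?J" if "y \<in> ?J" for x y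
      using that by (auto simp: br_anticomm[of x y])
    ultimately have "lie_ideal ?J" by (simp add: lie_ideal_def)
    moreover have "?J \<noteq> UNIV" using simple unfolding simple_lie_def by blast
    ultimately have "?J = {0}" using simple unfolding simple_lie_def by blast
    then show False using T assms(2) by blast
  qed
  then show thesis using that by blast
qed

text \<open>If \<alpha>(t \<alpha>) = 0, then \<open>t \<alpha>\<close> commutes with both root
  vectors and acts by one scalar c on the whole string through a weight vector; c can be taken
  nonzero by \<open>nonzero_eigenvalue\<close>. The string descends to a lowest vector, where
  \<open>lowest_vector_string\<close> gives a contradiction.\<close>

lemma root_t_nonzero:
  assumes \<alpha>: "\<alpha> \<in> roots h"
  shows "\<alpha> (t \<alpha>) \<noteq> 0"
proof
  assume \<alpha>t: "\<alpha> (t \<alpha>) = 0"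
  obtain p where p: "\<alpha> (hb p) \<noteq> 0" using root_nonzero[OF \<alpha>] by blast
  let ?x = "e \<alpha>" and ?y = "e (- \<alpha>)" and ?H = "hb p"
  have "t \<alpha> \<noteq> 0" using K_t[of \<alpha> p] p by auto
  then obtain w c where w: "w \<noteq> 0" "c \<noteq> 0" "bracket (t \<alpha>) w = scale c w"
    by (rule nonzero_eigenvalue[OF t_in_h])
  obtain C g where g: "finite C" "\<And>c. bracket ?H (g c) = scale c (g c)" "w = (\<Sum>c\<in>C. g c)"
    by (rule eigen_decomposition[OF h_diagonalizable[OF hb_in_h]]) blast
  obtain \<delta> where \<delta>: "\<delta> \<in> C" "g \<delta> \<noteq> 0"
    using w(1) unfolding g(3) by (meson sum.neutral)
  have tg: "bracket (t \<alpha>) (g \<delta>) = scale c (g \<delta>)"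
    using eigen_component_commuting[OF g h_abelian[OF hb_in_h t_in_h] w(3) \<delta>(1)] .
  have x: "bracket H ?x = scale (\<alpha> H) ?x" and y: "bracket H ?y = scale (- \<alpha> H) ?y" if "H \<in> h" for H
    using root_spaceD[OF e_root[OF \<alpha>] that] root_spaceD[OF e_root[OF root_uminus[OF \<alpha>]] that] by simp_all
  define v where "v n = (bracket ?y ^^ n) (g \<delta>)" for n
  have v_Suc: "v (Suc n) = bracket ?y (v n)" and v_0: "v 0 = g \<delta>" for n
    by (simp_all add: v_def)
  have Hv: "bracket ?H (v n) = scale (\<delta> + of_nat n * - \<alpha> ?H) (v n)" for n
  proof (induction n)
    case (Suc n)
    have "bracket ?H (v (Suc n)) = scale (- \<alpha> ?H) (v (Suc n)) + scale (\<delta> + of_nat n * - \<alpha> ?H) (v (Suc n))"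
      by (simp only: v_Suc br_derivation[of ?H ?y] y[OF hb_in_h] Suc.IH br_scale_left br_scale_right)
    also have "\<dots> = scale (- \<alpha> ?H + (\<delta> + of_nat n * - \<alpha> ?H)) (v (Suc n))"
      by (rule scale_left_distrib[symmetric])
    also have "- \<alpha> ?H + (\<delta> + of_nat n * - \<alpha> ?H) = \<delta> + of_nat (Suc n) * - \<alpha> ?H"
      by (simp add: algebra_simps)
    finally show ?case .
  qed (simp add: v_0 g(2))
  have tv: "bracket (t \<alpha>) (v n) = scale c (v n)" for n
    by (induction n) (simp_all add: v_0 v_Suc tg br_derivation[of "t \<alpha>" ?y] y[OF t_in_h] \<alpha>t br_scale_right)
  have "inj (\<lambda>n. \<delta> + of_nat n * - \<alpha> ?H)"
    using p by (auto simp: inj_def)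
  then obtain n where "v n = 0"
    using eigenvector_sequence_vanishes[of "bracket ?H" v "\<lambda>n. \<delta> + of_nat n * - \<alpha> ?H"] Hv
    by (auto simp: br_add_right br_scale_right)
  define m where "m = (LEAST n. v n = 0)"
  have m: "v m = 0" unfolding m_def using \<open>v n = 0\<close> by (rule LeastI)
  have "m \<noteq> 0" using m v_0 \<delta>(2) by metis
  then obtain k where k: "m = Suc k" using not0_implies_Suc by blast
  have "v k \<noteq> 0"
    using not_less_Least[of k "\<lambda>n. v n = 0"] k by (auto simp: m_def)
  \<comment> \<open>\<open>v k\<close> is the last nonzero vector of the descending string. As
    \<open>t \<alpha>\<close> kills \<open>e \<alpha>\<close>, the string lemma applies with b = 0
    and yields n c = 0 for some positive n.\<close>
  then have "\<exists>n\<ge>1. of_nat n * c + of_nat n * (of_nat n - 1) / 2 * 0 = 0"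
    by (rule lowest_vector_string[of _ ?y ?H _ ?x "\<alpha> ?H" "t \<alpha>"])
      (use m k p \<alpha>t in \<open>auto simp: v_Suc[symmetric] Hv tv x hb_in_h t_in_h bracket_e_uminus[OF \<alpha>]\<close>)
  then show False using w(2) by auto
qed

text \<open>The difference u of the two sides lies in the root space and is annihilated by
  \<open>e (- \<alpha>)\<close>. For u the coefficients in the string lemma are n (n + 1) / 2 times
  \<alpha>(t \<alpha>), never zero for positive n, so u = 0.\<close>

lemma root_space_one_dim:
  assumes \<alpha>: "\<alpha> \<in> roots h" and x: "x \<in> root_space h \<alpha>"
  shows "x = scale (K x (e (- \<alpha>))) (e \<alpha>)"
proof (rule ccontr)
  assume ne: "x \<noteq> scale (K x (e (- \<alpha>))) (e \<alpha>)"
  define u where "u = x - scale (K x (e (- \<alpha>))) (e \<alpha>)"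
  obtain p where p: "\<alpha> (hb p) \<noteq> 0" using root_nonzero[OF \<alpha>] by blast
  have e: "bracket H (e \<alpha>) = scale (\<alpha> H) (e \<alpha>)" if "H \<in> h" for H
    using root_spaceD[OF e_root[OF \<alpha>] that] .
  have u: "bracket H u = scale (\<alpha> H) u" if "H \<in> h" for H
    using root_spaceD[OF x that] e[OF that]
    by (simp add: u_def br_diff_right br_scale_right scale_right_diff_distrib mult.commute)
  have "bracket u (e (- \<alpha>)) = 0"
    using bracket_root_vectors_uminus[OF \<alpha> x] bracket_e_uminus[OF \<alpha>]
    by (simp add: u_def br_diff_left br_scale_left)
  then have "bracket (e (- \<alpha>)) u = 0"
    using br_anticomm[of "e (- \<alpha>)" u] by simp
  moreover have "u \<noteq> 0" using ne by (simp add: u_def)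
  ultimately have "\<exists>n\<ge>1. of_nat n * \<alpha> (t \<alpha>) + of_nat n * (of_nat n - 1) / 2 * \<alpha> (t \<alpha>) = 0"
    by (intro lowest_vector_string[of u "e (- \<alpha>)" "hb p" "\<alpha> (hb p)" "e \<alpha>" "\<alpha> (hb p)" "t \<alpha>"])
      (use p in \<open>auto simp: u e hb_in_h t_in_h bracket_e_uminus[OF \<alpha>]\<close>)
  then obtain n where n: "n \<ge> 1" "of_nat n * \<alpha> (t \<alpha>) + of_nat n * (of_nat n - 1) / 2 * \<alpha> (t \<alpha>) = 0"
    by blast
  then have "\<alpha> (t \<alpha>) * (of_nat n * (of_nat n + 1)) = 0"
    by (simp add: field_simps)
  then have "(of_nat n + 1 :: complex) = 0"
    using root_t_nonzero[OF \<alpha>] n(1) by simp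
  then show False
    by (metis of_nat_Suc of_nat_eq_0_iff add.commute nat.distinct(2))
qed

text \<open>Duality with the vectors \<open>e (- \<beta>)\<close> makes the vectors
  \<open>e \<alpha>\<close> distinct and independent.\<close>

lemma finite_roots: "finite (roots h)"
proof -
  have inj: "inj_on e (roots h)"
  proof (rule inj_onI)
    fix \<alpha> \<beta> assume "\<alpha> \<in> roots h" "\<beta> \<in> roots h" "e \<alpha> = e \<beta>"
    then show "\<alpha> = \<beta>" using e_dual[of \<alpha> \<beta>] e_dual[of \<beta> \<beta>] by (auto split: if_splits)
  qed
  have "independent (e ` roots h)"
    unfolding independent_explicit_finite_subsets
  proof (intro allI impI ballI)
    fix A u w assume A: "A \<subseteq> e ` roots h" "finite A" "(\<Sum>x\<in>A. scale (u x) x) = 0" "w \<in> A"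
    then obtain \<beta> where \<beta>: "\<beta> \<in> roots h" "w = e \<beta>" by blast
    have "0 = (\<Sum>x\<in>A. u x * K x (e (- \<beta>)))"
      using arg_cong[OF A(3), of "\<lambda>z. K z (e (- \<beta>))"] by (simp add: K_sum_left K_scale_left)
    also have "\<dots> = (\<Sum>x\<in>A. if x = w then u x else 0)"
    proof (intro sum.cong refl)
      fix x assume "x \<in> A"
      then obtain \<alpha> where \<alpha>: "\<alpha> \<in> roots h" "x = e \<alpha>" using A(1) by blast
      then show "u x * K x (e (- \<beta>)) = (if x = w then u x else 0)"
        using e_dual[OF \<alpha>(1) \<beta>(1)] \<beta> inj by (auto dest: inj_onD)
    qed
    also have "\<dots> = u w" using A by simp
    finally show "u w = 0" by simp
  qed
  then show ?thesis
    using independent_imp_finite finite_imageD inj by blast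
qed

text \<open>Structure constants with the third index lowered by \<open>K\<close>. In this form they
  are totally antisymmetric: the bracket gives the first pair, invariance the last.\<close>

definition G :: "('g \<Rightarrow> complex) \<Rightarrow> ('g \<Rightarrow> complex) \<Rightarrow> ('g \<Rightarrow> complex) \<Rightarrow> complex" where
  "G \<alpha> \<beta> \<gamma> = K (bracket (e \<alpha>) (e \<beta>)) (e \<gamma>)"

lemma G_swap12: "G \<beta> \<alpha> \<gamma> = - G \<alpha> \<beta> \<gamma>"
  by (simp add: G_def br_anticomm[of "e \<beta>"] K_uminus_left)

lemma G_swap23: "G \<alpha> \<gamma> \<beta> = - G \<alpha> \<beta> \<gamma>"
  by (simp add: G_def K_invariant br_anticomm[of "e \<gamma>"] K_uminus_right)

lemma bracket_e_in_root_space: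
  assumes "\<alpha> \<in> roots h" "\<beta> \<in> roots h"
  shows "bracket (e \<alpha>) (e \<beta>) \<in> root_space h (\<alpha> + \<beta>)"
  using root_spaceD[OF e_root[OF assms(1)]] root_spaceD[OF e_root[OF assms(2)]]
  by (simp add: root_space_def br_derivation[of _ "e \<alpha>"] br_scale_left br_scale_right scale_left_distrib)

lemma bracket_e_add:
  assumes "\<alpha> \<in> roots h" "\<beta> \<in> roots h" "\<alpha> + \<beta> \<in> roots h"
  shows "bracket (e \<alpha>) (e \<beta>) = scale (G \<alpha> \<beta> (- (\<alpha> + \<beta>))) (e (\<alpha> + \<beta>))"
  using root_space_one_dim[OF assms(3) bracket_e_in_root_space[OF assms(1,2)]] by (simp add: G_def)

lemma bracket_e_zero:
  assumes "\<alpha> \<in> roots h" "\<beta> \<in> roots h" "\<alpha> + \<beta> \<noteq> 0" "\<alpha> + \<beta> \<notin> roots h"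
  shows "bracket (e \<alpha>) (e \<beta>) = 0"
proof -
  have zero: "(\<alpha> + \<beta>) x = 0" if "x \<notin> h" for x
    using assms(1,2) that by (simp add: roots_def)
  have "\<exists>H. (\<alpha> + \<beta>) H \<noteq> 0" using assms(3) by (auto simp: fun_eq_iff)
  then have "\<exists>H\<in>h. (\<alpha> + \<beta>) H \<noteq> 0" using zero by blast
  moreover have "linear_on_subspace scale (*) h (\<alpha> + \<beta>)"
    using assms(1,2) by (simp add: roots_def linear_on_subspace_def algebra_simps)
  ultimately have "root_space h (\<alpha> + \<beta>) = {0}"
    using assms(4) zero by (auto simp: roots_def)
  then show ?thesis using bracket_e_in_root_space[OF assms(1,2)] by blast
qed

lemma bracket_t_e: "\<beta> \<in> roots h \<Longrightarrow> bracket (t \<alpha>) (e \<beta>) = scale (\<beta> (t \<alpha>)) (e \<beta>)"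
  using root_spaceD[OF e_root t_in_h] .

lemma t_uminus: "t (- \<alpha>) = - t \<alpha>"
  and t_add: "t (\<alpha> + \<beta>) = t \<alpha> + t \<beta>"
  by (simp_all add: t_def sum_negf scale_left_distrib sum.distrib)

lemma root_t_uminus:
  assumes "\<alpha> \<in> roots h"
  shows "(- \<alpha>) (t \<alpha>) = - \<alpha> (t \<alpha>)" "(- \<alpha>) (t (- \<alpha>)) = \<alpha> (t \<alpha>)"
proof -
  have "t (- \<alpha>) = scale (- 1) (t \<alpha>)" by (simp add: t_uminus)
  then have "\<alpha> (t (- \<alpha>)) = - \<alpha> (t \<alpha>)"
    using root_linear(2)[OF assms t_in_h, of "- 1"] by simp
  then show "(- \<alpha>) (t (- \<alpha>)) = \<alpha> (t \<alpha>)" by simp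
qed simp

end

section \<open>The operators in coordinates\<close>

text \<open>Composition becomes the multiplication of a \<open>ring\<close>, to which the fibre
  identities apply. The scalar multiplication is a variable and cannot enter the type; complex
  linearity is expressed by commuting with \<open>s k\<close>.\<close>

typedef (overloaded) 'a endo = "{f :: 'a::ab_group_add \<Rightarrow> 'a. \<forall>x y. f (x + y) = f x + f y}"
  morphisms app Endo
  by (rule exI[of _ id]) simp

setup_lifting type_definition_endo

instantiation endo :: (ab_group_add) ring
begin

lift_definition zero_endo :: "'a endo" is "\<lambda>x. 0" by simp
lift_definition plus_endo :: "'a endo \<Rightarrow> 'a endo \<Rightarrow> 'a endo" is "\<lambda>f g x. f x + g x" by (simp add: add_ac)
lift_definition uminus_endo :: "'a endo \<Rightarrow> 'a endo" is "\<lambda>f x. - f x" by simp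
lift_definition minus_endo :: "'a endo \<Rightarrow> 'a endo \<Rightarrow> 'a endo" is "\<lambda>f g x. f x - g x" by simp
lift_definition times_endo :: "'a endo \<Rightarrow> 'a endo \<Rightarrow> 'a endo" is "\<lambda>f g x. f (g x)" by simp

instance
  by standard (transfer; simp add: fun_eq_iff add_ac)+

end

lemma app_endo_add: "app f (x + y) = app f x + app f y"
  by transfer simp

lemma app_plus: "app (f + g) x = app f x + app g x"
  and app_minus: "app (f - g) x = app f x - app g x"
  and app_times: "app (f * g) x = app f (app g x)"
  and app_zero: "app 0 x = 0"
  by (transfer; simp)+

lemma app_sum: "app (sum f A) x = (\<Sum>i\<in>A. app (f i) x)"
  by (induction A rule: infinite_finite_induct) (simp_all add: app_zero app_plus)

lemma endo_eqI: "(\<And>x. app f x = app g x) \<Longrightarrow> f = g"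
  by (metis app_inject ext)

locale gaudin = root_data scale bracket h hb e + upper_half_plane \<tau> + wsp: vector_space sw
  for scale :: "complex \<Rightarrow> 'g::ab_group_add \<Rightarrow> 'g" and bracket and h and hb :: "'l::finite \<Rightarrow> 'g" and e and \<tau>
    and sw :: "complex \<Rightarrow> 'w::ab_group_add \<Rightarrow> 'w" +
  fixes I :: "'i set" and \<rho> :: "'i \<Rightarrow> 'g \<Rightarrow> 'w \<Rightarrow> 'w" and z :: "'i \<Rightarrow> complex"
  assumes fin_I: "finite I"
    and \<rho>_add_right: "i \<in> I \<Longrightarrow> \<rho> i A (v + v') = \<rho> i A v + \<rho> i A v'"
    and \<rho>_scale_right: "i \<in> I \<Longrightarrow> \<rho> i A (sw c v) = sw c (\<rho> i A v)"
    and \<rho>_add_left: "i \<in> I \<Longrightarrow> \<rho> i (A + A') v = \<rho> i A v + \<rho> i A' v"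
    and \<rho>_scale_left: "i \<in> I \<Longrightarrow> \<rho> i (scale c A) v = sw c (\<rho> i A v)"
    and \<rho>_bracket: "i \<in> I \<Longrightarrow> \<rho> i (bracket A B) v = \<rho> i A (\<rho> i B v) - \<rho> i B (\<rho> i A v)"
    and \<rho>_commute: "i \<in> I \<Longrightarrow> j \<in> I \<Longrightarrow> i \<noteq> j \<Longrightarrow> \<rho> i A (\<rho> j B v) = \<rho> j B (\<rho> i A v)"
begin

definition P :: "'i \<Rightarrow> 'g \<Rightarrow> 'w endo" where
  "P i A = Endo (\<rho> i A)"

definition s :: "complex \<Rightarrow> 'w endo" where
  "s k = Endo (sw k)"

lemma app_P: "i \<in> I \<Longrightarrow> app (P i A) = \<rho> i A"
  unfolding P_def by (rule Endo_inverse) (simp add: \<rho>_add_right)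

lemma app_s: "app (s k) = sw k"
  unfolding s_def by (rule Endo_inverse) (simp add: wsp.scale_right_distrib)

sublocale scalars s
  by standard (auto intro!: endo_eqI simp: app_s app_plus app_times wsp.scale_left_distrib)

lemma P_s: "i \<in> I \<Longrightarrow> P i A * s k = s k * P i A"
  by (rule endo_eqI) (simp add: app_times app_s app_P \<rho>_scale_right)

lemma P_add: "i \<in> I \<Longrightarrow> P i (A + B) = P i A + P i B"
  and P_scale: "i \<in> I \<Longrightarrow> P i (scale c A) = s c * P i A"
  and P_bracket: "i \<in> I \<Longrightarrow> commutator (P i A) (P i B) = P i (bracket A B)"
  by (rule endo_eqI; simp add: app_plus app_minus app_times app_P app_s \<rho>_add_left \<rho>_scale_left \<rho>_bracket commutator_def)+

lemma P_commute: "i \<in> I \<Longrightarrow> j \<in> I \<Longrightarrow> i \<noteq> j \<Longrightarrow> P i A * P j B = P j B * P i A"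
  by (rule endo_eqI) (simp add: app_times app_P \<rho>_commute)

lemma P_zero: "i \<in> I \<Longrightarrow> P i 0 = 0"
  using P_add[of i 0 0] by simp

lemma P_uminus: "i \<in> I \<Longrightarrow> P i (- A) = - P i A"
  using P_add[of i A "- A"] P_zero by (simp add: eq_neg_iff_add_eq_0 add.commute)

lemma P_sum: "i \<in> I \<Longrightarrow> P i (sum f A) = (\<Sum>j\<in>A. P i (f j))"
  by (induction A rule: infinite_finite_induct) (simp_all add: P_zero P_add)

section \<open>Coordinates on the Cartan subalgebra and the regular set\<close>

definition emb :: "complex^'l \<Rightarrow> 'g" where
  "emb \<xi> = (\<Sum>r\<in>UNIV. scale (\<xi> $ r) (hb r))"

lemma emb_in_h: "emb \<xi> \<in> h"
  unfolding emb_def by (intro subspace_sum subspace_scale h_subspace hb_in_h)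

lemma emb_axis: "emb (\<xi> + axis r k) = emb \<xi> + scale k (hb r)"
proof -
  have "(\<Sum>q\<in>UNIV. scale (axis r k $ q) (hb q)) = (\<Sum>q\<in>UNIV. if q = r then scale k (hb r) else 0)"
    by (intro sum.cong) (auto simp: axis_def)
  then show ?thesis
    by (simp add: emb_def scale_left_distrib sum.distrib)
qed

lemma root_emb: "\<alpha> \<in> roots h \<Longrightarrow> \<alpha> (emb \<xi>) = (\<Sum>r\<in>UNIV. \<xi> $ r * \<alpha> (hb r))"
  by (simp add: emb_def root_sum root_linear(2) hb_in_h subspace_scale[OF h_subspace])

lemma root_emb_axis: "\<alpha> \<in> roots h \<Longrightarrow> \<alpha> (emb (\<xi> + axis r k)) = \<alpha> (emb \<xi>) + k * \<alpha> (hb r)"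
  by (simp add: emb_axis root_linear emb_in_h hb_in_h subspace_scale[OF h_subspace])

lemma continuous_root_emb: "\<alpha> \<in> roots h \<Longrightarrow> isCont (\<lambda>\<xi>. \<alpha> (emb \<xi>)) \<xi>"
  by (simp add: root_emb)

definition dom :: "(complex^'l) set" where
  "dom = {\<xi>. emb \<xi> \<in> regular_set \<tau> h}"

lemma dom_eq: "dom = {\<xi>. \<forall>\<alpha>\<in>roots h. \<alpha> (emb \<xi>) \<notin> \<Lambda>}"
  by (auto simp: dom_def regular_set_def emb_in_h)

lemma domD: "\<xi> \<in> dom \<Longrightarrow> \<alpha> \<in> roots h \<Longrightarrow> \<alpha> (emb \<xi>) \<notin> \<Lambda>"
  by (simp add: dom_eq)

lemma open_dom: "open dom"
proof -
  have "dom = (\<Inter>\<alpha>\<in>roots h. (\<lambda>\<xi>. \<alpha> (emb \<xi>)) -` (- \<Lambda>))"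
    by (auto simp: dom_eq)
  moreover have "open ((\<lambda>\<xi>. \<alpha> (emb \<xi>)) -` (- \<Lambda>))" if "\<alpha> \<in> roots h" for \<alpha>
    using closed_lattice continuous_root_emb[OF that]
    by (intro open_vimage) (auto simp: continuous_on_eq_continuous_at)
  ultimately show ?thesis
    using finite_roots by auto
qed

lemma bounded_linear_axis: "bounded_linear (axis r :: complex \<Rightarrow> complex^'n)"
proof -
  have "linear (axis r :: complex \<Rightarrow> complex^'n)"
    by (intro linearI) (auto simp: axis_def vec_eq_iff)
  then show ?thesis
    by (simp add: linear_conv_bounded_linear)
qed

sublocale complex_directions dom "axis :: 'l \<Rightarrow> complex \<Rightarrow> complex^'l"
  by (rule complex_directions.intro) (rule open_dom bounded_linear_axis)+

lemma w_root_DERIV: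
  assumes \<alpha>: "\<alpha> \<in> roots h" and \<xi>: "\<xi> \<in> dom"
  shows "((\<lambda>k. w (\<alpha> (emb (\<xi> + axis r k))) x) has_field_derivative \<alpha> (hb r) * dw (\<alpha> (emb \<xi>)) x) (at 0)"
proof -
  have 1: "((\<lambda>k. \<alpha> (emb \<xi>) + k * \<alpha> (hb r)) has_field_derivative \<alpha> (hb r)) (at 0)"
    by (auto intro!: derivative_eq_intros)
  have 2: "((\<lambda>c. w c x) has_field_derivative dw (\<alpha> (emb \<xi>)) x) (at (\<alpha> (emb \<xi>) + 0 * \<alpha> (hb r)))"
    using w_DERIV[OF domD[OF \<xi> \<alpha>]] by simp
  show ?thesis
    using DERIV_chain2[OF 2 1] by (simp add: root_emb_axis[OF \<alpha>] mult.commute)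
qed

lemma holo_w_root:
  assumes \<alpha>: "\<alpha> \<in> roots h"
  shows "holo (\<lambda>\<xi>. w (\<alpha> (emb \<xi>)) x)"
proof (rule holoI)
  fix \<xi> r assume \<xi>: "\<xi> \<in> dom"
  show "((\<lambda>k. w (\<alpha> (emb (\<xi> + axis r k))) x) has_field_derivative \<alpha> (hb r) * dw (\<alpha> (emb \<xi>)) x) (at 0)"
    by (rule w_root_DERIV[OF \<alpha> \<xi>])
  show "isCont (\<lambda>\<xi>. w (\<alpha> (emb \<xi>)) x) \<xi>"
    by (rule isCont_o2[OF continuous_root_emb[OF \<alpha>]])
      (rule DERIV_isCont[OF w_DERIV[OF domD[OF \<xi> \<alpha>]]])
qed

lemma dpart_w_root: "\<alpha> \<in> roots h \<Longrightarrow> \<xi> \<in> dom \<Longrightarrow>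
    dpart r (\<lambda>\<xi>. w (\<alpha> (emb \<xi>)) x) \<xi> = \<alpha> (hb r) * dw (\<alpha> (emb \<xi>)) x"
  by (rule dpart_unique) (rule w_root_DERIV)

definition linear_form :: "('w \<Rightarrow> complex) \<Rightarrow> bool" where
  "linear_form \<phi> \<longleftrightarrow> (\<forall>v v'. \<phi> (v + v') = \<phi> v + \<phi> v') \<and> (\<forall>c v. \<phi> (sw c v) = c * \<phi> v)"

text \<open>Sections extended by zero outside \<open>dom\<close>, so that identities on the regular
  set are equalities of functions. The weight condition is kept apart, in \<open>FF0\<close>,
  because a single \<open>ell u \<alpha>\<close> shifts weights.\<close>

definition FF :: "(complex^'l \<Rightarrow> 'w \<Rightarrow> complex) set" where
  "FF = {\<Phi>. (\<forall>\<xi>. linear_form (\<Phi> \<xi>)) \<and> (\<forall>\<xi>. \<xi> \<notin> dom \<longrightarrow> \<Phi> \<xi> = 0) \<and> (\<forall>v. holo (\<lambda>\<xi>. \<Phi> \<xi> v))}"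

definition pd :: "'l \<Rightarrow> (complex^'l \<Rightarrow> 'w \<Rightarrow> complex) \<Rightarrow> complex^'l \<Rightarrow> 'w \<Rightarrow> complex" where
  "pd r \<Phi> = (\<lambda>\<xi> v. if \<xi> \<in> dom then dpart r (\<lambda>\<xi>. \<Phi> \<xi> v) \<xi> else 0)"

text \<open>A right action: \<open>B\<close> followed by \<open>C\<close> acts as the product
  \<open>B * C\<close>, in this order.\<close>

definition act :: "(complex^'l \<Rightarrow> 'w \<Rightarrow> complex) \<Rightarrow> (complex^'l \<Rightarrow> 'w endo) \<Rightarrow> complex^'l \<Rightarrow> 'w \<Rightarrow> complex" where
  "act \<Phi> B = (\<lambda>\<xi> v. \<Phi> \<xi> (app (B \<xi>) v))"

lemma FF_add: "\<Phi> \<in> FF \<Longrightarrow> \<Phi> \<xi> (v + v') = \<Phi> \<xi> v + \<Phi> \<xi> v'"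
  and FF_scale: "\<Phi> \<in> FF \<Longrightarrow> \<Phi> \<xi> (sw c v) = c * \<Phi> \<xi> v"
  and FF_outside: "\<Phi> \<in> FF \<Longrightarrow> \<xi> \<notin> dom \<Longrightarrow> \<Phi> \<xi> v = 0"
  and FF_holo: "\<Phi> \<in> FF \<Longrightarrow> holo (\<lambda>\<xi>. \<Phi> \<xi> v)"
  by (auto simp: FF_def linear_form_def)

lemma FF_zero_right: "\<Phi> \<in> FF \<Longrightarrow> \<Phi> \<xi> 0 = 0"
  using FF_scale[of \<Phi> \<xi> 0 0] by simp

lemma FF_uminus_right: "\<Phi> \<in> FF \<Longrightarrow> \<Phi> \<xi> (- v) = - \<Phi> \<xi> v"
  using FF_scale[of \<Phi> \<xi> "- 1" v] by simp

lemma FF_diff_right: "\<Phi> \<in> FF \<Longrightarrow> \<Phi> \<xi> (v - v') = \<Phi> \<xi> v - \<Phi> \<xi> v'"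
  using FF_add[of \<Phi> \<xi> v "- v'"] by (simp add: FF_uminus_right)

lemma FF_sum_right: "\<Phi> \<in> FF \<Longrightarrow> \<Phi> \<xi> (sum f A) = (\<Sum>i\<in>A. \<Phi> \<xi> (f i))"
  by (induction A rule: infinite_finite_induct) (simp_all add: FF_zero_right FF_add)

lemma FF_plus: "\<Phi> \<in> FF \<Longrightarrow> \<Psi> \<in> FF \<Longrightarrow> \<Phi> + \<Psi> \<in> FF"
  by (auto simp: FF_def linear_form_def algebra_simps intro!: holo_add)

lemma FF_cmult: "\<Phi> \<in> FF \<Longrightarrow> (\<lambda>\<xi> v. c * \<Phi> \<xi> v) \<in> FF"
  by (auto simp: FF_def linear_form_def algebra_simps fun_eq_iff intro!: holo_cmult)

lemma FF_uminus: "\<Phi> \<in> FF \<Longrightarrow> - \<Phi> \<in> FF"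
  using FF_cmult[of \<Phi> "- 1"] by (simp add: fun_Compl_def)

lemma FF_minus: "\<Phi> \<in> FF \<Longrightarrow> \<Psi> \<in> FF \<Longrightarrow> \<Phi> - \<Psi> \<in> FF"
  using FF_plus[OF _ FF_uminus, of \<Phi> \<Psi>] by simp

lemma FF_0: "0 \<in> FF"
  by (auto simp: FF_def linear_form_def intro!: holo_const)

lemma FF_sum: "(\<And>i. i \<in> A \<Longrightarrow> f i \<in> FF) \<Longrightarrow> sum f A \<in> FF"
  by (induction A rule: infinite_finite_induct) (simp_all add: FF_0 FF_plus)

lemma FF_pd:
  assumes \<Phi>: "\<Phi> \<in> FF"
  shows "pd r \<Phi> \<in> FF"
proof -
  have "linear_form (pd r \<Phi> \<xi>)" for \<xi>
    using FF_add[OF \<Phi>] FF_scale[OF \<Phi>]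
    by (simp add: linear_form_def pd_def dpart_add dpart_cmult FF_holo[OF \<Phi>])
  moreover have "holo (\<lambda>\<xi>. pd r \<Phi> \<xi> v)" for v
    by (rule holo_cong[OF _ holo_dpart[OF FF_holo[OF \<Phi>, of v], of r]]) (simp add: pd_def)
  ultimately show ?thesis
    by (auto simp: FF_def pd_def)
qed

lemma pd_plus: "\<Phi> \<in> FF \<Longrightarrow> \<Psi> \<in> FF \<Longrightarrow> pd r (\<Phi> + \<Psi>) = pd r \<Phi> + pd r \<Psi>"
  by (auto simp: pd_def fun_eq_iff dpart_add FF_holo)

lemma pd_cmult: "\<Phi> \<in> FF \<Longrightarrow> pd r (\<lambda>\<xi> v. c * \<Phi> \<xi> v) = (\<lambda>\<xi> v. c * pd r \<Phi> \<xi> v)"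
  by (auto simp: pd_def fun_eq_iff dpart_cmult FF_holo)

lemma pd_uminus: "\<Phi> \<in> FF \<Longrightarrow> pd r (- \<Phi>) = - pd r \<Phi>"
  using pd_cmult[of \<Phi> r "- 1"] by (simp add: fun_Compl_def)

lemma pd_minus: "\<Phi> \<in> FF \<Longrightarrow> \<Psi> \<in> FF \<Longrightarrow> pd r (\<Phi> - \<Psi>) = pd r \<Phi> - pd r \<Psi>"
  using pd_plus[OF _ FF_uminus, of \<Phi> \<Psi> r] by (simp add: pd_uminus)

lemma pd_commute:
  assumes \<Phi>: "\<Phi> \<in> FF"
  shows "pd r (pd q \<Phi>) = pd q (pd r \<Phi>)"
proof (intro ext)
  fix \<xi> v
  have "dpart r (\<lambda>\<xi>. pd q \<Phi> \<xi> v) \<xi> = dpart q (\<lambda>\<xi>. pd r \<Phi> \<xi> v) \<xi>" if \<xi>: "\<xi> \<in> dom"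
  proof -
    have "dpart r (\<lambda>\<xi>. pd q \<Phi> \<xi> v) \<xi> = dpart r (dpart q (\<lambda>\<xi>. \<Phi> \<xi> v)) \<xi>"
      by (rule dpart_cong) (use \<xi> in \<open>auto simp: pd_def\<close>)
    also have "\<dots> = dpart q (dpart r (\<lambda>\<xi>. \<Phi> \<xi> v)) \<xi>"
      by (rule dpart_commute[OF FF_holo[OF \<Phi>] \<xi>])
    also have "\<dots> = dpart q (\<lambda>\<xi>. pd r \<Phi> \<xi> v) \<xi>"
      by (rule dpart_cong) (use \<xi> in \<open>auto simp: pd_def\<close>)
    finally show ?thesis .
  qed
  then show "pd r (pd q \<Phi>) \<xi> v = pd q (pd r \<Phi>) \<xi> v"
    by (simp add: pd_def[of r "pd q \<Phi>"] pd_def[of q "pd r \<Phi>"])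
qed

lemma act_act: "act (act \<Phi> B) C = act \<Phi> (\<lambda>\<xi>. B \<xi> * C \<xi>)"
  by (simp add: act_def app_times)

lemma act_plus: "act (\<Phi> + \<Psi>) B = act \<Phi> B + act \<Psi> B"
  and act_minus: "act (\<Phi> - \<Psi>) B = act \<Phi> B - act \<Psi> B"
  and act_uminus: "act (- \<Phi>) B = - act \<Phi> B"
  and act_zero: "act 0 B = 0"
  by (simp_all add: act_def fun_eq_iff)

lemma act_sum: "act (sum f A) B = (\<Sum>i\<in>A. act (f i) B)"
proof (induction A rule: infinite_finite_induct)
  case (insert i A)
  then show ?case by (simp only: sum.insert act_plus if_False not_False_eq_True)
qed (simp_all only: sum.infinite sum.empty act_zero not_False_eq_True)

lemma act_plus_right: "\<Phi> \<in> FF \<Longrightarrow> act \<Phi> (\<lambda>\<xi>. B \<xi> + C \<xi>) = act \<Phi> B + act \<Phi> C"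
  and act_minus_right: "\<Phi> \<in> FF \<Longrightarrow> act \<Phi> (\<lambda>\<xi>. B \<xi> - C \<xi>) = act \<Phi> B - act \<Phi> C"
  and act_sum_right: "\<Phi> \<in> FF \<Longrightarrow> act \<Phi> (\<lambda>\<xi>. \<Sum>i\<in>A. D i \<xi>) = (\<Sum>i\<in>A. act \<Phi> (D i))"
proof -
  assume \<Phi>: "\<Phi> \<in> FF"
  show "act \<Phi> (\<lambda>\<xi>. B \<xi> + C \<xi>) = act \<Phi> B + act \<Phi> C"
    by (simp add: act_def fun_eq_iff app_plus FF_add[OF \<Phi>])
  show "act \<Phi> (\<lambda>\<xi>. B \<xi> - C \<xi>) = act \<Phi> B - act \<Phi> C"
    by (simp add: act_def fun_eq_iff app_minus FF_diff_right[OF \<Phi>])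
  show "act \<Phi> (\<lambda>\<xi>. \<Sum>i\<in>A. D i \<xi>) = (\<Sum>i\<in>A. act \<Phi> (D i))"
  proof (induction A rule: infinite_finite_induct)
    case (insert i A)
    have "act \<Phi> (\<lambda>\<xi>. D i \<xi> + (\<Sum>i\<in>A. D i \<xi>)) = act \<Phi> (D i) + act \<Phi> (\<lambda>\<xi>. \<Sum>i\<in>A. D i \<xi>)"
      by (simp add: act_def fun_eq_iff app_plus FF_add[OF \<Phi>])
    then show ?case using insert by simp
  qed (simp_all add: act_def fun_eq_iff app_zero FF_zero_right[OF \<Phi>])
qed

lemma act_cong:
  assumes "\<Phi> \<in> FF" "\<And>\<xi>. \<xi> \<in> dom \<Longrightarrow> B \<xi> = C \<xi>"
  shows "act \<Phi> B = act \<Phi> C"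
proof (intro ext)
  fix \<xi> v
  show "act \<Phi> B \<xi> v = act \<Phi> C \<xi> v"
    by (cases "\<xi> \<in> dom") (simp_all add: act_def assms FF_outside)
qed

text \<open>\<open>coeff B B'\<close> says that composing with the endomorphism-valued function \<open>B\<close> preserves the
  space of functions and that \<open>B' r\<close> plays the role of \<open>\<partial>B/\<partial>\<xi>\<^sub>r\<close> in the product rule.\<close>

definition coeff :: "(complex^'l \<Rightarrow> 'w endo) \<Rightarrow> ('l \<Rightarrow> complex^'l \<Rightarrow> 'w endo) \<Rightarrow> bool" where
  "coeff B B' \<longleftrightarrow> (\<forall>\<Phi>\<in>FF. act \<Phi> B \<in> FF \<and> (\<forall>r. pd r (act \<Phi> B) = act (pd r \<Phi>) B + act \<Phi> (B' r)))"

lemma coeff_FF: "coeff B B' \<Longrightarrow> \<Phi> \<in> FF \<Longrightarrow> act \<Phi> B \<in> FF"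
  and coeff_pd: "coeff B B' \<Longrightarrow> \<Phi> \<in> FF \<Longrightarrow> pd r (act \<Phi> B) = act (pd r \<Phi>) B + act \<Phi> (B' r)"
  by (auto simp: coeff_def)

lemma coeff_const:
  assumes "\<And>k. b * s k = s k * b"
  shows "coeff (\<lambda>_. b) (\<lambda>r _. 0)"
  unfolding coeff_def
proof (intro ballI conjI allI)
  fix \<Phi> r assume \<Phi>: "\<Phi> \<in> FF"
  have "app b (sw k v) = sw k (app b v)" for k v
    using arg_cong[OF assms[of k], of "\<lambda>f. app f v"] by (simp add: app_times app_s)
  then show "act \<Phi> (\<lambda>_. b) \<in> FF"
    using \<Phi> by (auto simp: FF_def act_def linear_form_def app_endo_add)
  show "pd r (act \<Phi> (\<lambda>_. b)) = act (pd r \<Phi>) (\<lambda>_. b) + act \<Phi> (\<lambda>_. 0)"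
    by (auto simp: pd_def act_def fun_eq_iff app_zero FF_zero_right[OF \<Phi>])
qed

lemma coeff_scalar:
  assumes k: "holo k"
  shows "coeff (\<lambda>\<xi>. s (k \<xi>)) (\<lambda>r \<xi>. s (dpart r k \<xi>))"
  unfolding coeff_def
proof (intro ballI conjI allI)
  fix \<Phi> r assume \<Phi>: "\<Phi> \<in> FF"
  have eq: "act \<Phi> (\<lambda>\<xi>. s (k \<xi>)) = (\<lambda>\<xi> v. k \<xi> * \<Phi> \<xi> v)"
    by (simp add: act_def app_s FF_scale[OF \<Phi>])
  show "act \<Phi> (\<lambda>\<xi>. s (k \<xi>)) \<in> FF"
    using \<Phi> k unfolding eq by (auto simp: FF_def linear_form_def algebra_simps fun_eq_iff intro!: holo_mult)
  show "pd r (act \<Phi> (\<lambda>\<xi>. s (k \<xi>))) = act (pd r \<Phi>) (\<lambda>\<xi>. s (k \<xi>)) + act \<Phi> (\<lambda>\<xi>. s (dpart r k \<xi>))"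
  proof (intro ext)
    fix \<xi> v
    show "pd r (act \<Phi> (\<lambda>\<xi>. s (k \<xi>))) \<xi> v = (act (pd r \<Phi>) (\<lambda>\<xi>. s (k \<xi>)) + act \<Phi> (\<lambda>\<xi>. s (dpart r k \<xi>))) \<xi> v"
      unfolding eq using FF_scale[OF FF_pd[OF \<Phi>]]
      by (cases "\<xi> \<in> dom")
        (simp_all add: pd_def act_def app_s FF_scale[OF \<Phi>] dpart_mult k FF_holo[OF \<Phi>] FF_outside[OF \<Phi>])
  qed
qed

lemma coeff_mult:
  assumes B: "coeff B B'" and C: "coeff C C'"
  shows "coeff (\<lambda>\<xi>. B \<xi> * C \<xi>) (\<lambda>r \<xi>. B' r \<xi> * C \<xi> + B \<xi> * C' r \<xi>)"
  unfolding coeff_def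
proof (intro ballI conjI allI)
  fix \<Phi> r assume \<Phi>: "\<Phi> \<in> FF"
  show "act \<Phi> (\<lambda>\<xi>. B \<xi> * C \<xi>) \<in> FF"
    unfolding act_act[symmetric] by (intro coeff_FF[OF C] coeff_FF[OF B] \<Phi>)
  show "pd r (act \<Phi> (\<lambda>\<xi>. B \<xi> * C \<xi>)) =
      act (pd r \<Phi>) (\<lambda>\<xi>. B \<xi> * C \<xi>) + act \<Phi> (\<lambda>\<xi>. B' r \<xi> * C \<xi> + B \<xi> * C' r \<xi>)"
    unfolding act_plus_right[OF \<Phi>] act_act[symmetric] coeff_pd[OF C coeff_FF[OF B \<Phi>]] coeff_pd[OF B \<Phi>] act_plus
    by (simp only: add.assoc)
qed

lemma coeff_sum:
  assumes "\<And>i. i \<in> A \<Longrightarrow> coeff (B i) (B' i)" "finite A"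
  shows "coeff (\<lambda>\<xi>. \<Sum>i\<in>A. B i \<xi>) (\<lambda>r \<xi>. \<Sum>i\<in>A. B' i r \<xi>)"
  unfolding coeff_def
proof (intro ballI conjI allI)
  fix \<Phi> r assume \<Phi>: "\<Phi> \<in> FF"
  show "act \<Phi> (\<lambda>\<xi>. \<Sum>i\<in>A. B i \<xi>) \<in> FF"
    unfolding act_sum_right[OF \<Phi>] using assms coeff_FF \<Phi> by (intro FF_sum) blast
  have "pd r (\<Sum>i\<in>A. act \<Phi> (B i)) = (\<Sum>i\<in>A. pd r (act \<Phi> (B i)))"
    using assms(2,1)
  proof (induction A rule: finite_induct)
    case empty
    show ?case by (auto simp: pd_def fun_eq_iff dpart_def)
  next
    case (insert i A)
    have "pd r (act \<Phi> (B i) + (\<Sum>i\<in>A. act \<Phi> (B i))) = pd r (act \<Phi> (B i)) + pd r (\<Sum>i\<in>A. act \<Phi> (B i))"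
      by (intro pd_plus FF_sum) (use insert.prems coeff_FF \<Phi> in blast)+
    then show ?case
      using insert by (simp only: sum.insert not_False_eq_True insert_iff simp_thms)
  qed
  then show "pd r (act \<Phi> (\<lambda>\<xi>. \<Sum>i\<in>A. B i \<xi>)) = act (pd r \<Phi>) (\<lambda>\<xi>. \<Sum>i\<in>A. B i \<xi>) + act \<Phi> (\<lambda>\<xi>. \<Sum>i\<in>A. B' i r \<xi>)"
    unfolding act_sum_right[OF \<Phi>] act_sum_right[OF FF_pd[OF \<Phi>]] sum.distrib[symmetric]
    using coeff_pd[OF assms(1) \<Phi>] by simp
qed

section \<open>The connection, the potential and its covariant derivative\<close>

definition \<eta> :: "complex \<Rightarrow> 'l \<Rightarrow> 'w endo" where
  "\<eta> u r = (\<Sum>i\<in>I. s (\<zeta> (z i - u)) * P i (hb r))"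

definition ell :: "complex \<Rightarrow> ('g \<Rightarrow> complex) \<Rightarrow> complex^'l \<Rightarrow> 'w endo" where
  "ell u \<alpha> \<xi> = (\<Sum>i\<in>I. s (w (\<alpha> (emb \<xi>)) (z i - u)) * P i (e \<alpha>))"

definition dell :: "complex \<Rightarrow> ('g \<Rightarrow> complex) \<Rightarrow> 'l \<Rightarrow> complex^'l \<Rightarrow> 'w endo" where
  "dell u \<alpha> r \<xi> = (\<Sum>i\<in>I. s (dpart r (\<lambda>\<xi>. w (\<alpha> (emb \<xi>)) (z i - u)) \<xi>) * P i (e \<alpha>))"

definition Q :: "complex \<Rightarrow> complex^'l \<Rightarrow> 'w endo" where
  "Q u \<xi> = (\<Sum>\<alpha>\<in>roots h. ell u \<alpha> \<xi> * ell u (- \<alpha>) \<xi>)"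

definition dQ :: "complex \<Rightarrow> 'l \<Rightarrow> complex^'l \<Rightarrow> 'w endo" where
  "dQ u r \<xi> = (\<Sum>\<alpha>\<in>roots h. dell u \<alpha> r \<xi> * ell u (- \<alpha>) \<xi> + ell u \<alpha> \<xi> * dell u (- \<alpha>) r \<xi>)"

lemma coeff_ell: "\<alpha> \<in> roots h \<Longrightarrow> coeff (ell u \<alpha>) (dell u \<alpha>)"
proof -
  assume \<alpha>: "\<alpha> \<in> roots h"
  have "coeff (\<lambda>\<xi>. s (w (\<alpha> (emb \<xi>)) (z i - u)) * P i (e \<alpha>))
     (\<lambda>r \<xi>. s (dpart r (\<lambda>\<xi>. w (\<alpha> (emb \<xi>)) (z i - u)) \<xi>) * P i (e \<alpha>) + s (w (\<alpha> (emb \<xi>)) (z i - u)) * 0)"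
    if "i \<in> I" for i
    by (intro coeff_mult coeff_scalar coeff_const holo_w_root \<alpha> P_s that)
  then show ?thesis
    using coeff_sum[OF _ fin_I] unfolding ell_def[abs_def] dell_def[abs_def] by (simp add: mult_zero_right)
qed

lemma coeff_Q: "coeff (Q u) (dQ u)"
  unfolding Q_def[abs_def] dQ_def[abs_def]
  by (intro coeff_sum coeff_mult coeff_ell root_uminus finite_roots)

lemma \<eta>_s: "\<eta> u r * s k = s k * \<eta> u r"
proof -
  have "s m * P i (hb r) * s k = s k * (s m * P i (hb r))" if "i \<in> I" for i m
  proof -
    have "s m * P i (hb r) * s k = s m * s k * P i (hb r)"
      using P_s[OF that] by (simp add: mult.assoc)
    then show ?thesis by (simp add: s_mult[symmetric] mult.assoc[symmetric] mult.commute)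
  qed
  then show ?thesis
    by (simp add: \<eta>_def sum_distrib_left sum_distrib_right)
qed

lemma coeff_\<eta>: "coeff (\<lambda>_. \<eta> u r) (\<lambda>r _. 0)"
  by (rule coeff_const) (rule \<eta>_s)

lemma \<eta>_commute: "\<eta> u r * \<eta> u' q = \<eta> u' q * \<eta> u r"
proof -
  have "commutator (\<eta> u r) (\<eta> u' q) = (\<Sum>i\<in>I. s (\<zeta> (z i - u) * \<zeta> (z i - u')) * commutator (P i (hb r)) (P i (hb q)))"
    unfolding \<eta>_def by (rule commutator_local_sums) (auto simp: fin_I P_s P_commute)
  also have "\<dots> = 0"
    by (simp add: P_bracket h_abelian hb_in_h P_zero)
  finally show ?thesis by (simp add: commutator_def)
qed

definition nab :: "complex \<Rightarrow> 'l \<Rightarrow> (complex^'l \<Rightarrow> 'w \<Rightarrow> complex) \<Rightarrow> complex^'l \<Rightarrow> 'w \<Rightarrow> complex" where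
  "nab u r \<Phi> = pd r \<Phi> - act \<Phi> (\<lambda>_. \<eta> u r)"

lemma FF_nab: "\<Phi> \<in> FF \<Longrightarrow> nab u r \<Phi> \<in> FF"
  unfolding nab_def by (intro FF_minus FF_pd coeff_FF[OF coeff_\<eta>])

lemma nab_plus: "\<Phi> \<in> FF \<Longrightarrow> \<Psi> \<in> FF \<Longrightarrow> nab u r (\<Phi> + \<Psi>) = nab u r \<Phi> + nab u r \<Psi>"
  by (simp add: nab_def pd_plus act_plus)

lemma nab_cmult: "\<Phi> \<in> FF \<Longrightarrow> nab u r (\<lambda>\<xi> v. c * \<Phi> \<xi> v) = (\<lambda>\<xi> v. c * nab u r \<Phi> \<xi> v)"
  by (simp add: nab_def pd_cmult act_def fun_eq_iff right_diff_distrib)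

lemma nab_sum: "(\<And>i. i \<in> A \<Longrightarrow> f i \<in> FF) \<Longrightarrow> nab u r (sum f A) = (\<Sum>i\<in>A. nab u r (f i))"
proof (induction A rule: infinite_finite_induct)
  case (insert i A)
  have "nab u r (f i + sum f A) = nab u r (f i) + nab u r (sum f A)"
    by (intro nab_plus FF_sum) (use insert.prems in auto)
  then show ?case
    using insert by (simp only: sum.insert not_False_eq_True insert_iff simp_thms)
qed (auto simp: nab_def pd_def act_def fun_eq_iff dpart_def)

lemma pd_act_\<eta>: "\<Phi> \<in> FF \<Longrightarrow> pd q (act \<Phi> (\<lambda>_. \<eta> u r)) = act (pd q \<Phi>) (\<lambda>_. \<eta> u r)"
  using coeff_pd[OF coeff_\<eta>] by (simp add: act_def fun_eq_iff app_zero FF_zero_right)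

text \<open>The connections are flat and mutually compatible: the coefficients \<open>\<eta>\<close>
  do not depend on the point and commute, since \<open>h\<close> is abelian.\<close>

lemma nab_commute:
  assumes "\<Phi> \<in> FF"
  shows "nab u r (nab u' q \<Phi>) = nab u' q (nab u r \<Phi>)"
  using assms coeff_FF[OF coeff_\<eta>]
  by (simp add: nab_def pd_minus FF_pd pd_act_\<eta> act_minus act_act \<eta>_commute[of u r u' q] pd_commute[of \<Phi> r q] algebra_simps)

text \<open>The derivative of \<open>Q u'\<close> along the connection with parameter u. The right
  action turns the subtracted \<open>\<eta>\<close> into the commutator with \<open>\<eta>\<close>
  on the left.\<close>

definition \<kappa> :: "complex \<Rightarrow> complex \<Rightarrow> 'l \<Rightarrow> complex^'l \<Rightarrow> 'w endo" where
  "\<kappa> u u' r \<xi> = dQ u' r \<xi> + commutator (\<eta> u r) (Q u' \<xi>)"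

lemma nab_act_Q:
  assumes "\<Phi> \<in> FF"
  shows "nab u r (act \<Phi> (Q u')) = act (nab u r \<Phi>) (Q u') + act \<Phi> (\<kappa> u u' r)"
  using assms
  by (simp add: nab_def coeff_pd[OF coeff_Q] act_minus act_act \<kappa>_def[abs_def] commutator_def act_plus_right
      act_minus_right)

text \<open>Holomorphy is read off from the product rule, which writes this section as a difference
  of two that are known to lie in \<open>FF\<close>.\<close>

lemma FF_act_\<kappa>:
  assumes "\<Phi> \<in> FF"
  shows "act \<Phi> (\<kappa> u u' r) \<in> FF"
proof -
  have "act \<Phi> (\<kappa> u u' r) = nab u r (act \<Phi> (Q u')) - act (nab u r \<Phi>) (Q u')"
    using nab_act_Q[OF assms] by simp
  then show ?thesis
    using assms by (simp add: FF_minus FF_nab coeff_FF[OF coeff_Q])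
qed

definition regular :: "complex \<Rightarrow> bool" where
  "regular u \<longleftrightarrow> (\<forall>i\<in>I. z i - u \<notin> \<Lambda>)"

lemma regularD: "regular u \<Longrightarrow> i \<in> I \<Longrightarrow> z i - u \<notin> \<Lambda>"
  by (simp add: regular_def)

lemma fibre:
  assumes \<xi>: "\<xi> \<in> dom" and u: "regular u" and u': "regular u'" and uu': "u' - u \<notin> \<Lambda>"
  shows "dynamical_fibre s I (roots h) (\<lambda>i \<alpha>. P i (e \<alpha>)) (\<lambda>i \<alpha>. P i (t \<alpha>)) (\<lambda>\<alpha> \<beta>. \<beta> (t \<alpha>)) G
    (\<lambda>\<alpha> i. w (\<alpha> (emb \<xi>)) (z i - u)) (\<lambda>\<alpha> i. w (\<alpha> (emb \<xi>)) (z i - u'))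
    (\<lambda>\<alpha>. w (\<alpha> (emb \<xi>)) (u' - u)) (\<lambda>\<alpha>. dw (\<alpha> (emb \<xi>)) (u' - u))
    (\<lambda>i. \<zeta> (z i - u)) (\<lambda>i. \<zeta> (z i - u'))"
proof (intro dynamical_fibre.intro scalars_axioms dynamical_fibre_axioms.intro)
  have diff: "(z i - u) - (z i - u') = u' - u" for i by simp
  fix i assume i: "i \<in> I"
  note [simp] = regularD[OF u i] regularD[OF u' i]
  show "w (\<alpha> (emb \<xi>)) (z i - u) * w ((- \<alpha>) (emb \<xi>)) (z i - u') =
      w (\<alpha> (emb \<xi>)) (u' - u) * (\<zeta> (z i - u') - \<zeta> (z i - u)) - dw (\<alpha> (emb \<xi>)) (u' - u)"
    if "\<alpha> \<in> roots h" for \<alpha>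
    using fay_degenerate[of "z i - u" "z i - u'" "\<alpha> (emb \<xi>)"] uu' domD[OF \<xi> that] by simp
  show "w (\<alpha> (emb \<xi>)) (z i - u) * w (\<beta> (emb \<xi>)) (z i - u') =
      - w ((- \<beta>) (emb \<xi>)) (u' - u) * w ((\<alpha> + \<beta>) (emb \<xi>)) (z i - u)
      + w (\<alpha> (emb \<xi>)) (u' - u) * w ((\<alpha> + \<beta>) (emb \<xi>)) (z i - u')"
    if "\<alpha> \<in> roots h" "\<beta> \<in> roots h" "\<alpha> + \<beta> \<in> roots h" for \<alpha> \<beta>
  proof -
    \<comment> \<open>\<open>fay\<close> produces the argument u - u'; changing both signs in w
      brings every coefficient to u' - u.\<close>
    have "w (\<beta> (emb \<xi>)) (u - u') = - w (- \<beta> (emb \<xi>)) (u' - u)"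
      using w_uminus[of "- \<beta> (emb \<xi>)" "u' - u"] by simp
    then show ?thesis
      using fay[of "z i - u" "z i - u'" "\<alpha> (emb \<xi>)" "\<beta> (emb \<xi>)"] uu' domD[OF \<xi>] that domD[OF \<xi> that(3)]
      by (simp add: algebra_simps)
  qed
next
  fix \<alpha> assume "\<alpha> \<in> roots h"
  then show "- \<alpha> \<in> roots h" "\<alpha> \<noteq> 0" "(- \<alpha>) (t \<alpha>) = - \<alpha> (t \<alpha>)" "(- \<alpha>) (t (- \<alpha>)) = \<alpha> (t \<alpha>)"
    by (rule root_uminus roots_neq_0 root_t_uminus; assumption)+
next
  fix \<alpha> \<beta> \<gamma>
  show "G \<beta> \<alpha> \<gamma> = - G \<alpha> \<beta> \<gamma>" "G \<alpha> \<gamma> \<beta> = - G \<alpha> \<beta> \<gamma>"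
    by (rule G_swap12 G_swap23)+
next
  fix i j \<alpha> \<beta> assume "i \<in> I" "j \<in> I" "i \<noteq> j"
  then show "P i (e \<alpha>) * P j (e \<beta>) = P j (e \<beta>) * P i (e \<alpha>)"
    "P i (t \<alpha>) * P j (e \<beta>) = P j (e \<beta>) * P i (t \<alpha>)"
    by (rule P_commute)+
qed (simp_all add: fin_I finite_roots P_s P_bracket bracket_e_add P_scale bracket_e_uminus bracket_e_zero P_zero
    bracket_t_e t_uminus t_add P_uminus P_add del: minus_add_distrib)

lemma commutator_\<eta>_ell:
  assumes "\<alpha> \<in> roots h"
  shows "commutator (\<eta> u r) (ell u' \<alpha> \<xi>) =
    (\<Sum>i\<in>I. s (\<alpha> (hb r) * (\<zeta> (z i - u) * w (\<alpha> (emb \<xi>)) (z i - u'))) * P i (e \<alpha>))"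
proof -
  have "commutator (\<eta> u r) (ell u' \<alpha> \<xi>) =
    (\<Sum>i\<in>I. s (\<zeta> (z i - u) * w (\<alpha> (emb \<xi>)) (z i - u')) * commutator (P i (hb r)) (P i (e \<alpha>)))"
    unfolding \<eta>_def ell_def by (rule commutator_local_sums) (auto simp: fin_I P_s P_commute)
  also have "\<dots> = (\<Sum>i\<in>I. s (\<alpha> (hb r) * (\<zeta> (z i - u) * w (\<alpha> (emb \<xi>)) (z i - u'))) * P i (e \<alpha>))"
    by (intro sum.cong refl)
      (simp add: P_bracket root_spaceD[OF e_root[OF assms] hb_in_h] P_scale s_mult_assoc mult_ac)
  finally show ?thesis .
qed

lemma commutator_\<eta>_Q:
  "commutator (\<eta> u r) (Q u' \<xi>) = (\<Sum>\<alpha>\<in>roots h. commutator (\<eta> u r) (ell u' \<alpha> \<xi>) * ell u' (- \<alpha>) \<xi>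
     + ell u' \<alpha> \<xi> * commutator (\<eta> u r) (ell u' (- \<alpha>) \<xi>))"
  unfolding Q_def commutator_sum_right by (intro sum.cong refl) (simp add: commutator_def algebra_simps)

context
  fixes u u' \<xi>
  assumes \<xi>: "\<xi> \<in> dom" and u: "regular u" and u': "regular u'" and uu': "u' - u \<notin> \<Lambda>"
begin

interpretation fib: dynamical_fibre s I "roots h" "\<lambda>i \<alpha>. P i (e \<alpha>)" "\<lambda>i \<alpha>. P i (t \<alpha>)" "\<lambda>\<alpha> \<beta>. \<beta> (t \<alpha>)" G
    "\<lambda>\<alpha> i. w (\<alpha> (emb \<xi>)) (z i - u)" "\<lambda>\<alpha> i. w (\<alpha> (emb \<xi>)) (z i - u')"
    "\<lambda>\<alpha>. w (\<alpha> (emb \<xi>)) (u' - u)" "\<lambda>\<alpha>. dw (\<alpha> (emb \<xi>)) (u' - u)"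
    "\<lambda>i. \<zeta> (z i - u)" "\<lambda>i. \<zeta> (z i - u')"
  by (rule fibre[OF \<xi> u u' uu'])

lemma fib_L: "fib.L \<alpha> = ell u \<alpha> \<xi>" and fib_L': "fib.L' \<alpha> = ell u' \<alpha> \<xi>"
  by (simp_all add: fib.L_def fib.L'_def ell_def)

lemma fib_Q: "(\<Sum>\<alpha>\<in>roots h. fib.L (- \<alpha>) * fib.L \<alpha>) = Q u \<xi>"
  and fib_Q': "(\<Sum>\<alpha>\<in>roots h. fib.L' (- \<alpha>) * fib.L' \<alpha>) = Q u' \<xi>"
  using fib.sum_R_uminus[of "\<lambda>\<alpha>. ell u \<alpha> \<xi> * ell u (- \<alpha>) \<xi>"] fib.sum_R_uminus[of "\<lambda>\<alpha>. ell u' \<alpha> \<xi> * ell u' (- \<alpha>) \<xi>"]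
  by (simp_all add: fib_L fib_L' Q_def)

lemma \<kappa>_eq:
  "\<kappa> u u' r \<xi> = (\<Sum>\<alpha>\<in>roots h. s (\<alpha> (hb r) * w (\<alpha> (emb \<xi>)) (u' - u)) * (fib.L (- \<alpha>) * fib.L' \<alpha> + fib.L' \<alpha> * fib.L (- \<alpha>)))"
proof -
  \<comment> \<open>The derivative of \<open>ell u' \<alpha>\<close> along the connection with
    parameter u; the first identity of \<open>fay_dw\<close> rewrites it through \<open>L\<close>
    and \<open>L'\<close>.\<close>
  define M where "M \<alpha> = dell u' \<alpha> r \<xi> + commutator (\<eta> u r) (ell u' \<alpha> \<xi>)" for \<alpha>
  have "\<kappa> u u' r \<xi> = (\<Sum>\<alpha>\<in>roots h. M \<alpha> * fib.L' (- \<alpha>) + fib.L' \<alpha> * M (- \<alpha>))"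
    by (simp add: \<kappa>_def dQ_def commutator_\<eta>_Q M_def fib_L' sum.distrib distrib_left distrib_right)
  also have "\<dots> = (\<Sum>\<alpha>\<in>roots h. s (\<alpha> (hb r) * w (\<alpha> (emb \<xi>)) (u' - u)) * (fib.L (- \<alpha>) * fib.L' \<alpha> + fib.L' \<alpha> * fib.L (- \<alpha>)))"
  proof (rule fib.commutator_L_L'_sum[where z = "\<zeta> (u' - u)"])
    fix \<alpha> assume \<alpha>: "\<alpha> \<in> roots h"
    let ?a = "\<alpha> (emb \<xi>)"
    have "M \<alpha> = (\<Sum>i\<in>I. s (\<alpha> (hb r) * (dw ?a (z i - u') + \<zeta> (z i - u) * w ?a (z i - u'))) * P i (e \<alpha>))"
      by (simp add: M_def dell_def dpart_w_root[OF \<alpha> \<xi>] commutator_\<eta>_ell[OF \<alpha>] sum.distrib[symmetric]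
          distrib_right[symmetric] s_add[symmetric] distrib_left[symmetric])
    also have "\<dots> = (\<Sum>i\<in>I. s (\<alpha> (hb r) * (- w (- ?a) (u' - u) * w ?a (z i - u) + \<zeta> (u' - u) * w ?a (z i - u'))) * P i (e \<alpha>))"
      using fay_dw(1)[OF regularD[OF u] regularD[OF u'] _ domD[OF \<xi> \<alpha>]] uu' by simp
    also have "\<dots> = s (\<alpha> (hb r)) * (- s (w ((- \<alpha>) (emb \<xi>)) (u' - u)) * fib.L \<alpha> + s (\<zeta> (u' - u)) * fib.L' \<alpha>)"
      by (simp only: fib.L_def fib.L'_def s_mult s_add s_uminus distrib_left distrib_right sum.distrib sum_distrib_left
          mult.assoc mult_minus_left mult_minus_right sum_negf uminus_apply)
    finally show "M \<alpha> = s (\<alpha> (hb r)) * (- s (w ((- \<alpha>) (emb \<xi>)) (u' - u)) * fib.L \<alpha> + s (\<zeta> (u' - u)) * fib.L' \<alpha>)" .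
  qed simp
  finally show ?thesis .
qed

text \<open>The same sum as in \<open>\<kappa>_eq\<close>, now obtained from the second identity of
  \<open>fay_dw\<close>: the two mixed covariant derivatives coincide.\<close>

lemma \<kappa>_eq':
  "\<kappa> u' u r \<xi> = (\<Sum>\<alpha>\<in>roots h. s (\<alpha> (hb r) * w (\<alpha> (emb \<xi>)) (u' - u)) * (fib.L (- \<alpha>) * fib.L' \<alpha> + fib.L' \<alpha> * fib.L (- \<alpha>)))"
proof -
  define M where "M \<alpha> = dell u \<alpha> r \<xi> + commutator (\<eta> u' r) (ell u \<alpha> \<xi>)" for \<alpha>
  have "\<kappa> u' u r \<xi> = (\<Sum>\<alpha>\<in>roots h. M \<alpha> * fib.L (- \<alpha>) + fib.L \<alpha> * M (- \<alpha>))"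
    by (simp add: \<kappa>_def dQ_def commutator_\<eta>_Q M_def fib_L sum.distrib distrib_left distrib_right)
  also have "\<dots> = (\<Sum>\<alpha>\<in>roots h. s (\<alpha> (hb r) * w (\<alpha> (emb \<xi>)) (u' - u)) * (fib.L (- \<alpha>) * fib.L' \<alpha> + fib.L' \<alpha> * fib.L (- \<alpha>)))"
  proof (rule fib.commutator_L'_L_sum[where z = "\<zeta> (u' - u)"])
    fix \<alpha> assume \<alpha>: "\<alpha> \<in> roots h"
    let ?a = "\<alpha> (emb \<xi>)"
    have "M \<alpha> = (\<Sum>i\<in>I. s (\<alpha> (hb r) * (dw ?a (z i - u) + \<zeta> (z i - u') * w ?a (z i - u))) * P i (e \<alpha>))"
      by (simp add: M_def dell_def dpart_w_root[OF \<alpha> \<xi>] commutator_\<eta>_ell[OF \<alpha>] sum.distrib[symmetric]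
          distrib_right[symmetric] s_add[symmetric] distrib_left[symmetric])
    also have "\<dots> = (\<Sum>i\<in>I. s (\<alpha> (hb r) * (w ?a (u' - u) * w ?a (z i - u') - \<zeta> (u' - u) * w ?a (z i - u))) * P i (e \<alpha>))"
      using fay_dw(2)[OF regularD[OF u] regularD[OF u'] _ domD[OF \<xi> \<alpha>]] uu' by simp
    also have "\<dots> = s (\<alpha> (hb r)) * (s (w ?a (u' - u)) * fib.L' \<alpha> - s (\<zeta> (u' - u)) * fib.L \<alpha>)"
      by (simp only: fib.L_def fib.L'_def s_mult s_diff right_diff_distrib left_diff_distrib sum_subtractf sum_distrib_left mult.assoc)
    finally show "M \<alpha> = s (\<alpha> (hb r)) * (s (w ?a (u' - u)) * fib.L' \<alpha> - s (\<zeta> (u' - u)) * fib.L \<alpha>)" .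
  qed simp
  finally show ?thesis .
qed

lemma fib_E: "fib.E \<alpha> = (\<Sum>r\<in>UNIV. s (\<alpha> (hb r)) * (\<eta> u r - \<eta> u' r))"
proof -
  have "fib.E \<alpha> = (\<Sum>i\<in>I. \<Sum>r\<in>UNIV. s (\<alpha> (hb r)) * (s (\<zeta> (z i - u) - \<zeta> (z i - u')) * P i (hb r)))"
    unfolding fib.E_def
    by (intro sum.cong refl) (simp add: t_def P_sum P_scale sum_distrib_left s_mult_assoc mult.commute)
  also have "\<dots> = (\<Sum>r\<in>UNIV. s (\<alpha> (hb r)) * (\<Sum>i\<in>I. s (\<zeta> (z i - u) - \<zeta> (z i - u')) * P i (hb r)))"
    unfolding sum_distrib_left by (rule sum.swap)
  also have "\<dots> = (\<Sum>r\<in>UNIV. s (\<alpha> (hb r)) * (\<eta> u r - \<eta> u' r))"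
    by (simp add: \<eta>_def s_diff left_diff_distrib sum_subtractf)
  finally show ?thesis .
qed

text \<open>\<open>fibre_identity\<close> in the shape produced by the Laplacians: the factor
  \<alpha>(h_r) in \<open>\<kappa>_eq\<close> combines with the differences of the connections to
  \<open>fib.E \<alpha>\<close>.\<close>

lemma fibre_vanishing:
  fixes \<phi> :: "'w endo \<Rightarrow> complex"
  assumes "\<And>x y. \<phi> (x + y) = \<phi> x + \<phi> y" "\<And>H y. H \<in> h \<Longrightarrow> \<phi> ((\<Sum>i\<in>I. P i H) * y) = 0"
  shows "\<phi> ((\<Sum>r\<in>UNIV. (\<eta> u r - \<eta> u' r) * \<kappa> u u' r \<xi> + \<kappa> u u' r \<xi> * (\<eta> u r - \<eta> u' r)) + commutator (Q u \<xi>) (Q u' \<xi>)) = 0"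
proof -
  let ?M = "\<lambda>\<alpha>. fib.L (- \<alpha>) * fib.L' \<alpha> + fib.L' \<alpha> * fib.L (- \<alpha>)" and ?\<epsilon> = "\<lambda>r. \<eta> u r - \<eta> u' r"
    and ?c = "\<lambda>\<alpha>. w (\<alpha> (emb \<xi>)) (u' - u)"
  have \<epsilon>s: "?\<epsilon> r * (s k * x) = s k * (?\<epsilon> r * x)" for r k x
  proof -
    have "\<eta> v r * (s k * x) = s k * (\<eta> v r * x)" for v
      by (simp only: mult.assoc[symmetric] \<eta>_s)
    then show ?thesis by (simp only: left_diff_distrib right_diff_distrib)
  qed
  have "s (?c \<alpha>) * (fib.E \<alpha> * ?M \<alpha> + ?M \<alpha> * fib.E \<alpha>) =
      (\<Sum>r\<in>UNIV. s (\<alpha> (hb r) * ?c \<alpha>) * (?\<epsilon> r * ?M \<alpha> + ?M \<alpha> * ?\<epsilon> r))" if "\<alpha> \<in> roots h" for \<alpha>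
  proof -
    have Ms: "?M \<alpha> * (s k * x) = s k * (?M \<alpha> * x)" for k x
    proof -
      have "fib.L (- \<alpha>) * (s k * y) = s k * (fib.L (- \<alpha>) * y)" "fib.L' \<alpha> * (s k * y) = s k * (fib.L' \<alpha> * y)" for y
        by (simp_all only: mult.assoc[symmetric] fib.L_s[OF root_uminus[OF that]] fib.L'_s[OF that])
      then show ?thesis by (simp add: distrib_left distrib_right mult.assoc)
    qed
    define m where "m = ?M \<alpha>"
    have ms: "m * (s k * x) = s k * (m * x)" for k x
      unfolding m_def by (rule Ms)
    have 1: "fib.E \<alpha> * m = (\<Sum>r\<in>UNIV. s (\<alpha> (hb r)) * (?\<epsilon> r * m))"
      by (simp only: fib_E sum_distrib_right mult.assoc)
    have 2: "m * fib.E \<alpha> = (\<Sum>r\<in>UNIV. s (\<alpha> (hb r)) * (m * ?\<epsilon> r))"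
      by (simp only: fib_E sum_distrib_left ms)
    have "s (?c \<alpha>) * (fib.E \<alpha> * m + m * fib.E \<alpha>) = (\<Sum>r\<in>UNIV. s (\<alpha> (hb r) * ?c \<alpha>) * (?\<epsilon> r * m + m * ?\<epsilon> r))"
      by (simp only: 1 2 sum.distrib[symmetric] distrib_left[symmetric])
        (simp only: sum_distrib_left s_mult_assoc mult.commute[of "?c \<alpha>"])
    then show ?thesis
      unfolding m_def .
  qed
  then have "(\<Sum>\<alpha>\<in>roots h. s (?c \<alpha>) * (fib.E \<alpha> * ?M \<alpha> + ?M \<alpha> * fib.E \<alpha>)) =
      (\<Sum>\<alpha>\<in>roots h. \<Sum>r\<in>UNIV. s (\<alpha> (hb r) * ?c \<alpha>) * (?\<epsilon> r * ?M \<alpha> + ?M \<alpha> * ?\<epsilon> r))"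
    by simp
  also have "\<dots> = (\<Sum>r\<in>UNIV. \<Sum>\<alpha>\<in>roots h. s (\<alpha> (hb r) * ?c \<alpha>) * (?\<epsilon> r * ?M \<alpha> + ?M \<alpha> * ?\<epsilon> r))"
    by (rule sum.swap)
  also have "\<dots> = (\<Sum>r\<in>UNIV. ?\<epsilon> r * \<kappa> u u' r \<xi> + \<kappa> u u' r \<xi> * ?\<epsilon> r)"
    unfolding \<kappa>_eq sum_distrib_left sum_distrib_right sum.distrib[symmetric] \<epsilon>s
    by (intro sum.cong refl) (simp only: distrib_left distrib_right mult.assoc)
  finally have "(\<Sum>r\<in>UNIV. ?\<epsilon> r * \<kappa> u u' r \<xi> + \<kappa> u u' r \<xi> * ?\<epsilon> r) =
      (\<Sum>\<alpha>\<in>roots h. s (?c \<alpha>) * (fib.E \<alpha> * ?M \<alpha> + ?M \<alpha> * fib.E \<alpha>))" by simp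
  then show ?thesis
    using fib.fibre_identity[of \<phi>, OF assms(1)] assms(2)[OF t_in_h]
    by (simp only: fib_Q fib_Q' fib.W_def)
qed

end

section \<open>Commutation of the operators on zero weight sections\<close>

definition lap :: "complex \<Rightarrow> (complex^'l \<Rightarrow> 'w \<Rightarrow> complex) \<Rightarrow> complex^'l \<Rightarrow> 'w \<Rightarrow> complex" where
  "lap u \<Phi> = (\<Sum>r\<in>UNIV. nab u r (nab u r \<Phi>))"

definition tau2 :: "complex \<Rightarrow> (complex^'l \<Rightarrow> 'w \<Rightarrow> complex) \<Rightarrow> complex^'l \<Rightarrow> 'w \<Rightarrow> complex" where
  "tau2 u \<Phi> = lap u \<Phi> + act \<Phi> (Q u)"

definition FF0 :: "(complex^'l \<Rightarrow> 'w \<Rightarrow> complex) set" where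
  "FF0 = {\<Phi> \<in> FF. \<forall>H\<in>h. act \<Phi> (\<lambda>_. \<Sum>i\<in>I. P i H) = 0}"

lemma FF_lap: "\<Phi> \<in> FF \<Longrightarrow> lap u \<Phi> \<in> FF"
  unfolding lap_def by (intro FF_sum FF_nab)

lemma FF_tau2: "\<Phi> \<in> FF \<Longrightarrow> tau2 u \<Phi> \<in> FF"
  unfolding tau2_def by (intro FF_plus FF_lap coeff_FF[OF coeff_Q])

lemma lap_plus: "\<Phi> \<in> FF \<Longrightarrow> \<Psi> \<in> FF \<Longrightarrow> lap u (\<Phi> + \<Psi>) = lap u \<Phi> + lap u \<Psi>"
  unfolding lap_def sum.distrib[symmetric] by (intro sum.cong refl) (simp only: nab_plus FF_nab)

lemma lap_commute:
  assumes "\<Phi> \<in> FF"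
  shows "lap u (lap u' \<Phi>) = lap u' (lap u \<Phi>)"
proof -
  have 1: "lap u (lap u' \<Phi>) = (\<Sum>r\<in>UNIV. \<Sum>q\<in>UNIV. nab u r (nab u r (nab u' q (nab u' q \<Phi>))))" for u u'
    unfolding lap_def by (simp only: nab_sum FF_nab assms)
  have 2: "nab u r (nab u r (nab u' q (nab u' q \<Phi>))) = nab u' q (nab u' q (nab u r (nab u r \<Phi>)))" for r q
    by (simp only: nab_commute[of _ u r u' q] FF_nab assms)
  show ?thesis
    unfolding 1 2 by (rule sum.swap)
qed

lemma lap_act_Q:
  assumes "\<Phi> \<in> FF"
  shows "lap u (act \<Phi> (Q u')) = act (lap u \<Phi>) (Q u') +
    (\<Sum>r\<in>UNIV. act (nab u r \<Phi>) (\<kappa> u u' r) + nab u r (act \<Phi> (\<kappa> u u' r)))"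
proof -
  have "nab u r (nab u r (act \<Phi> (Q u'))) = act (nab u r (nab u r \<Phi>)) (Q u') +
      (act (nab u r \<Phi>) (\<kappa> u u' r) + nab u r (act \<Phi> (\<kappa> u u' r)))" for r
    using assms by (simp only: nab_act_Q nab_plus FF_nab coeff_FF[OF coeff_Q] FF_act_\<kappa> add.assoc)
  then show ?thesis
    by (simp only: lap_def act_sum sum.distrib)
qed

lemma nab_diff: "\<Phi> \<in> FF \<Longrightarrow> nab u r \<Phi> - nab u' r \<Phi> = - act \<Phi> (\<lambda>_. \<eta> u r - \<eta> u' r)"
  by (simp only: nab_def act_minus_right) simp

text \<open>The Laplacians commute, and the terms with a Laplacian of the section followed by
  \<open>Q\<close> occur on both sides. Since the covariant derivatives of \<open>Q\<close> agree,
  the first order terms differ only by the difference of the connections, and the rest is the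
  expression of \<open>fibre_vanishing\<close>.\<close>

lemma tau2_commute_generic:
  assumes \<Phi>: "\<Phi> \<in> FF0" and u: "regular u" and u': "regular u'" and uu': "u' - u \<notin> \<Lambda>"
  shows "tau2 u (tau2 u' \<Phi>) = tau2 u' (tau2 u \<Phi>)"
proof -
  have FF: "\<Phi> \<in> FF" using \<Phi> by (simp add: FF0_def)
  let ?k = "\<kappa> u u'" and ?\<epsilon> = "\<lambda>r. \<eta> u r - \<eta> u' r"
  \<comment> \<open>On \<open>dom\<close> both coefficients are the same explicit sum; elsewhere
    sections vanish.\<close>
  have k': "act \<Psi> (\<kappa> u' u r) = act \<Psi> (?k r)" if "\<Psi> \<in> FF" for \<Psi> r
    by (rule act_cong[OF that]) (simp only: \<kappa>_eq[OF _ u u' uu'] \<kappa>_eq'[OF _ u u' uu'])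
  have expand: "tau2 u (tau2 u' \<Phi>) = lap u (lap u' \<Phi>) + (act (lap u \<Phi>) (Q u') +
      (\<Sum>r\<in>UNIV. act (nab u r \<Phi>) (\<kappa> u u' r) + nab u r (act \<Phi> (\<kappa> u u' r))))
      + (act (lap u' \<Phi>) (Q u) + act \<Phi> (\<lambda>\<xi>. Q u' \<xi> * Q u \<xi>))" for u u'
    by (simp only: tau2_def lap_plus FF_lap coeff_FF[OF coeff_Q] FF lap_act_Q act_plus act_act)
  define X where "X = (\<Sum>r\<in>UNIV. act \<Phi> (\<lambda>\<xi>. ?\<epsilon> r * ?k r \<xi> + ?k r \<xi> * ?\<epsilon> r))
     + act \<Phi> (\<lambda>\<xi>. commutator (Q u \<xi>) (Q u' \<xi>))"
  have summand: "(act (nab u r \<Phi>) (?k r) + nab u r (act \<Phi> (?k r))) - (act (nab u' r \<Phi>) (?k r) + nab u' r (act \<Phi> (?k r)))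
      = - act \<Phi> (\<lambda>\<xi>. ?\<epsilon> r * ?k r \<xi> + ?k r \<xi> * ?\<epsilon> r)" for r
  proof -
    have "act (nab u r \<Phi>) (?k r) - act (nab u' r \<Phi>) (?k r) = - act \<Phi> (\<lambda>\<xi>. ?\<epsilon> r * ?k r \<xi>)"
      by (simp only: act_minus[symmetric] nab_diff[OF FF] act_uminus act_act)
    moreover have "nab u r (act \<Phi> (?k r)) - nab u' r (act \<Phi> (?k r)) = - act \<Phi> (\<lambda>\<xi>. ?k r \<xi> * ?\<epsilon> r)"
      by (simp only: nab_diff[OF FF_act_\<kappa>[OF FF]] act_act)
    ultimately show ?thesis
      unfolding act_plus_right[OF FF] add_diff_add by (simp only: minus_add_distrib)
  qed
  have "tau2 u (tau2 u' \<Phi>) - tau2 u' (tau2 u \<Phi>) =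
      ((\<Sum>r\<in>UNIV. act (nab u r \<Phi>) (?k r) + nab u r (act \<Phi> (?k r)))
       - (\<Sum>r\<in>UNIV. act (nab u' r \<Phi>) (?k r) + nab u' r (act \<Phi> (?k r))))
      + (act \<Phi> (\<lambda>\<xi>. Q u' \<xi> * Q u \<xi>) - act \<Phi> (\<lambda>\<xi>. Q u \<xi> * Q u' \<xi>))"
    unfolding expand lap_commute[OF FF, of u' u] k'[OF FF] k'[OF FF_nab[OF FF]] by simp
  also have "\<dots> = - X"
    unfolding sum_subtractf[symmetric] summand X_def sum_negf commutator_def act_minus_right[OF FF] by simp
  also have "X = 0"
  proof (intro ext)
    fix \<xi> v
    have X: "X = act \<Phi> (\<lambda>\<xi>. (\<Sum>r\<in>UNIV. ?\<epsilon> r * ?k r \<xi> + ?k r \<xi> * ?\<epsilon> r) + commutator (Q u \<xi>) (Q u' \<xi>))"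
      unfolding X_def act_plus_right[OF FF, of "\<lambda>\<xi>. \<Sum>r\<in>UNIV. ?\<epsilon> r * ?k r \<xi> + ?k r \<xi> * ?\<epsilon> r"]
        act_sum_right[OF FF] ..
    show "X \<xi> v = 0 \<xi> v"
    proof (cases "\<xi> \<in> dom")
      case True
      have "(\<lambda>x. \<Phi> \<xi> (app x v)) ((\<Sum>r\<in>UNIV. ?\<epsilon> r * ?k r \<xi> + ?k r \<xi> * ?\<epsilon> r) + commutator (Q u \<xi>) (Q u' \<xi>)) = 0"
      proof (rule fibre_vanishing[OF True u u' uu'])
        show "\<Phi> \<xi> (app (x + y) v) = \<Phi> \<xi> (app x v) + \<Phi> \<xi> (app y v)" for x y
          by (simp add: app_plus FF_add[OF FF])
        show "\<Phi> \<xi> (app ((\<Sum>i\<in>I. P i H) * y) v) = 0" if "H \<in> h" for H y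
        proof -
          have "act \<Phi> (\<lambda>_. \<Sum>i\<in>I. P i H) \<xi> (app y v) = 0"
            using \<Phi> that by (simp add: FF0_def)
          then show ?thesis by (simp add: act_def app_times)
        qed
      qed
      then show ?thesis by (simp add: X act_def)
    next
      case False
      then show ?thesis by (simp add: X act_def FF_outside[OF FF])
    qed
  qed
  finally show ?thesis by (simp only: minus_zero right_minus_eq)
qed

lemma ell_s: "ell u \<alpha> \<xi> * s k = s k * ell u \<alpha> \<xi>"
proof -
  have "s m * P i (e \<alpha>) * s k = s k * (s m * P i (e \<alpha>))" if "i \<in> I" for i m
  proof -
    have "s m * P i (e \<alpha>) * s k = s m * s k * P i (e \<alpha>)"
      using P_s[OF that] by (simp add: mult.assoc)
    then show ?thesis by (simp add: s_mult[symmetric] mult.assoc[symmetric] mult.commute)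
  qed
  then show ?thesis
    by (simp add: ell_def sum_distrib_left sum_distrib_right)
qed

text \<open>\<open>\<eta>\<close> lies in the action of the abelian \<open>h\<close>, and each
  summand of \<open>Q\<close> has weight \<alpha> + (-\<alpha>) = 0. Hence zero weight is
  preserved.\<close>

lemma weight_commutes:
  assumes H: "H \<in> h"
  shows "\<eta> u r * (\<Sum>i\<in>I. P i H) = (\<Sum>i\<in>I. P i H) * \<eta> u r"
    and "Q u \<xi> * (\<Sum>i\<in>I. P i H) = (\<Sum>i\<in>I. P i H) * Q u \<xi>"
proof -
  let ?W = "\<Sum>i\<in>I. P i H"
  have W: "?W = (\<Sum>i\<in>I. s 1 * P i H)" by (simp add: s_one)
  have "commutator ?W (\<eta> u r) = (\<Sum>i\<in>I. s (1 * \<zeta> (z i - u)) * commutator (P i H) (P i (hb r)))"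
    unfolding W \<eta>_def by (rule commutator_local_sums) (auto simp: fin_I P_s P_commute)
  also have "\<dots> = 0"
    using H by (simp add: P_bracket h_abelian hb_in_h P_zero)
  finally show "\<eta> u r * ?W = ?W * \<eta> u r" by (simp add: commutator_def)
  have ell: "commutator ?W (ell u \<alpha> \<xi>) = s (\<alpha> H) * ell u \<alpha> \<xi>" if \<alpha>: "\<alpha> \<in> roots h" for \<alpha>
  proof -
    have "commutator ?W (ell u \<alpha> \<xi>) = (\<Sum>i\<in>I. s (1 * w (\<alpha> (emb \<xi>)) (z i - u)) * commutator (P i H) (P i (e \<alpha>)))"
      unfolding W ell_def by (rule commutator_local_sums) (auto simp: fin_I P_s P_commute)
    also have "\<dots> = (\<Sum>i\<in>I. s (\<alpha> H) * (s (w (\<alpha> (emb \<xi>)) (z i - u)) * P i (e \<alpha>)))"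
      by (intro sum.cong refl)
        (simp add: P_bracket root_spaceD[OF e_root[OF \<alpha>] H] P_scale s_mult_assoc mult.commute)
    finally show ?thesis by (simp only: ell_def sum_distrib_left)
  qed
  have "commutator ?W (Q u \<xi>) = 0"
    unfolding Q_def commutator_sum_right
  proof (intro sum.neutral ballI)
    fix \<alpha> assume \<alpha>: "\<alpha> \<in> roots h"
    have "commutator ?W (ell u \<alpha> \<xi> * ell u (- \<alpha>) \<xi>) =
        commutator ?W (ell u \<alpha> \<xi>) * ell u (- \<alpha>) \<xi> + ell u \<alpha> \<xi> * commutator ?W (ell u (- \<alpha>) \<xi>)"
      by (simp add: commutator_def algebra_simps)
    also have "\<dots> = s (\<alpha> H) * (ell u \<alpha> \<xi> * ell u (- \<alpha>) \<xi>) + ell u \<alpha> \<xi> * s (- \<alpha> H) * ell u (- \<alpha>) \<xi>"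
      by (simp only: ell[OF \<alpha>] ell[OF root_uminus[OF \<alpha>]] mult.assoc uminus_apply)
    also have "\<dots> = 0"
      unfolding ell_s by (simp only: mult.assoc s_uminus mult_minus_left add.right_inverse)
    finally show "commutator ?W (ell u \<alpha> \<xi> * ell u (- \<alpha>) \<xi>) = 0" .
  qed
  then show "Q u \<xi> * ?W = ?W * Q u \<xi>" by (simp add: commutator_def)
qed

lemma FF0_I: "\<Phi> \<in> FF \<Longrightarrow> (\<And>H. H \<in> h \<Longrightarrow> act \<Phi> (\<lambda>_. \<Sum>i\<in>I. P i H) = 0) \<Longrightarrow> \<Phi> \<in> FF0"
  by (simp add: FF0_def)

lemma FF0_plus: "\<Phi> \<in> FF0 \<Longrightarrow> \<Psi> \<in> FF0 \<Longrightarrow> \<Phi> + \<Psi> \<in> FF0"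
proof (rule FF0_I)
  assume *: "\<Phi> \<in> FF0" "\<Psi> \<in> FF0"
  then show "\<Phi> + \<Psi> \<in> FF" by (intro FF_plus) (auto simp: FF0_def)
  show "act (\<Phi> + \<Psi>) (\<lambda>_. \<Sum>i\<in>I. P i H) = 0" if "H \<in> h" for H
    using * that by (simp only: act_plus FF0_def mem_Collect_eq) simp
qed

lemma FF0_sum: "finite A \<Longrightarrow> (\<And>i. i \<in> A \<Longrightarrow> f i \<in> FF0) \<Longrightarrow> sum f A \<in> FF0"
proof (induction A rule: finite_induct)
  case empty
  show ?case by (rule FF0_I) (simp_all only: sum.empty FF_0 act_zero)
next
  case (insert i A)
  have "f i + sum f A \<in> FF0" using insert by (intro FF0_plus) auto
  moreover have "sum f (insert i A) = f i + sum f A"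
    using insert.hyps by (rule sum.insert)
  ultimately show ?case by (simp only:)
qed

lemma FF0_nab:
  assumes "\<Phi> \<in> FF0"
  shows "nab u r \<Phi> \<in> FF0"
proof (rule FF0_I)
  have FF: "\<Phi> \<in> FF" using assms by (simp add: FF0_def)
  show "nab u r \<Phi> \<in> FF" by (rule FF_nab[OF FF])
  fix H assume H: "H \<in> h"
  let ?W = "\<Sum>i\<in>I. P i H"
  have 0: "act \<Phi> (\<lambda>_. ?W) = 0" using assms H by (simp add: FF0_def)
  have "?W * s k = s k * ?W" for k
    by (simp add: sum_distrib_left sum_distrib_right P_s)
  then have "pd r (act \<Phi> (\<lambda>_. ?W)) = act (pd r \<Phi>) (\<lambda>_. ?W) + act \<Phi> (\<lambda>_. 0)"
    by (rule coeff_pd[OF coeff_const FF])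
  moreover have "act \<Phi> (\<lambda>_. 0) = 0" "pd r 0 = 0"
    by (auto simp: act_def fun_eq_iff app_zero FF_zero_right[OF FF] pd_def dpart_def)
  ultimately have "act (pd r \<Phi>) (\<lambda>_. ?W) = 0"
    unfolding 0 by simp
  moreover have "act (act \<Phi> (\<lambda>_. \<eta> u r)) (\<lambda>_. ?W) = 0"
    unfolding act_act weight_commutes(1)[OF H] unfolding act_act[symmetric] 0 by (rule act_zero)
  ultimately show "act (nab u r \<Phi>) (\<lambda>_. ?W) = 0"
    by (simp only: nab_def act_minus diff_zero)
qed

lemma FF0_act_Q:
  assumes "\<Phi> \<in> FF0"
  shows "act \<Phi> (Q u) \<in> FF0"
proof (rule FF0_I)
  have FF: "\<Phi> \<in> FF" using assms by (simp add: FF0_def)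
  then show "act \<Phi> (Q u) \<in> FF" by (rule coeff_FF[OF coeff_Q])
  fix H assume H: "H \<in> h"
  then show "act (act \<Phi> (Q u)) (\<lambda>_. \<Sum>i\<in>I. P i H) = 0"
    unfolding act_act weight_commutes(2)[OF H] using assms
    unfolding act_act[symmetric] FF0_def by (simp add: act_zero)
qed

lemma FF0_tau2: "\<Phi> \<in> FF0 \<Longrightarrow> tau2 u \<Phi> \<in> FF0"
  unfolding tau2_def lap_def by (intro FF0_plus FF0_sum FF0_nab FF0_act_Q finite)

text \<open>For \<open>u' - u\<close> in the lattice, \<open>u\<close> and \<open>u'\<close> define the same operator: the quasi-period factors of
  \<open>w\<^sub>\<alpha>\<close> and \<open>w\<^sub>-\<^sub>\<alpha>\<close> cancel and \<open>\<zeta>\<close> changes by a constant, which multiplies the total weight.\<close>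

lemma tau2_lattice:
  assumes \<Phi>: "\<Phi> \<in> FF0" and u: "regular u" and u': "u' - u \<in> \<Lambda>"
  shows "tau2 u' \<Phi> = tau2 u \<Phi>"
proof -
  from u' obtain m n where "u' - u = of_int m + of_int n * \<tau>"
    unfolding in_period_lattice by blast
  then have zi: "z i - u' = (z i - u) + of_int (- m) + of_int (- n) * \<tau>" for i
    by (simp add: algebra_simps)
  let ?c = "2 * of_real pi * \<i> * of_int (- n) :: complex"
  have nab: "nab u' r \<Psi> = nab u r \<Psi>" if \<Psi>: "\<Psi> \<in> FF0" for r \<Psi>
  proof -
    have FF: "\<Psi> \<in> FF" using \<Psi> by (simp add: FF0_def)
    have "\<zeta> (z i - u') = \<zeta> (z i - u) - ?c" if "i \<in> I" for i
      unfolding zi by (rule zeta_lattice) (rule regularD[OF u that])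
    then have "\<eta> u r - \<eta> u' r = (\<Sum>i\<in>I. s ?c * P i (hb r))"
      unfolding \<eta>_def sum_subtractf[symmetric] left_diff_distrib[symmetric] s_diff[symmetric]
      by (intro sum.cong refl) simp
    also have "\<dots> = (\<Sum>i\<in>I. P i (hb r)) * s ?c"
      by (simp add: sum_distrib_right P_s)
    finally have "act \<Psi> (\<lambda>_. \<eta> u r - \<eta> u' r) = act (act \<Psi> (\<lambda>_. \<Sum>i\<in>I. P i (hb r))) (\<lambda>_. s ?c)"
      by (simp only: act_act)
    also have "\<dots> = 0"
      using \<Psi> hb_in_h by (simp add: FF0_def act_zero)
    finally show ?thesis
      using nab_diff[OF FF, of u r u'] by simp
  qed
  have "ell u' \<alpha> \<xi> = s (exp (?c * \<alpha> (emb \<xi>))) * ell u \<alpha> \<xi>" for \<alpha> \<xi>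
  proof -
    have "w (\<alpha> (emb \<xi>)) (z i - u') = exp (?c * \<alpha> (emb \<xi>)) * w (\<alpha> (emb \<xi>)) (z i - u)" for i
      unfolding zi w_lattice by (simp add: mult_ac)
    then show ?thesis
      by (simp add: ell_def sum_distrib_left s_mult_assoc)
  qed
  note 1 = this
  have "ell u' \<alpha> \<xi> * ell u' (- \<alpha>) \<xi> = ell u \<alpha> \<xi> * ell u (- \<alpha>) \<xi>" for \<alpha> \<xi>
  proof -
    have "ell u' \<alpha> \<xi> * ell u' (- \<alpha>) \<xi> =
        s (exp (?c * \<alpha> (emb \<xi>))) * (ell u \<alpha> \<xi> * s (exp (?c * (- \<alpha>) (emb \<xi>)))) * ell u (- \<alpha>) \<xi>"
      unfolding 1 by (simp only: mult.assoc)
    also have "\<dots> = s (exp (?c * \<alpha> (emb \<xi>)) * exp (?c * (- \<alpha>) (emb \<xi>))) * (ell u \<alpha> \<xi> * ell u (- \<alpha>) \<xi>)"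
      unfolding ell_s by (simp only: s_mult mult.assoc)
    also have "exp (?c * \<alpha> (emb \<xi>)) * exp (?c * (- \<alpha>) (emb \<xi>)) = 1"
      unfolding exp_add[symmetric] by simp
    finally show ?thesis by (simp only: s_one)
  qed
  then have "Q u' = Q u" by (intro ext) (simp add: Q_def)
  then show ?thesis
    unfolding tau2_def lap_def using nab[OF \<Phi>] nab[OF FF0_nab[OF \<Phi>]] by simp
qed

theorem tau2_commute:
  assumes "\<Phi> \<in> FF0" "regular u" "regular u'"
  shows "tau2 u (tau2 u' \<Phi>) = tau2 u' (tau2 u \<Phi>)"
  using assms tau2_commute_generic tau2_lattice[OF assms(1,2)] tau2_lattice[OF FF0_tau2[OF assms(1), of u] assms(2)]
  by (cases "u' - u \<in> \<Lambda>") simp_all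

end

section \<open>Transfer to the Cartan subalgebra\<close>

lemma app_endo_sum: "app f (sum g A) = (\<Sum>i\<in>A. app f (g i))"
proof (induction A rule: infinite_finite_induct)
  have "app f 0 = 0" using app_endo_add[of f 0 0] by simp
  then show "app f (sum g A) = (\<Sum>i\<in>A. app f (g i))" if "infinite A" for A using that by simp
  from \<open>app f 0 = 0\<close> show "app f (sum g {}) = (\<Sum>i\<in>{}. app f (g i))" by simp
qed (simp add: app_endo_add)

lemma sum_fun2_apply: "(\<Sum>i\<in>A. f i) x y = (\<Sum>i\<in>A. f i x y)"
  by (induction A rule: infinite_finite_induct) simp_all

context gaudin
begin

definition restr :: "('g \<Rightarrow> 'w \<Rightarrow> complex) \<Rightarrow> complex^'l \<Rightarrow> 'w \<Rightarrow> complex" where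
  "restr F = (\<lambda>\<xi> v. if \<xi> \<in> dom then F (emb \<xi>) v else 0)"

lemma restr_in: "\<xi> \<in> dom \<Longrightarrow> restr F \<xi> v = F (emb \<xi>) v"
  and restr_out: "\<xi> \<notin> dom \<Longrightarrow> restr F \<xi> v = 0"
  by (simp_all add: restr_def)

lemma restr_nabla:
  assumes F: "restr F \<in> FF"
  shows "restr (nabla \<tau> hb I \<rho> z u r F) = nab u r (restr F)"
proof (intro ext)
  fix \<xi> v
  show "restr (nabla \<tau> hb I \<rho> z u r F) \<xi> v = nab u r (restr F) \<xi> v"
  proof (cases "\<xi> \<in> dom")
    case True
    have "partial_xi hb r F (emb \<xi>) v = dpart r (\<lambda>\<xi>. F (emb \<xi>) v) \<xi>"
      by (simp add: partial_xi_def dpart_def emb_axis)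
    \<comment> \<open>\<open>F\<close> may take arbitrary values off the regular set; the derivative
      at a point of the open set \<open>dom\<close> does not see them.\<close>
    also have "\<dots> = dpart r (\<lambda>\<xi>. restr F \<xi> v) \<xi>"
      by (rule dpart_cong[OF _ True]) (simp add: restr_def)
    finally have 1: "partial_xi hb r F (emb \<xi>) v = pd r (restr F) \<xi> v"
      using True by (simp add: pd_def)
    have "app (\<eta> u r) v = (\<Sum>i\<in>I. sw (\<zeta> (z i - u)) (\<rho> i (hb r) v))"
      by (simp add: \<eta>_def app_sum app_times app_s app_P)
    then have "(\<Sum>i\<in>I. \<zeta> (z i - u) * rho_star \<rho> i (hb r) (F (emb \<xi>)) v) = act (restr F) (\<lambda>_. \<eta> u r) \<xi> v"
      by (simp add: act_def FF_sum_right[OF F] FF_scale[OF F]) (simp add: restr_def True rho_star_def)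
    then show ?thesis
      unfolding restr_in[OF True] nabla_def nab_def 1 by simp
  qed (simp add: restr_out FF_outside[OF FF_nab[OF F]])
qed

lemma restr_tau_hat:
  assumes F: "restr F \<in> FF"
  shows "restr (tau_hat \<tau> h hb e I \<rho> z u F) = (\<lambda>\<xi> v. 1/2 * tau2 u (restr F) \<xi> v)"
proof (intro ext)
  fix \<xi> v
  show "restr (tau_hat \<tau> h hb e I \<rho> z u F) \<xi> v = 1/2 * tau2 u (restr F) \<xi> v"
  proof (cases "\<xi> \<in> dom")
    case True
    have "nabla \<tau> hb I \<rho> z u r (nabla \<tau> hb I \<rho> z u r F) (emb \<xi>) v = nab u r (nab u r (restr F)) \<xi> v" for r
    proof -
      have "restr (nabla \<tau> hb I \<rho> z u r (nabla \<tau> hb I \<rho> z u r F)) = nab u r (nab u r (restr F))"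
        using restr_nabla[of "nabla \<tau> hb I \<rho> z u r F" u r] by (simp only: restr_nabla[OF F] FF_nab[OF F])
      then have "restr (nabla \<tau> hb I \<rho> z u r (nabla \<tau> hb I \<rho> z u r F)) \<xi> v = nab u r (nab u r (restr F)) \<xi> v"
        by (simp only:)
      then show ?thesis
        by (simp only: restr_in[OF True])
    qed
    then have 1: "(\<Sum>r\<in>UNIV. nabla \<tau> hb I \<rho> z u r (nabla \<tau> hb I \<rho> z u r F) (emb \<xi>) v) = lap u (restr F) \<xi> v"
      by (simp add: lap_def sum_fun2_apply)
    let ?w = "\<lambda>\<alpha> i. w (\<alpha> (emb \<xi>)) (z i - u)"
    have "app (Q u \<xi>) v = (\<Sum>\<alpha>\<in>roots h. \<Sum>i\<in>I. \<Sum>j\<in>I. sw (?w \<alpha> i * ?w (- \<alpha>) j) (\<rho> i (e \<alpha>) (\<rho> j (e (- \<alpha>)) v)))"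
    proof -
      have "app (ell u \<alpha> \<xi> * ell u (- \<alpha>) \<xi>) v =
          (\<Sum>i\<in>I. \<Sum>j\<in>I. sw (?w \<alpha> i * ?w (- \<alpha>) j) (\<rho> i (e \<alpha>) (\<rho> j (e (- \<alpha>)) v)))" for \<alpha>
      proof -
        have "app (ell u \<alpha> \<xi> * ell u (- \<alpha>) \<xi>) v =
            (\<Sum>i\<in>I. app (s (?w \<alpha> i) * P i (e \<alpha>)) (\<Sum>j\<in>I. app (s (?w (- \<alpha>) j) * P j (e (- \<alpha>))) v))"
          by (simp only: ell_def app_times[of "sum _ _"] app_sum)
        also have "\<dots> = (\<Sum>i\<in>I. \<Sum>j\<in>I. app (s (?w \<alpha> i) * P i (e \<alpha>)) (app (s (?w (- \<alpha>) j) * P j (e (- \<alpha>))) v))"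
          by (simp only: app_endo_sum)
        also have "\<dots> = (\<Sum>i\<in>I. \<Sum>j\<in>I. sw (?w \<alpha> i * ?w (- \<alpha>) j) (\<rho> i (e \<alpha>) (\<rho> j (e (- \<alpha>)) v)))"
          by (intro sum.cong refl) (simp add: app_times app_s app_P \<rho>_scale_right)
        finally show ?thesis .
      qed
      then show ?thesis by (simp add: Q_def app_sum)
    qed
    then have "act (restr F) (Q u) \<xi> v = (\<Sum>\<alpha>\<in>roots h. \<Sum>i\<in>I. \<Sum>j\<in>I.
        ?w \<alpha> i * ?w (- \<alpha>) j * restr F \<xi> (\<rho> i (e \<alpha>) (\<rho> j (e (- \<alpha>)) v)))"
      by (simp add: act_def FF_sum_right[OF F] FF_scale[OF F])
    also have "\<dots> = (\<Sum>\<alpha>\<in>roots h. \<Sum>i\<in>I. \<Sum>j\<in>I.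
        w (\<alpha> (emb \<xi>)) (z i - u) * w (- \<alpha> (emb \<xi>)) (z j - u) *
         rho_star \<rho> j (e (- \<alpha>)) (rho_star \<rho> i (e \<alpha>) (F (emb \<xi>))) v)"
      using True by (simp add: restr_def rho_star_def)
    also have "\<dots> = (\<Sum>i\<in>I. \<Sum>\<alpha>\<in>roots h. \<Sum>j\<in>I.
        w (\<alpha> (emb \<xi>)) (z i - u) * w (- \<alpha> (emb \<xi>)) (z j - u) *
         rho_star \<rho> j (e (- \<alpha>)) (rho_star \<rho> i (e \<alpha>) (F (emb \<xi>))) v)"
      by (rule sum.swap)
    also have "\<dots> = (\<Sum>i\<in>I. \<Sum>j\<in>I. \<Sum>\<alpha>\<in>roots h.
        w (\<alpha> (emb \<xi>)) (z i - u) * w (- \<alpha> (emb \<xi>)) (z j - u) *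
         rho_star \<rho> j (e (- \<alpha>)) (rho_star \<rho> i (e \<alpha>) (F (emb \<xi>))) v)"
      by (intro sum.cong refl) (rule sum.swap)
    finally have 2: "(\<Sum>i\<in>I. \<Sum>j\<in>I. \<Sum>\<alpha>\<in>roots h.
        w (\<alpha> (emb \<xi>)) (z i - u) * w (- \<alpha> (emb \<xi>)) (z j - u) *
         rho_star \<rho> j (e (- \<alpha>)) (rho_star \<rho> i (e \<alpha>) (F (emb \<xi>))) v) = act (restr F) (Q u) \<xi> v" by simp
    have "restr (tau_hat \<tau> h hb e I \<rho> z u F) \<xi> v = tau_hat \<tau> h hb e I \<rho> z u F (emb \<xi>) v"
      using True by (simp add: restr_def)
    also have "\<dots> = 1/2 * lap u (restr F) \<xi> v + 1/2 * act (restr F) (Q u) \<xi> v"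
      unfolding tau_hat_def 1 2 ..
    finally show ?thesis
      by (simp add: tau2_def)
  qed (simp add: restr_def[of "tau_hat \<tau> h hb e I \<rho> z u F"] FF_outside[OF FF_tau2[OF F]])
qed

lemma tau2_cmult: "\<Phi> \<in> FF \<Longrightarrow> tau2 u (\<lambda>\<xi> v. c * \<Phi> \<xi> v) = (\<lambda>\<xi> v. c * tau2 u \<Phi> \<xi> v)"
  by (simp add: tau2_def lap_def nab_cmult FF_nab fun_eq_iff sum_fun2_apply sum_distrib_left distrib_left act_def)

lemma tau_hat_commute:
  assumes F: "restr F \<in> FF0" and u: "regular u" and u': "regular u'" and H: "H \<in> regular_set \<tau> h"
  shows "tau_hat \<tau> h hb e I \<rho> z u (tau_hat \<tau> h hb e I \<rho> z u' F) H v =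
    tau_hat \<tau> h hb e I \<rho> z u' (tau_hat \<tau> h hb e I \<rho> z u F) H v"
proof -
  have FF: "restr F \<in> FF" using F by (simp add: FF0_def)
  have H_h: "H \<in> h" using H by (simp add: regular_set_def)
  define \<xi> :: "complex^'l" where "\<xi> = (\<chi> r. K H (hb r))"
  have emb: "emb \<xi> = H"
    using h_expansion[OF H_h] by (simp add: emb_def \<xi>_def)
  then have \<xi>: "\<xi> \<in> dom" using H by (simp add: dom_def)
  have "tau_hat \<tau> h hb e I \<rho> z u (tau_hat \<tau> h hb e I \<rho> z u' F) H v = 1/4 * tau2 u (tau2 u' (restr F)) \<xi> v" for u u'
  proof -
    let ?G = "tau_hat \<tau> h hb e I \<rho> z u' F"
    have G: "restr ?G = (\<lambda>\<xi> v. 1/2 * tau2 u' (restr F) \<xi> v)" by (rule restr_tau_hat[OF FF])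
    have "restr ?G \<in> FF" unfolding G by (rule FF_cmult[OF FF_tau2[OF FF]])
    then have "restr (tau_hat \<tau> h hb e I \<rho> z u ?G) = (\<lambda>\<xi> v. 1/2 * tau2 u (restr ?G) \<xi> v)"
      by (rule restr_tau_hat)
    also have "\<dots> = (\<lambda>\<xi> v. 1/4 * tau2 u (tau2 u' (restr F)) \<xi> v)"
      unfolding G tau2_cmult[OF FF_tau2[OF FF]] by simp
    finally have "restr (tau_hat \<tau> h hb e I \<rho> z u ?G) \<xi> v = 1/4 * tau2 u (tau2 u' (restr F)) \<xi> v"
      by simp
    then show ?thesis
      using \<xi> emb by (simp add: restr_def)
  qed
  note four = this
  show ?thesis
    unfolding four tau2_commute[OF F u u'] ..
qed

text \<open>Restricted to a coordinate line, the complex linear derivative L is multiplication by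
  \<open>L (axis r 1)\<close>.\<close>

lemma holo_of_holomorphic_several:
  assumes f: "holomorphic_several f dom"
  shows "holo f"
proof -
  have "isCont f \<xi> \<and> (\<forall>r. (\<lambda>k. f (\<xi> + axis r k)) field_differentiable at 0)" if \<xi>: "\<xi> \<in> dom" for \<xi>
  proof (intro conjI allI)
    obtain L where L: "(f has_derivative L) (at \<xi>)" "\<And>c x. L (c *s x) = c * L x"
      using f \<xi> unfolding holomorphic_several_def by blast
    show "isCont f \<xi>"
      using has_derivative_continuous[OF L(1)] .
    fix r :: 'l
    have "((\<lambda>k. \<xi> + axis r k) has_derivative (\<lambda>k. 0 + axis r k)) (at 0)"
      by (rule has_derivative_add[OF has_derivative_const bounded_linear.has_derivative[OF linear_d has_derivative_ident]])
    moreover have "(f has_derivative L) (at (\<xi> + axis r 0))"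
      using L(1) by simp
    ultimately have "((\<lambda>k. f (\<xi> + axis r k)) has_derivative (\<lambda>k. L (0 + axis r k))) (at 0)"
      by (rule has_derivative_compose)
    moreover have "(\<lambda>k. L (0 + axis r k)) = (*) (L (axis r 1))"
    proof
      fix k :: complex
      have "axis r k = k *s axis r (1::complex)"
        by (simp add: vec_eq_iff axis_def)
      then show "L (0 + axis r k) = L (axis r 1) * k"
        using L(2)[of k "axis r 1"] by (metis add_0 mult.commute)
    qed
    ultimately have "((\<lambda>k. f (\<xi> + axis r k)) has_field_derivative L (axis r 1)) (at 0)"
      by (simp only: has_field_derivative_def)
    then show "(\<lambda>k. f (\<xi> + axis r k)) field_differentiable at 0"
      by (auto simp: field_differentiable_def)
  qed
  then show ?thesis
    by (simp add: holo_def continuous_at_imp_continuous_on)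
qed

lemma restr_holomorphic_section:
  assumes F: "F \<in> holomorphic_sections \<tau> h hb sw I \<rho>"
  shows "restr F \<in> FF0"
proof (rule FF0_I)
  have zw: "F (emb \<xi>) \<in> zero_weight_dual sw I h \<rho>" if "\<xi> \<in> dom" for \<xi>
    using F that by (simp add: holomorphic_sections_def dom_def)
  have "holo (\<lambda>\<xi>. restr F \<xi> v)" for v
  proof (rule holo_cong)
    show "holo (\<lambda>\<xi>. F (emb \<xi>) v)"
      using F by (intro holo_of_holomorphic_several) (simp add: holomorphic_sections_def dom_def emb_def)
  qed (simp add: restr_def)
  moreover have "linear_form (restr F \<xi>)" for \<xi>
    using zw[of \<xi>] by (auto simp: linear_form_def restr_def zero_weight_dual_def Vector_Spaces.linear_iff)
  ultimately show "restr F \<in> FF"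
    by (auto simp: FF_def restr_def)
  fix H assume H: "H \<in> h"
  show "act (restr F) (\<lambda>_. \<Sum>i\<in>I. P i H) = 0"
  proof (intro ext)
    fix \<xi> v
    show "act (restr F) (\<lambda>_. \<Sum>i\<in>I. P i H) \<xi> v = 0 \<xi> v"
    proof (cases "\<xi> \<in> dom")
      case True
      have "act (restr F) (\<lambda>_. \<Sum>i\<in>I. P i H) \<xi> v = (\<Sum>i\<in>I. restr F \<xi> (\<rho> i H v))"
        by (simp add: act_def app_sum app_P FF_sum_right[OF \<open>restr F \<in> FF\<close>])
      also have "\<dots> = (\<Sum>i\<in>I. rho_star \<rho> i H (F (emb \<xi>)) v)"
        using True by (simp add: restr_def rho_star_def)
      also have "\<dots> = 0"
        using zw[OF True] H by (simp add: zero_weight_dual_def)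
      finally show ?thesis by simp
    qed (simp add: act_def restr_def)
  qed
qed

end

text \<open>Extend d to a basis and take the coordinate at d.\<close>

lemma linear_functional_separates:
  assumes "vector_space (sw :: complex \<Rightarrow> 'w::ab_group_add \<Rightarrow> 'w)" "d \<noteq> 0"
  obtains \<psi> where "Vector_Spaces.linear sw (*) \<psi>" "\<psi> d \<noteq> (0 :: complex)"
proof -
  interpret vector_space sw by fact
  have ind: "independent {d}" using assms(2) by simp
  define B where "B = extend_basis {d}"
  have B: "independent B" "span B = UNIV" "d \<in> B"
    using independent_extend_basis[OF ind] span_extend_basis[OF ind] extend_basis_superset[OF ind] by (auto simp: B_def)
  show thesis
  proof (rule that)
    show "Vector_Spaces.linear sw (*) (\<lambda>v. representation B v d)"
      unfolding Vector_Spaces.linear_iff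
      using B by (auto simp: representation_add representation_scale vector_space_axioms vector_space_over_itself.vector_space_axioms)
    show "representation B d d \<noteq> 0"
      using B by (simp add: representation_basis)
  qed
qed

text \<open>The universal property speaks of forms, so f - g is tested against a functional \<psi>
  with nonzero value at the difference. Both \<psi> composed with f - g and the zero form factor the
  zero multilinear form; uniqueness makes them equal.\<close>

lemma tensor_linear_eqI:
  assumes T: "is_tensor_product sv sw I V t"
    and f: "Vector_Spaces.linear sw sw f" and g: "Vector_Spaces.linear sw sw g"
    and eq: "\<And>v. v \<in> (\<Pi>\<^sub>E i\<in>I. V i) \<Longrightarrow> f (t v) = g (t v)"
  shows "f x = g x"
proof (rule ccontr)
  assume "f x \<noteq> g x"
  have vs: "vector_space sw" using T by (simp add: is_tensor_product_def)
  obtain \<psi> where \<psi>: "Vector_Spaces.linear sw (*) \<psi>" "\<psi> (f x - g x) \<noteq> (0 :: complex)"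
    using linear_functional_separates[OF vs, of "f x - g x"] \<open>f x \<noteq> g x\<close> by auto
  have mult0: "multilinear_on sv (*) I V (\<lambda>_. 0 :: complex)"
    by (simp add: multilinear_on_def linear_on_subspace_def)
  have vc: "vector_space ((*) :: complex \<Rightarrow> complex \<Rightarrow> complex)"
    by (rule vector_space_over_itself.vector_space_axioms)
  have lin: "Vector_Spaces.linear sw (*) (\<lambda>x. \<psi> (f x - g x))"
  proof -
    have "f (x + y) - g (x + y) = (f x - g x) + (f y - g y)" for x y
      using f g by (simp add: Vector_Spaces.linear_iff)
    moreover have "f (sw c x) - g (sw c x) = sw c (f x - g x)" for c x
    proof -
      have "sw c (f x - g x + g x) = sw c (f x - g x) + sw c (g x)"
        using vs unfolding vector_space_def by blast
      then show ?thesis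
        using f g by (simp add: Vector_Spaces.linear_iff)
    qed
    ultimately show ?thesis
      using \<psi>(1) vs vc by (simp add: Vector_Spaces.linear_iff)
  qed
  have \<psi>0: "\<psi> 0 = 0"
    using \<psi>(1) unfolding Vector_Spaces.linear_iff by (metis add_cancel_right_right)
  have zero: "Vector_Spaces.linear sw (*) (\<lambda>x. 0 :: complex)"
    using vs vc by (simp add: Vector_Spaces.linear_iff)
  have "\<exists>!k. Vector_Spaces.linear sw (*) k \<and> (\<forall>v \<in> (\<Pi>\<^sub>E i\<in>I. V i). k (t v) = (0 :: complex))"
    using T mult0 unfolding is_tensor_product_def by blast
  moreover have "\<forall>v \<in> (\<Pi>\<^sub>E i\<in>I. V i). \<psi> (f (t v) - g (t v)) = 0"
    using eq \<psi>0 by simp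
  ultimately have "(\<lambda>x. \<psi> (f x - g x)) = (\<lambda>x. 0)"
    using lin zero by (metis (mono_tags, lifting))
  then show False using \<psi>(2) by meson
qed

section \<open>Actions on the factors of a tensor product, checked on elementary tensors\<close>

locale tensor_factors = lie_algebra scale bracket
  for scale :: "complex \<Rightarrow> 'g::ab_group_add \<Rightarrow> 'g" and bracket +
  fixes sv :: "complex \<Rightarrow> 'v::ab_group_add \<Rightarrow> 'v" and sw :: "complex \<Rightarrow> 'w::ab_group_add \<Rightarrow> 'w"
    and I :: "'i set" and V :: "'i \<Rightarrow> 'v set" and r :: "'i \<Rightarrow> 'g \<Rightarrow> 'v \<Rightarrow> 'v"
    and t :: "('i \<Rightarrow> 'v) \<Rightarrow> 'w" and \<rho> :: "'i \<Rightarrow> 'g \<Rightarrow> 'w \<Rightarrow> 'w"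
  assumes vs: "vector_space sv"
    and rep: "i \<in> I \<Longrightarrow> lie_representation sv (V i) (r i)"
    and tensor: "is_tensor_product sv sw I V t"
    and rho: "factor_action sw I V r t \<rho>"
begin

abbreviation elementary :: "('i \<Rightarrow> 'v) \<Rightarrow> bool" where
  "elementary v \<equiv> v \<in> (\<Pi>\<^sub>E i\<in>I. V i)"

lemma vector_space_sw: "vector_space sw"
  using tensor by (simp add: is_tensor_product_def)

lemma \<rho>_linear: "i \<in> I \<Longrightarrow> Vector_Spaces.linear sw sw (\<rho> i A)"
  using rho by (simp add: factor_action_def)

lemma \<rho>_add: "i \<in> I \<Longrightarrow> \<rho> i A (v + v') = \<rho> i A v + \<rho> i A v'"
  and \<rho>_scale: "i \<in> I \<Longrightarrow> \<rho> i A (sw c v) = sw c (\<rho> i A v)"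
  using \<rho>_linear by (auto simp: Vector_Spaces.linear_iff)

lemma \<rho>_elementary: "i \<in> I \<Longrightarrow> elementary v \<Longrightarrow> \<rho> i A (t v) = t (v(i := r i A (v i)))"
  using rho by (simp add: factor_action_def)

lemma t_add: "elementary v \<Longrightarrow> i \<in> I \<Longrightarrow> x \<in> V i \<Longrightarrow> y \<in> V i \<Longrightarrow> t (v(i := x + y)) = t (v(i := x)) + t (v(i := y))"
  and t_scale: "elementary v \<Longrightarrow> i \<in> I \<Longrightarrow> x \<in> V i \<Longrightarrow> t (v(i := sv c x)) = sw c (t (v(i := x)))"
  using tensor by (auto simp: is_tensor_product_def multilinear_on_def linear_on_subspace_def)

lemma elementary_upd: "elementary v \<Longrightarrow> i \<in> I \<Longrightarrow> x \<in> V i \<Longrightarrow> elementary (v(i := x))"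
  by (auto simp: PiE_def extensional_def)

lemma elementary_in: "elementary v \<Longrightarrow> i \<in> I \<Longrightarrow> v i \<in> V i"
  by auto

lemma r_in: "i \<in> I \<Longrightarrow> x \<in> V i \<Longrightarrow> r i A x \<in> V i"
  using rep by (simp add: lie_representation_def)

lemma r_add: "i \<in> I \<Longrightarrow> x \<in> V i \<Longrightarrow> r i (A + B) x = r i A x + r i B x"
  and r_scale: "i \<in> I \<Longrightarrow> x \<in> V i \<Longrightarrow> r i (scale c A) x = sv c (r i A x)"
  and r_bracket: "i \<in> I \<Longrightarrow> x \<in> V i \<Longrightarrow> r i (bracket A B) x = r i A (r i B x) - r i B (r i A x)"
  using rep by (auto simp: lie_representation_def Vector_Spaces.linear_iff)

lemma sw_add: "sw c (x + y) = sw c x + sw c y" "sw (c + d) x = sw c x + sw d x" "sw c (sw d x) = sw (c * d) x"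
  using vector_space_sw by (simp_all add: vector_space_def)

lemma linear_swI:
  "(\<And>x y. f (x + y) = f x + f y) \<Longrightarrow> (\<And>c x. f (sw c x) = sw c (f x)) \<Longrightarrow> Vector_Spaces.linear sw sw f"
  using vector_space_sw by (simp add: Vector_Spaces.linear_iff)

lemma sw_diff: "sw c (x - y) = sw c x - sw c y"
  using sw_add(1)[of c "x - y" y] by simp

lemma \<rho>_add_left:
  assumes i: "i \<in> I"
  shows "\<rho> i (A + B) x = \<rho> i A x + \<rho> i B x"
proof (rule tensor_linear_eqI[OF tensor \<rho>_linear[OF i]])
  show "Vector_Spaces.linear sw sw (\<lambda>x. \<rho> i A x + \<rho> i B x)"
    by (rule linear_swI) (simp_all add: \<rho>_add \<rho>_scale i sw_add)
qed (simp add: \<rho>_elementary i r_add elementary_in t_add r_in)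

lemma \<rho>_scale_left:
  assumes i: "i \<in> I"
  shows "\<rho> i (scale c A) x = sw c (\<rho> i A x)"
proof (rule tensor_linear_eqI[OF tensor \<rho>_linear[OF i]])
  show "Vector_Spaces.linear sw sw (\<lambda>x. sw c (\<rho> i A x))"
    by (rule linear_swI) (simp_all add: \<rho>_add \<rho>_scale i sw_add mult.commute)
qed (simp add: \<rho>_elementary i r_scale elementary_in t_scale r_in)

lemma \<rho>_bracket:
  assumes i: "i \<in> I"
  shows "\<rho> i (bracket A B) x = \<rho> i A (\<rho> i B x) - \<rho> i B (\<rho> i A x)"
proof (rule tensor_linear_eqI[OF tensor \<rho>_linear[OF i]])
  show "Vector_Spaces.linear sw sw (\<lambda>x. \<rho> i A (\<rho> i B x) - \<rho> i B (\<rho> i A x))"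
    by (rule linear_swI) (simp_all add: \<rho>_add \<rho>_scale i sw_diff)
  fix v assume v: "elementary v"
  let ?x = "r i A (r i B (v i))" and ?y = "r i B (r i A (v i))" and ?z = "r i (bracket A B) (v i)"
  have vi: "v i \<in> V i" using v i by (rule elementary_in)
  have in_V: "?x \<in> V i" "?y \<in> V i" "?z \<in> V i" by (simp_all add: r_in i vi)
  have twice: "\<rho> i A (\<rho> i B (t v)) = t (v(i := r i A (r i B (v i))))" for A B
    by (simp add: \<rho>_elementary i v elementary_upd vi r_in)
  \<comment> \<open>Multilinearity is stated for sums, so the difference in the bracket relation is
    first rewritten as a sum.\<close>
  have "?z + ?y = ?x" by (simp add: r_bracket[OF i vi])
  then have "t (v(i := ?x)) = t (v(i := ?z)) + t (v(i := ?y))"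
    using t_add[OF v i in_V(3,2)] by simp
  then show "\<rho> i (bracket A B) (t v) = \<rho> i A (\<rho> i B (t v)) - \<rho> i B (\<rho> i A (t v))"
    unfolding twice by (simp add: \<rho>_elementary[OF i v])
qed

lemma \<rho>_commute:
  assumes "i \<in> I" "j \<in> I" "i \<noteq> j"
  shows "\<rho> i A (\<rho> j B x) = \<rho> j B (\<rho> i A x)"
proof (rule tensor_linear_eqI[OF tensor, where f = "\<lambda>x. \<rho> i A (\<rho> j B x)" and g = "\<lambda>x. \<rho> j B (\<rho> i A x)"])
  show "Vector_Spaces.linear sw sw (\<lambda>x. \<rho> i A (\<rho> j B x))" "Vector_Spaces.linear sw sw (\<lambda>x. \<rho> j B (\<rho> i A x))"
    by (rule linear_swI; simp add: \<rho>_add \<rho>_scale assms)+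
  fix v assume v: "elementary v"
  have in_V: "r i A (v i) \<in> V i" "r j B (v j) \<in> V j"
    using assms v by (simp_all add: r_in elementary_in)
  have "\<rho> i A (\<rho> j B (t v)) = t (v(j := r j B (v j), i := r i A (v i)))"
    using assms by (simp add: \<rho>_elementary v elementary_upd in_V)
  moreover have "\<rho> j B (\<rho> i A (t v)) = t (v(i := r i A (v i), j := r j B (v j)))"
    using assms by (simp add: \<rho>_elementary v elementary_upd in_V)
  moreover have "v(i := r i A (v i), j := r j B (v j)) = v(j := r j B (v j), i := r i A (v i))"
    by (rule fun_upd_twist[OF assms(3)])
  ultimately show "\<rho> i A (\<rho> j B (t v)) = \<rho> j B (\<rho> i A (t v))"
    by metis
qed

end

theorem theorem1p1:
  fixes \<tau> :: complex
    and sg :: "complex \<Rightarrow> 'g::ab_group_add \<Rightarrow> 'g"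
    and br :: "'g \<Rightarrow> 'g \<Rightarrow> 'g"
    and h :: "'g set"
    and hb :: "'l::finite \<Rightarrow> 'g"
    and e :: "('g \<Rightarrow> complex) \<Rightarrow> 'g"
    and N :: nat
    and sv :: "complex \<Rightarrow> 'v::ab_group_add \<Rightarrow> 'v"
    and V :: "nat \<Rightarrow> 'v set"
    and r :: "nat \<Rightarrow> 'g \<Rightarrow> 'v \<Rightarrow> 'v"
    and sw :: "complex \<Rightarrow> 'w::ab_group_add \<Rightarrow> 'w"
    and t :: "(nat \<Rightarrow> 'v) \<Rightarrow> 'w"
    and \<rho> :: "nat \<Rightarrow> 'g \<Rightarrow> 'w \<Rightarrow> 'w"
    and z :: "nat \<Rightarrow> complex"
    and u u' :: complex
  assumes tau: "Im \<tau> > 0"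
    and lie: "lie_algebra sg br"
    and fin_dim: "lie_algebra.finite_dim sg"
    and simple: "lie_algebra.simple_lie sg br"
    and cartan: "lie_algebra.cartan_subalgebra sg br h"
    and hb_basis: "module.span sg (range hb) = h"
    and hb_orthonormal:
      "\<And>p q. lie_algebra.inner_form sg br h (hb p) (hb q) = (if p = q then 1 else 0)"
    and e_root: "\<And>\<alpha>. \<alpha> \<in> lie_algebra.roots sg br h \<Longrightarrow> e \<alpha> \<in> lie_algebra.root_space sg br h \<alpha>"
    and e_dual: "\<And>\<alpha> \<alpha>'. \<alpha> \<in> lie_algebra.roots sg br h \<Longrightarrow> \<alpha>' \<in> lie_algebra.roots sg br h \<Longrightarrow>
      lie_algebra.inner_form sg br h (e \<alpha>) (e (- \<alpha>')) = (if \<alpha> = \<alpha>' then 1 else 0)"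
    and vs: "vector_space sv"
    and irr: "\<And>i. i \<in> {1..N} \<Longrightarrow> lie_algebra.finite_dim_irreducible_rep sg br sv (V i) (r i)"
    and tensor: "is_tensor_product sv sw {1..N} V t"
    and rho: "factor_action sw {1..N} V r t \<rho>"
    and z_distinct: "\<And>i j. i \<in> {1..N} \<Longrightarrow> j \<in> {1..N} \<Longrightarrow> i \<noteq> j \<Longrightarrow> z i - z j \<notin> period_lattice \<tau>"
    and u_regular: "\<And>i. i \<in> {1..N} \<Longrightarrow> u - z i \<notin> period_lattice \<tau>"
    and u'_regular: "\<And>i. i \<in> {1..N} \<Longrightarrow> u' - z i \<notin> period_lattice \<tau>"
  shows "\<forall>F \<in> lie_algebra.holomorphic_sections sg br \<tau> h hb sw {1..N} \<rho>.
           \<forall>H \<in> lie_algebra.regular_set sg br \<tau> h. \<forall>v.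
             lie_algebra.tau_hat sg br \<tau> h hb e {1..N} \<rho> z u
               (lie_algebra.tau_hat sg br \<tau> h hb e {1..N} \<rho> z u' F) H v
             - lie_algebra.tau_hat sg br \<tau> h hb e {1..N} \<rho> z u'
               (lie_algebra.tau_hat sg br \<tau> h hb e {1..N} \<rho> z u F) H v = 0"
proof (intro ballI allI)
  interpret lie_algebra sg br by (rule lie)
  interpret tf: tensor_factors sg br sv sw "{1..N}" V r t \<rho>
  proof (intro tensor_factors.intro tensor_factors_axioms.intro lie vs tensor rho)
    show "lie_representation sv (V i) (r i)" if "i \<in> {1..N}" for i
      using irr[OF that] by (simp add: finite_dim_irreducible_rep_def)
  qed
  have fdl: "finite_dim_lie_algebra sg br"
    by (intro finite_dim_lie_algebra.intro finite_dim_lie_algebra_axioms.intro lie fin_dim)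
  have root_data: "root_data sg br h hb e"
    by (intro root_data.intro root_data_axioms.intro fdl)
      (rule simple cartan hb_basis hb_orthonormal e_root e_dual; assumption?)+
  interpret ga: gaudin sg br h hb e \<tau> sw "{1..N}" \<rho> z
    by (intro gaudin.intro gaudin_axioms.intro root_data upper_half_plane.intro tau tf.vector_space_sw
        finite_atLeastAtMost)
      (rule tf.\<rho>_add tf.\<rho>_scale tf.\<rho>_add_left tf.\<rho>_scale_left tf.\<rho>_bracket tf.\<rho>_commute; assumption)+
  fix F H v
  assume F: "F \<in> holomorphic_sections \<tau> h hb sw {1..N} \<rho>" and H: "H \<in> regular_set \<tau> h"
  \<comment> \<open>The operators contain z_i - u while the hypotheses exclude u - z_i from the
    lattice; the lattice is symmetric.\<close>
  have "ga.regular u" "ga.regular u'"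
    unfolding ga.regular_def using u_regular u'_regular by (metis ga.lattice_uminus minus_diff_eq)+
  then show "tau_hat \<tau> h hb e {1..N} \<rho> z u (tau_hat \<tau> h hb e {1..N} \<rho> z u' F) H v
      - tau_hat \<tau> h hb e {1..N} \<rho> z u' (tau_hat \<tau> h hb e {1..N} \<rho> z u F) H v = 0"
    using ga.tau_hat_commute[OF ga.restr_holomorphic_section[OF F] _ _ H] by simp
qed

end
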